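(* Let $E$ be a uniformly smooth and uniformly convex real Banach space, let $g:E\to(-\infty,+\infty]$ be a Legendre function, put $U=\operatorname{int}\operatorname{dom}g$, $U^*=\operatorname{int}\operatorname{dom}g^*$, and let $C\subset U$ be nonempty, closed, convex and bounded. Let $\{\Theta_l\}_{l\ge1}$ be a countable family of equilibrium bifunctions $C\times C\to\mathbb R$, let $\{A_k\}_{k\ge1}$ be a countable family of norm-continuous monotone mappings $C\to E^*$, and let $\{T_j\}_{j\ge1}$ be a countable family of $J_*$-closed generalized Bregman $J_*$-nonexpansive mappings $C\to E^*$. Assume that for all $l,k\ge1$, all $x\in C$ and all $r>0$ the sets $\mathcal Z_r^{\Theta_l}(x)$ and $\mathcal W_r^{A_k}(x)$ are nonempty. Assume that $$\mathcal S:=\Big(\bigcap_{j\ge1}F_J(T_j)\Big)\cap\Big(\bigcap_{l\ge1}\operatorname{EP}(\Theta_l)\Big)\cap\Big(\bigcap_{k\ge1}\operatorname{VI}(C,A_k)\Big)$$ is nonempty. Let $\alpha_1,\alpha_2,\alpha_3\in(0,1)$ with $\alpha_1+\alpha_2+\alpha_3=1$, let $r_0>0$ and $\{r_n\}\subset[r_0,\infty)$, and let $\tau_T,\tau_A,\tau_\Theta:\mathbb N\to\mathbb N$ be mappings each of which takes every value in $\mathbb N$ infinitely often. For $v_1,v_2,v_3\in U$ write $\mathcal M(v_1,v_2,v_3)=\nabla g^*\big(\alpha_1\nabla g(v_1)+\alpha_2\nabla g(v_2)+\alpha_3\nabla g(v_3)\big)$. Suppose that there are bounded sets $K_0,K_1\subset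 U$ and a bounded convex set $K^*\subset U^*$ such that: (i) $C\subset K_0$, $\nabla g(K_0)\subset K^*$, and $\mathcal M(K_0\times K_0\times K_0)\subset K_1$; (ii) $g$ and $\nabla g$ are continuous on a bounded subset of $U$ containing $K_0\cup K_1$, $\nabla g$ is uniformly continuous on $K_0$, and for any sequences $\{\zeta_n\},\{\eta_n\}\subset K_0\cup K_1$, $D_g(\zeta_n,\eta_n)\to0$ implies $\|\zeta_n-\eta_n\|\to0$; (iii) $g^*$ is uniformly convex on $K^*$, and $\nabla g^*$ is bounded and uniformly continuous on $K^*$. Given $x\in C$, put $x_1=x$, $C_1=C$, and for $n\ge1$ $$\begin{cases} z_n=R_{r_n}^{\Theta_{\tau_\Theta(n)}}x_n,\\ u_n=Q_{r_n}^{A_{\tau_A(n)}}x_n,\\ y_n=\mathcal M(x_n,z_n,J_*T_{\tau_T(n)}u_n),\\ C_{n+1}=\{z\in C_n: D_g(z,y_n)\le D_g(z,x_n)\},\\ x_{n+1}=P^g_{C_{n+1}}x.\end{cases}$$ Then $\{x_n\}$ converges strongly (in norm) to $P^g_{\mathcal S}x$.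
   Context: Duality. $E^*$ is the dual of $E$, $\langle\cdot,\cdot\rangle$ the duality pairing, $J:E\to E^*$ the normalized duality mapping, $\langle x,Jx\rangle=\|x\|^2=\|Jx\|^2$. In a uniformly smooth and uniformly convex space $J$ is single-valued and bijective; $J_*:=J^{-1}:E^*\to E$. Generator. A proper, lower semicontinuous, convex function $g:E\to(-\infty,+\infty]$ is Legendre if it is essentially smooth and essentially strictly convex (usual Banach-space sense); then $g$ is differentiable on $U$ and $\nabla g:U\to U^*$ is a bijection with inverse $\nabla g^*$, where $g^*$ is the Fenchel conjugate. The Bregman distance is $D_g(x,y)=g(x)-g(y)-\langle\nabla g(y),x-y\rangle$ for $x\in\operatorname{dom}g$, $y\in U$. Uniform convexity of $g^*$ on a convex set $K^*$ means: there is a nondecreasing $\rho:[0,\infty)\to[0,\infty)$ with $\rho(0)=0$, $\rho(t)>0$ for $t>0$, and $g^*(\lambda s+(1-\lambda)t)\le\lambda g^*(s)+(1-\lambda)g^*(t)-\lambda(1-\lambda)\rho(\|s-t\|)$ for all $s,t\in K^*$, $\lambda\in[0,1]$. Projection. For $D\subset C$ nonempty, closed, convex and $x\in U$, $P^g_Dx$ is the unique minimizer of $z\mapsto D_g(z,x)$ over $D$. Mappings. For $T:C\to E^*$ with $J_*T(C)\subset C$, $F_J(T):=\{p\in C:Tp=Jp\}$. $T$ is generalized Bregman $J_*$-nonexpansive if $J_*T(C)\subset C$, $F_J(T)\ne\emptyset$ and $D_g(p,J_*Tx)\le D_g(p,x)$ for all $x\in C$, $p\in F_J(T)$. $T$ is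 $J_*$-closed if $J_*T(C)\subset C$ and whenever $x_n\to x$ in $C$ and $J_*Tx_n\to y$ in $E$, then $y=J_*Tx$. Equilibrium problems. A bifunction $\Theta:C\times C\to\mathbb R$ is called an equilibrium bifunction here if $\Theta(x,x)=0$ for all $x$; $\Theta(x,y)+\Theta(y,x)\le0$ for all $x,y$; $\limsup_{t\downarrow0}\Theta(tz+(1-t)x,y)\le\Theta(x,y)$ for all $x,y,z$; and $\Theta(x,\cdot)$ is convex and lower semicontinuous on $C$ for each $x$. $\operatorname{EP}(\Theta)=\{x^*\in C:\Theta(x^*,y)\ge0\ \forall y\in C\}$. Variational inequalities. $\operatorname{VI}(C,A)=\{x^*\in C:\langle y-x^*,Ax^*\rangle\ge0\ \forall y\in C\}$. Resolvents. For $r>0$, $x\in C$: $\mathcal Z_r^\Theta(x)=\{z\in C:\Theta(z,y)+\frac1r\langle y-z,\nabla g(z)-\nabla g(x)\rangle\ge0\ \forall y\in C\}$, $\mathcal W_r^A(x)=\{z\in C:\langle y-z,Az\rangle+\frac1r\langle y-z,\nabla g(z)-\nabla g(x)\rangle\ge0\ \forall y\in C\}$. For an equilibrium bifunction $\Theta$ and a monotone $A$, when these sets are nonempty they are singletons; their unique elements are denoted $R_r^\Theta x$ and $Q_r^Ax$. *)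

theory Defs
  imports "HOL-Analysis.Analysis"
begin

text \<open>The dual \<open>E*\<close> of \<open>E = 'a\<close> is \<open>'a \<Rightarrow>\<^sub>L real\<close>; the pairing \<open>\<langle>x, f\<rangle>\<close> is \<open>blinfun_apply f x\<close>.\<close>

definition uniformly_convex_space :: "'a::real_normed_vector itself \<Rightarrow> bool" where
  "uniformly_convex_space _ \<longleftrightarrow>
     (\<forall>\<epsilon>>0. \<exists>\<delta>>0. \<forall>x y::'a. norm x = 1 \<longrightarrow> norm y = 1 \<longrightarrow> norm (x - y) \<ge> \<epsilon> \<longrightarrow>
        norm ((1/2) *\<^sub>R (x + y)) \<le> 1 - \<delta>)"

definition uniformly_smooth_space :: "'a::real_normed_vector itself \<Rightarrow> bool" where
  "uniformly_smooth_space _ \<longleftrightarrow>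
     (\<forall>\<epsilon>>0. \<exists>\<delta>>0. \<forall>x y::'a. norm x = 1 \<longrightarrow> norm y \<le> \<delta> \<longrightarrow>
        norm (x + y) + norm (x - y) \<le> 2 + \<epsilon> * norm y)"

definition duality_set :: "'a::real_normed_vector \<Rightarrow> ('a \<Rightarrow>\<^sub>L real) set" where
  "duality_set x = {f. blinfun_apply f x = (norm x)\<^sup>2 \<and> (norm f)\<^sup>2 = (norm x)\<^sup>2}"

definition duality_map :: "'a::real_normed_vector \<Rightarrow> ('a \<Rightarrow>\<^sub>L real)" where
  "duality_map x = (THE f. f \<in> duality_set x)"

definition duality_map_inv :: "('a::real_normed_vector \<Rightarrow>\<^sub>L real) \<Rightarrow> 'a" where
  "duality_map_inv = inv duality_map"

definition eff_dom :: "('a \<Rightarrow> ereal) \<Rightarrow> 'a set" where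
  "eff_dom g = {x. g x < \<infinity>}"

definition proper_fun :: "('a \<Rightarrow> ereal) \<Rightarrow> bool" where
  "proper_fun g \<longleftrightarrow> (\<forall>x. g x \<noteq> -\<infinity>) \<and> eff_dom g \<noteq> {}"

definition lsc_on :: "'a::topological_space set \<Rightarrow> ('a \<Rightarrow> ereal) \<Rightarrow> bool" where
  "lsc_on S f \<longleftrightarrow> (\<forall>x\<in>S. f x \<le> Liminf (at x within S) f)"

definition convex_ereal :: "('a::real_vector \<Rightarrow> ereal) \<Rightarrow> bool" where
  "convex_ereal g \<longleftrightarrow> (\<forall>x y. \<forall>t\<in>{0..1}.
     g (t *\<^sub>R x + (1 - t) *\<^sub>R y) \<le> ereal t * g x + ereal (1 - t) * g y)"

definition strictly_convex_ereal_on :: "'a::real_vector set \<Rightarrow> ('a \<Rightarrow> ereal) \<Rightarrow> bool" where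
  "strictly_convex_ereal_on S g \<longleftrightarrow> (\<forall>x\<in>S. \<forall>y\<in>S. x \<noteq> y \<longrightarrow> (\<forall>t\<in>{0<..<1}.
     g (t *\<^sub>R x + (1 - t) *\<^sub>R y) < ereal t * g x + ereal (1 - t) * g y))"

definition subdiff :: "('a::real_normed_vector \<Rightarrow> ereal) \<Rightarrow> 'a \<Rightarrow> ('a \<Rightarrow>\<^sub>L real) set" where
  "subdiff g x = {f. x \<in> eff_dom g \<and> (\<forall>y. g x + ereal (blinfun_apply f (y - x)) \<le> g y)}"

definition fenchel_conj :: "('a::real_normed_vector \<Rightarrow> ereal) \<Rightarrow> ('a \<Rightarrow>\<^sub>L real) \<Rightarrow> ereal" where
  "fenchel_conj g f = (SUP x. ereal (blinfun_apply f x) - g x)"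

text \<open>Legendre functions follow Bauschke, Borwein and Combettes.  A set-valued map is represented as a function into sets; its domain consists of the points
  with nonempty value.\<close>

definition locally_bounded_on_dom ::
    "('a::metric_space \<Rightarrow> 'b::metric_space set) \<Rightarrow> bool" where
  "locally_bounded_on_dom F \<longleftrightarrow>
     (\<forall>x. F x \<noteq> {} \<longrightarrow> (\<exists>e>0. bounded (\<Union>y\<in>ball x e. F y)))"

definition single_valued_on_dom :: "('a \<Rightarrow> 'b set) \<Rightarrow> bool" where
  "single_valued_on_dom F \<longleftrightarrow> (\<forall>x. F x \<noteq> {} \<longrightarrow> (\<exists>f. F x = {f}))"

definition essentially_smooth :: "('a::real_normed_vector \<Rightarrow> ereal) \<Rightarrow> bool" where
  "essentially_smooth g \<longleftrightarrow>
     locally_bounded_on_dom (subdiff g) \<and> single_valued_on_dom (subdiff g)"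

definition essentially_strictly_convex :: "('a::real_normed_vector \<Rightarrow> ereal) \<Rightarrow> bool" where
  "essentially_strictly_convex g \<longleftrightarrow>
     locally_bounded_on_dom (\<lambda>f. {x. f \<in> subdiff g x}) \<and>
     (\<forall>S. convex S \<longrightarrow> S \<subseteq> {x. subdiff g x \<noteq> {}} \<longrightarrow> strictly_convex_ereal_on S g)"

definition legendre :: "('a::real_normed_vector \<Rightarrow> ereal) \<Rightarrow> bool" where
  "legendre g \<longleftrightarrow> proper_fun g \<and> lsc_on UNIV g \<and> convex_ereal g \<and>
     essentially_smooth g \<and> essentially_strictly_convex g"

text \<open>Gateaux gradient at an interior point of the effective domain.  Near such a point a proper
  convex function is finite along every line, so passing to real values loses nothing.\<close>

definition has_gradient ::
    "('a::real_normed_vector \<Rightarrow> ereal) \<Rightarrow> ('a \<Rightarrow>\<^sub>L real) \<Rightarrow> 'a \<Rightarrow> bool" where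
  "has_gradient g f x \<longleftrightarrow> x \<in> interior (eff_dom g) \<and>
     (\<forall>h. ((\<lambda>t. real_of_ereal (g (x + t *\<^sub>R h))) has_real_derivative blinfun_apply f h) (at 0))"

definition grad :: "('a::real_normed_vector \<Rightarrow> ereal) \<Rightarrow> 'a \<Rightarrow> ('a \<Rightarrow>\<^sub>L real)" where
  "grad g x = (THE f. has_gradient g f x)"

text \<open>The gradient of the conjugate lives in the bidual; reflexivity identifies it with the
  point of E that induces it by evaluation.\<close>

definition grad_conj :: "('a::real_normed_vector \<Rightarrow> ereal) \<Rightarrow> ('a \<Rightarrow>\<^sub>L real) \<Rightarrow> 'a" where
  "grad_conj g s =
     (THE x. \<forall>f. blinfun_apply (grad (fenchel_conj g) s) f = blinfun_apply f x)"

text \<open>Meaningful for \<open>x\<close> in the effective domain and \<open>y\<close> in its interior.\<close>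

definition bregman :: "('a::real_normed_vector \<Rightarrow> ereal) \<Rightarrow> 'a \<Rightarrow> 'a \<Rightarrow> real" where
  "bregman g x y =
     real_of_ereal (g x) - real_of_ereal (g y) - blinfun_apply (grad g y) (x - y)"

definition bregman_proj :: "('a::real_normed_vector \<Rightarrow> ereal) \<Rightarrow> 'a set \<Rightarrow> 'a \<Rightarrow> 'a" where
  "bregman_proj g D x = (THE z. z \<in> D \<and> (\<forall>w\<in>D. bregman g z x \<le> bregman g w x))"

definition uniformly_convex_fun_on :: "'a::real_normed_vector set \<Rightarrow> ('a \<Rightarrow> ereal) \<Rightarrow> bool" where
  "uniformly_convex_fun_on K h \<longleftrightarrow>
     (\<exists>\<rho>::real \<Rightarrow> real. mono_on {0..} \<rho> \<and> \<rho> 0 = 0 \<and> (\<forall>t>0. \<rho> t > 0) \<and>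
        (\<forall>s\<in>K. \<forall>t\<in>K. \<forall>l\<in>{0..1}.
           h (l *\<^sub>R s + (1 - l) *\<^sub>R t)
             \<le> ereal l * h s + ereal (1 - l) * h t - ereal (l * (1 - l) * \<rho> (norm (s - t)))))"

definition bregman_mean ::
    "('a::real_normed_vector \<Rightarrow> ereal) \<Rightarrow> real \<Rightarrow> real \<Rightarrow> real \<Rightarrow> 'a \<Rightarrow> 'a \<Rightarrow> 'a \<Rightarrow> 'a" where
  "bregman_mean g a1 a2 a3 v1 v2 v3 =
     grad_conj g (a1 *\<^sub>R grad g v1 + a2 *\<^sub>R grad g v2 + a3 *\<^sub>R grad g v3)"

definition FJ :: "'a::real_normed_vector set \<Rightarrow> ('a \<Rightarrow> ('a \<Rightarrow>\<^sub>L real)) \<Rightarrow> 'a set" where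
  "FJ C T = {p \<in> C. T p = duality_map p}"

definition Jstar_self_map :: "'a::real_normed_vector set \<Rightarrow> ('a \<Rightarrow> ('a \<Rightarrow>\<^sub>L real)) \<Rightarrow> bool" where
  "Jstar_self_map C T \<longleftrightarrow> (\<forall>x\<in>C. duality_map_inv (T x) \<in> C)"

definition gen_bregman_Jstar_nonexpansive ::
    "('a::real_normed_vector \<Rightarrow> ereal) \<Rightarrow> 'a set \<Rightarrow> ('a \<Rightarrow> ('a \<Rightarrow>\<^sub>L real)) \<Rightarrow> bool" where
  "gen_bregman_Jstar_nonexpansive g C T \<longleftrightarrow> Jstar_self_map C T \<and> FJ C T \<noteq> {} \<and>
     (\<forall>x\<in>C. \<forall>p\<in>FJ C T. bregman g p (duality_map_inv (T x)) \<le> bregman g p x)"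

definition Jstar_closed :: "'a::real_normed_vector set \<Rightarrow> ('a \<Rightarrow> ('a \<Rightarrow>\<^sub>L real)) \<Rightarrow> bool" where
  "Jstar_closed C T \<longleftrightarrow> Jstar_self_map C T \<and>
     (\<forall>X x y. (\<forall>n. X n \<in> C) \<longrightarrow> x \<in> C \<longrightarrow> X \<longlonglongrightarrow> x \<longrightarrow>
        (\<lambda>n::nat. duality_map_inv (T (X n))) \<longlonglongrightarrow> y \<longrightarrow> y = duality_map_inv (T x))"

definition monotone_map_on :: "'a::real_normed_vector set \<Rightarrow> ('a \<Rightarrow> ('a \<Rightarrow>\<^sub>L real)) \<Rightarrow> bool" where
  "monotone_map_on C A \<longleftrightarrow> (\<forall>x\<in>C. \<forall>y\<in>C. blinfun_apply (A x - A y) (x - y) \<ge> 0)"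

definition equilibrium_bifunction ::
    "'a::real_normed_vector set \<Rightarrow> ('a \<Rightarrow> 'a \<Rightarrow> real) \<Rightarrow> bool" where
  "equilibrium_bifunction C \<Theta> \<longleftrightarrow>
     (\<forall>x\<in>C. \<Theta> x x = 0) \<and>
     (\<forall>x\<in>C. \<forall>y\<in>C. \<Theta> x y + \<Theta> y x \<le> 0) \<and>
     (\<forall>x\<in>C. \<forall>y\<in>C. \<forall>z\<in>C.
        Limsup (at_right 0) (\<lambda>t. ereal (\<Theta> (t *\<^sub>R z + (1 - t) *\<^sub>R x) y)) \<le> ereal (\<Theta> x y)) \<and>
     (\<forall>x\<in>C. convex_on C (\<Theta> x) \<and> lsc_on C (\<lambda>y. ereal (\<Theta> x y)))"

definition EP :: "'a set \<Rightarrow> ('a \<Rightarrow> 'a \<Rightarrow> real) \<Rightarrow> 'a set" where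
  "EP C \<Theta> = {z \<in> C. \<forall>y\<in>C. \<Theta> z y \<ge> 0}"

definition VI :: "'a::real_normed_vector set \<Rightarrow> ('a \<Rightarrow> ('a \<Rightarrow>\<^sub>L real)) \<Rightarrow> 'a set" where
  "VI C A = {z \<in> C. \<forall>y\<in>C. blinfun_apply (A z) (y - z) \<ge> 0}"

definition EP_resolvent_set ::
    "('a::real_normed_vector \<Rightarrow> ereal) \<Rightarrow> 'a set \<Rightarrow> ('a \<Rightarrow> 'a \<Rightarrow> real) \<Rightarrow> real \<Rightarrow> 'a \<Rightarrow> 'a set" where
  "EP_resolvent_set g C \<Theta> r x =
     {z \<in> C. \<forall>y\<in>C. \<Theta> z y + (1 / r) * blinfun_apply (grad g z - grad g x) (y - z) \<ge> 0}"

definition VI_resolvent_set ::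
    "('a::real_normed_vector \<Rightarrow> ereal) \<Rightarrow> 'a set \<Rightarrow> ('a \<Rightarrow> ('a \<Rightarrow>\<^sub>L real)) \<Rightarrow> real \<Rightarrow> 'a \<Rightarrow> 'a set" where
  "VI_resolvent_set g C A r x =
     {z \<in> C. \<forall>y\<in>C. blinfun_apply (A z) (y - z)
                     + (1 / r) * blinfun_apply (grad g z - grad g x) (y - z) \<ge> 0}"

definition EP_resolvent ::
    "('a::real_normed_vector \<Rightarrow> ereal) \<Rightarrow> 'a set \<Rightarrow> ('a \<Rightarrow> 'a \<Rightarrow> real) \<Rightarrow> real \<Rightarrow> 'a \<Rightarrow> 'a" where
  "EP_resolvent g C \<Theta> r x = (THE z. z \<in> EP_resolvent_set g C \<Theta> r x)"

definition VI_resolvent ::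
    "('a::real_normed_vector \<Rightarrow> ereal) \<Rightarrow> 'a set \<Rightarrow> ('a \<Rightarrow> ('a \<Rightarrow>\<^sub>L real)) \<Rightarrow> real \<Rightarrow> 'a \<Rightarrow> 'a" where
  "VI_resolvent g C A r x = (THE z. z \<in> VI_resolvent_set g C A r x)"

text \<open>Index sets start at 1; the value at 0 is irrelevant.\<close>

definition inf_often_index_map :: "(nat \<Rightarrow> nat) \<Rightarrow> bool" where
  "inf_often_index_map \<tau> \<longleftrightarrow>
     (\<forall>n\<ge>1. \<tau> n \<ge> 1) \<and> (\<forall>k\<ge>1. infinite {n. n \<ge> 1 \<and> \<tau> n = k})"

end

(* Weak compactness is never needed: in a uniformly convex Banach space a decreasing sequence of
   nonempty bounded closed convex sets has a common point.  Applied to sublevel sets this makes the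
   gradient of g map onto int dom g*, and makes g* Gateaux differentiable there with gradient the
   unique preimage.  Young's equality then turns uniform convexity of g* into
     D(p, y_n) <= D(p, x_n) - a2 D(z_n, x_n) - a3 D(u_n, x_n) - c rho(|grad g(x_n) - grad g(w_n)|)
   for p in S, where w_n = J_* T u_n.  So S lies in every C_n; D(x_n, x) is increasing and bounded,
   and the three-point inequality makes x_n Cauchy, with limit q say.  As y_n also tends to q, the
   left-over terms vanish, z_n, u_n and w_n tend to q, and q is in S.  Finally q minimises D(., x)
   over the intersection of all C_n, which contains S. *)

theory Submission
  imports Defs
begin

section \<open>The Hahn-Banach theorem\<close>

text \<open>\<open>legendre\<close> speaks of subdifferentials only, while \<open>grad\<close>,
  \<open>grad_conj\<close>, the resolvents and the projection are definite descriptions. So every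
  object of the scheme has to be shown to exist and to be unique before an inequality about it says
  anything. Hahn-Banach enters twice. Dominated by a directional derivative, it yields a subgradient
  that is exact in one prescribed direction; essential smoothness makes these subgradients one
  functional, which is then the Gateaux gradient. Dominated by the norm, it yields functionals that
  separate points, so that a gradient of the conjugate, an element of the bidual, is identified with
  a point of E, and that bound a vector by its values on a ball of functionals. Uniqueness of
  projections and resolvents comes from hypothesis (ii) on constant sequences: D(u, v) = 0 forces u
  = v. A variational inequality is the equilibrium problem of the bifunction sending (z, y) to the
  value of A z at y - z, so one resolvent estimate and one limit lemma serve both families.\<close>

definition sublinear :: "('a::real_vector \<Rightarrow> real) \<Rightarrow> bool" where
  "sublinear p \<longleftrightarrow> (\<forall>x y. p (x + y) \<le> p x + p y) \<and> (\<forall>c\<ge>0. \<forall>x. p (c *\<^sub>R x) = c * p x)"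

lemma sublinear_0: "sublinear p \<Longrightarrow> p 0 = 0"
  unfolding sublinear_def by (metis mult_zero_left order_refl scaleR_zero_left)

lemma sublinear_ge: "sublinear p \<Longrightarrow> - p (- x) \<le> p x"
  using sublinear_0[of p] unfolding sublinear_def
  by (metis add.right_inverse add.commute diff_ge_0_iff_ge diff_minus_eq_add)

text \<open>One inequality suffices for positive homogeneity: used with \<open>inverse c\<close> at
  \<open>c *\<^sub>R x\<close> it gives the reverse one. Functionals defined as infima satisfy the
  one-sided version directly.\<close>

lemma sublinear_homogI:
  assumes "\<And>x y. p (x + y) \<le> p x + p y" "p 0 = 0"
    and "\<And>c x. c > 0 \<Longrightarrow> p (c *\<^sub>R x) \<le> c * p x"
  shows "sublinear p"
  unfolding sublinear_def
proof (intro conjI allI impI)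
  fix c :: real and x :: 'a assume "0 \<le> c"
  show "p (c *\<^sub>R x) = c * p x"
  proof (cases "c = 0")
    case False
    with \<open>0 \<le> c\<close> have c: "c > 0" by simp
    have "p (inverse c *\<^sub>R (c *\<^sub>R x)) \<le> inverse c * p (c *\<^sub>R x)"
      using assms(3) c by (meson positive_imp_inverse_positive)
    hence "c * p x \<le> p (c *\<^sub>R x)"
      using c by (simp add: field_simps)
    with assms(3)[OF c, of x] show ?thesis by linarith
  qed (simp add: assms)
qed (rule assms)

text \<open>Among the sublinear functionals below \<open>p\<close>, this one is as small as possible at \<open>- h\<close>.\<close>

definition sublinear_tilt :: "('a::real_vector \<Rightarrow> real) \<Rightarrow> 'a \<Rightarrow> 'a \<Rightarrow> real" where
  "sublinear_tilt p h x = (INF t\<in>{0..}. p (x + t *\<^sub>R h) - t * p h)"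

text \<open>The infimum is finite because t p(h) = p(t h) \<le> p(x + t h) + p(- x). The last clause
  is the competitor t = 1 at - h; it is what will make a minimal functional odd.\<close>

lemma sublinear_tilt:
  assumes p: "sublinear p"
  shows "sublinear (sublinear_tilt p h)" "sublinear_tilt p h x \<le> p x"
    "sublinear_tilt p h (- h) \<le> - p h"
proof -
  have add: "p (x + y) \<le> p x + p y" and hom: "c \<ge> 0 \<Longrightarrow> p (c *\<^sub>R x) = c * p x" for x y c
    using p by (auto simp: sublinear_def)
  have low: "- p (- x) \<le> p (x + t *\<^sub>R h) - t * p h" if "t \<ge> 0" for x t
    using add[of "x + t *\<^sub>R h" "- x"] hom[OF that, of h] by simp
  have bdd: "bdd_below ((\<lambda>t. p (x + t *\<^sub>R h) - t * p h) ` {0..})" for x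
    by (rule bdd_belowI[of _ "- p (- x)"]) (use low in auto)
  have upper: "sublinear_tilt p h x \<le> p (x + t *\<^sub>R h) - t * p h" if "t \<ge> 0" for x t
    unfolding sublinear_tilt_def by (rule cINF_lower[OF bdd]) (use that in auto)
  have greatest: "m \<le> sublinear_tilt p h x"
    if "\<And>t. t \<ge> 0 \<Longrightarrow> m \<le> p (x + t *\<^sub>R h) - t * p h" for m x
    unfolding sublinear_tilt_def by (rule cINF_greatest) (use that in auto)
  show le: "sublinear_tilt p h x \<le> p x" for x
    using upper[of 0 x] by simp
  show "sublinear_tilt p h (- h) \<le> - p h"
    using upper[of 1 "- h"] sublinear_0[OF p] by simp
  show "sublinear (sublinear_tilt p h)"
  proof (rule sublinear_homogI)
    fix x y
    \<comment> \<open>If s and t are competitors at x and y, then s + t is one at x + y. One infimum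
      is taken at a time, hence the subtraction on the left.\<close>
    have "sublinear_tilt p h (x + y) - (p (y + t *\<^sub>R h) - t * p h) \<le> sublinear_tilt p h x"
      if t: "t \<ge> 0" for t
    proof (rule greatest)
      fix s :: real assume s: "s \<ge> 0"
      have "sublinear_tilt p h (x + y) \<le> p (x + y + (s + t) *\<^sub>R h) - (s + t) * p h"
        using upper s t by simp
      also have "x + y + (s + t) *\<^sub>R h = (x + s *\<^sub>R h) + (y + t *\<^sub>R h)"
        by (simp add: algebra_simps)
      finally show "sublinear_tilt p h (x + y) - (p (y + t *\<^sub>R h) - t * p h) \<le> p (x + s *\<^sub>R h) - s * p h"
        using add[of "x + s *\<^sub>R h" "y + t *\<^sub>R h"] by (simp add: algebra_simps)
    qed
    hence "sublinear_tilt p h (x + y) - sublinear_tilt p h x \<le> sublinear_tilt p h y"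
      by (intro greatest) (simp add: algebra_simps)
    thus "sublinear_tilt p h (x + y) \<le> sublinear_tilt p h x + sublinear_tilt p h y" by simp
  next
    have "0 \<le> sublinear_tilt p h 0"
      by (rule greatest) (simp add: hom)
    thus "sublinear_tilt p h 0 = 0"
      using le[of 0] sublinear_0[OF p] by simp
  next
    fix c :: real and x assume c: "c > 0"
    have "inverse c * sublinear_tilt p h (c *\<^sub>R x) \<le> sublinear_tilt p h x"
    proof (rule greatest)
      fix t :: real assume t: "t \<ge> 0"
      have "sublinear_tilt p h (c *\<^sub>R x) \<le> p (c *\<^sub>R x + (c * t) *\<^sub>R h) - (c * t) * p h"
        using upper c t by simp
      also have "c *\<^sub>R x + (c * t) *\<^sub>R h = c *\<^sub>R (x + t *\<^sub>R h)"
        by (simp add: algebra_simps)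
      also have "p \<dots> = c * p (x + t *\<^sub>R h)" using c hom by simp
      finally show "inverse c * sublinear_tilt p h (c *\<^sub>R x) \<le> p (x + t *\<^sub>R h) - t * p h"
        using c by (simp add: field_simps)
    qed
    thus "sublinear_tilt p h (c *\<^sub>R x) \<le> c * sublinear_tilt p h x"
      using c by (simp add: field_simps)
  qed
qed

text \<open>A pointwise infimum of sublinear functionals is in general not subadditive. In a chain,
  of two members nearly optimal at x and at y the smaller one may be used at both points. The common
  lower bound at x is \<open>- p (- x)\<close>.\<close>

lemma sublinear_INF_chain:
  assumes "Q \<noteq> {}" "\<And>q. q \<in> Q \<Longrightarrow> sublinear q" "\<And>q x. q \<in> Q \<Longrightarrow> q x \<le> p x"
    and chain: "\<And>q q'. q \<in> Q \<Longrightarrow> q' \<in> Q \<Longrightarrow> (\<forall>x. q x \<le> q' x) \<or> (\<forall>x. q' x \<le> q x)"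
  shows "sublinear (\<lambda>x. INF q\<in>Q. q x)" "q \<in> Q \<Longrightarrow> (INF q\<in>Q. q x) \<le> q x"
proof -
  have bdd: "bdd_below ((\<lambda>q. q x) ` Q)" for x
  proof (rule bdd_belowI[of _ "- p (- x)"])
    fix y assume "y \<in> (\<lambda>q. q x) ` Q"
    then obtain q where "q \<in> Q" "y = q x" by auto
    thus "- p (- x) \<le> y"
      using sublinear_ge[OF assms(2), of q x] assms(3)[of q "- x"] by simp
  qed
  show lower: "(INF q\<in>Q. q x) \<le> q x" if "q \<in> Q" for q x
    by (rule cINF_lower[OF bdd that])
  have greatest: "m \<le> (INF q\<in>Q. q x)" if "\<And>q. q \<in> Q \<Longrightarrow> m \<le> q x" for m x
    using that assms(1) by (intro cINF_greatest)
  show "sublinear (\<lambda>x. INF q\<in>Q. q x)"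
  proof (rule sublinear_homogI)
    fix x y
    have "(INF q\<in>Q. q (x + y)) - q y \<le> (INF q\<in>Q. q x)" if q: "q \<in> Q" for q
    proof (rule greatest)
      fix q' assume q': "q' \<in> Q"
      consider "\<forall>x. q x \<le> q' x" | "\<forall>x. q' x \<le> q x" using chain[OF q q'] by blast
      thus "(INF q\<in>Q. q (x + y)) - q y \<le> q' x"
      proof cases
        case 1
        have "q (x + y) \<le> q x + q y" using assms(2)[OF q] by (auto simp: sublinear_def)
        thus ?thesis using lower[OF q, of "x + y"] 1[rule_format, of x] by linarith
      next
        case 2
        have "q' (x + y) \<le> q' x + q' y" using assms(2)[OF q'] by (auto simp: sublinear_def)
        thus ?thesis using lower[OF q', of "x + y"] 2[rule_format, of y] by linarith
      qed
    qed
    hence "(INF q\<in>Q. q (x + y)) - (INF q\<in>Q. q x) \<le> (INF q\<in>Q. q y)"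
      by (intro greatest) (simp add: algebra_simps)
    thus "(INF q\<in>Q. q (x + y)) \<le> (INF q\<in>Q. q x) + (INF q\<in>Q. q y)" by simp
  next
    have "(INF q\<in>Q. q 0) = (INF q\<in>Q. 0::real)"
      by (intro INF_cong) (auto simp: sublinear_0 assms)
    thus "(INF q\<in>Q. q 0) = 0" using assms(1) by simp
  next
    fix c :: real and x assume c: "c > 0"
    have "inverse c * (INF q\<in>Q. q (c *\<^sub>R x)) \<le> (INF q\<in>Q. q x)"
    proof (rule greatest)
      fix q assume q: "q \<in> Q"
      have "q (c *\<^sub>R x) = c * q x" using assms(2)[OF q] c by (auto simp: sublinear_def)
      thus "inverse c * (INF q\<in>Q. q (c *\<^sub>R x)) \<le> q x"
        using lower[OF q, of "c *\<^sub>R x"] c by (simp add: field_simps)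
    qed
    thus "(INF q\<in>Q. q (c *\<^sub>R x)) \<le> c * (INF q\<in>Q. q x)"
      using c by (simp add: field_simps)
  qed
qed

lemma minimal_sublinear_exists:
  assumes p: "sublinear p"
  obtains q where "sublinear q" "\<And>x. q x \<le> p x"
    "\<And>q'. sublinear q' \<Longrightarrow> (\<And>x. q' x \<le> q x) \<Longrightarrow> q' = q"
proof -
  define A where "A = {q. sublinear q \<and> (\<forall>x. q x \<le> p x)}"
  \<comment> \<open>The order is reversed: a maximal element in the sense of Zorn is a pointwise
    minimal functional, and chains are bounded by their infima.\<close>
  let ?P = "\<lambda>q q' :: 'a \<Rightarrow> real. \<forall>x. q' x \<le> q x"
  have "\<exists>m\<in>A. \<forall>a\<in>A. ?P m a \<longrightarrow> a = m"
  proof (rule predicate_Zorn)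
    show "partial_order_on A (relation_of ?P A)"
      by (rule partial_order_on_relation_ofI) (auto intro: order_trans intro!: ext antisym)
  next
    fix Q assume Q: "Q \<in> Chains (relation_of ?P A)"
    hence QA: "Q \<subseteq> A" and ch: "\<And>q q'. q \<in> Q \<Longrightarrow> q' \<in> Q \<Longrightarrow> ?P q q' \<or> ?P q' q"
      by (auto simp: Chains_def relation_of_def)
    show "\<exists>u\<in>A. \<forall>a\<in>Q. ?P a u"
    proof (cases "Q = {}")
      case True
      thus ?thesis using p by (auto simp: A_def)
    next
      case False
      note I = sublinear_INF_chain[of Q p, OF False]
      have s: "sublinear (\<lambda>x. INF q\<in>Q. q x)"
        by (rule I(1)) (use QA ch in \<open>auto simp: A_def\<close>)
      have l: "(INF q\<in>Q. q x) \<le> q x" if "q \<in> Q" for q x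
        by (rule I(2)) (use QA ch that in \<open>auto simp: A_def\<close>)
      have "(INF q\<in>Q. q x) \<le> p x" for x
        using False l QA unfolding A_def by (metis (mono_tags, lifting) all_not_in_conv mem_Collect_eq order_trans subset_iff)
      with s l show ?thesis by (auto simp: A_def intro!: bexI[of _ "\<lambda>x. INF q\<in>Q. q x"])
    qed
  qed
  then obtain q where q: "q \<in> A" "\<And>a. a \<in> A \<Longrightarrow> ?P q a \<Longrightarrow> a = q" by blast
  show thesis
  proof (rule that)
    fix q' assume "sublinear q'" "\<And>x. q' x \<le> q x"
    moreover from this q(1) have "q' \<in> A" by (auto simp: A_def intro: order_trans)
    ultimately show "q' = q" using q(2) by blast
  qed (use q(1) in \<open>auto simp: A_def\<close>)
qed

text \<open>A minimal sublinear functional equals all its tilts, so it is odd, hence linear; starting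
  from the tilt of \<open>p\<close> at \<open>h\<close> forces equality at \<open>h\<close>.\<close>

theorem Hahn_Banach_sublinear:
  assumes p: "sublinear p"
  obtains f where "linear f" "\<And>x. f x \<le> p x" "f h = p h"
proof -
  obtain q where q: "sublinear q" "\<And>x. q x \<le> sublinear_tilt p h x"
    and min: "\<And>q'. sublinear q' \<Longrightarrow> (\<And>x. q' x \<le> q x) \<Longrightarrow> q' = q"
    using minimal_sublinear_exists[OF sublinear_tilt(1)[OF p, of h]] by metis
  have add: "q (x + y) \<le> q x + q y" and hom: "c \<ge> 0 \<Longrightarrow> q (c *\<^sub>R x) = c * q x" for x y c
    using q(1) by (auto simp: sublinear_def)
  have odd: "q (- x) = - q x" for x
  proof -
    have "sublinear_tilt q x = q"
      by (rule min) (use sublinear_tilt[OF q(1)] in auto)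
    hence "q (- x) \<le> - q x" using sublinear_tilt(3)[OF q(1), of x] by simp
    with sublinear_ge[OF q(1), of x] show ?thesis by simp
  qed
  have "linear q"
  proof (rule linearI)
    fix x y show "q (x + y) = q x + q y"
      using add[of x y] add[of "- x" "- y"] odd[of "x + y"] odd[of x] odd[of y] by simp
  next
    fix c :: real and x show "q (c *\<^sub>R x) = c *\<^sub>R q x"
      using hom[of c x] hom[of "- c" x] odd[of "c *\<^sub>R x"] by (cases "c \<ge> 0") auto
  qed
  moreover have le: "q x \<le> p x" for x
    using q(2) sublinear_tilt(2)[OF p] by (meson order_trans)
  moreover have "q h = p h"
    using q(2)[of "- h"] sublinear_tilt(3)[OF p, of h] odd[of h] le[of h] by simp
  ultimately show thesis by (rule that)
qed

text \<open>Hahn-Banach with the norm as dominating functional: contact at h gives the value,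
  domination at x and - x gives the bound on the norm.\<close>

lemma norming_functional:
  fixes h :: "'a::real_normed_vector"
  obtains f :: "'a \<Rightarrow>\<^sub>L real" where "norm f \<le> 1" "blinfun_apply f h = norm h"
proof -
  have "sublinear (norm :: 'a \<Rightarrow> real)"
    by (auto simp: sublinear_def norm_triangle_ineq)
  then obtain f :: "'a \<Rightarrow> real" where f: "linear f" "\<And>x. f x \<le> norm x" "f h = norm h"
    using Hahn_Banach_sublinear by metis
  have "\<bar>f x\<bar> \<le> norm x" for x
    using f(2)[of x] f(2)[of "- x"] linear_neg[OF f(1), of x] by (simp add: abs_le_iff)
  hence b: "bounded_linear f"
    using f(1) by (intro bounded_linear_intro[where K = 1]) (auto simp: linear_add linear_scale)
  show thesis
  proof (rule that[of "Blinfun f"])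
    show "norm (Blinfun f) \<le> 1"
      by (rule norm_blinfun_bound) (use \<open>\<And>x. \<bar>f x\<bar> \<le> norm x\<close> b in \<open>auto simp: bounded_linear_Blinfun_apply\<close>)
  qed (use b f in \<open>simp add: bounded_linear_Blinfun_apply\<close>)
qed

lemma blinfun_separates:
  assumes "\<And>f :: 'a::real_normed_vector \<Rightarrow>\<^sub>L real. blinfun_apply f x = blinfun_apply f y"
  shows "x = y"
proof -
  obtain f :: "'a \<Rightarrow>\<^sub>L real" where "blinfun_apply f (x - y) = norm (x - y)"
    using norming_functional by metis
  thus ?thesis using assms[of f] by (simp add: blinfun.diff_right)
qed

text \<open>A norming functional of x, scaled to length d, is admissible. This later turns an upper
  bound for the conjugate on a ball into a norm bound on a sublevel set.\<close>

lemma norm_le_functional_bound: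
  fixes x :: "'a::real_normed_vector"
  assumes "d > 0" "\<And>f :: 'a \<Rightarrow>\<^sub>L real. norm f \<le> d \<Longrightarrow> blinfun_apply f x \<le> M"
  shows "norm x \<le> M / d"
proof -
  obtain f :: "'a \<Rightarrow>\<^sub>L real" where f: "norm f \<le> 1" "blinfun_apply f x = norm x"
    using norming_functional by metis
  have "norm (d *\<^sub>R f) \<le> d" using f(1) assms(1) by simp
  from assms(2)[OF this] f(2) assms(1) show ?thesis
    by (simp add: blinfun.scaleR_left field_simps)
qed

section \<open>Uniformly convex spaces\<close>

text \<open>The normalised vectors u n are asymptotically a n / d, and their midpoints have norm
  close to 1, so uniform convexity pushes them together. For d = 0 the sequence itself tends to
  0.\<close>

lemma uniformly_convex_almost_minimal_Cauchy:
  fixes a :: "nat \<Rightarrow> 'a::real_normed_vector"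
  assumes uc: "uniformly_convex_space TYPE('a)"
    and lim: "(\<lambda>n. norm (a n)) \<longlonglongrightarrow> d"
    and mid: "\<And>e. e > 0 \<Longrightarrow> \<exists>N. \<forall>m\<ge>N. \<forall>n\<ge>N. norm ((1/2) *\<^sub>R (a m + a n)) \<ge> d - e"
  shows "Cauchy a"
proof (cases "d = 0")
  case True
  hence "a \<longlonglongrightarrow> 0" using lim tendsto_norm_zero_iff by blast
  thus ?thesis by (rule LIMSEQ_imp_Cauchy)
next
  case False
  have "d \<ge> 0" using lim by (rule LIMSEQ_le_const) auto
  with False have d: "d > 0" by simp
  have nd: "norm (z /\<^sub>R d) = norm z / d" for z :: 'a
    using d by (simp add: divide_inverse_commute)
  define u where "u n = a n /\<^sub>R norm (a n)" for n
  have diff: "(\<lambda>n. norm (u n - a n /\<^sub>R d)) \<longlonglongrightarrow> 0"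
  proof -
    have "(\<lambda>n. \<bar>inverse (norm (a n)) - inverse d\<bar> * norm (a n)) \<longlonglongrightarrow> \<bar>inverse d - inverse d\<bar> * d"
      by (intro tendsto_intros lim) (use d in auto)
    moreover have "norm (u n - a n /\<^sub>R d) = \<bar>inverse (norm (a n)) - inverse d\<bar> * norm (a n)" for n
      by (simp add: u_def flip: scaleR_diff_left)
    ultimately show ?thesis by simp
  qed
  show ?thesis
  proof (rule metric_CauchyI)
    fix e :: real assume e: "e > 0"
    define e' where "e' = e / (2 * d)"
    have e': "e' > 0" using e d by (simp add: e'_def)
    then obtain \<delta> where \<delta>: "\<delta> > 0"
      and uc': "\<And>x y :: 'a. norm x = 1 \<Longrightarrow> norm y = 1 \<Longrightarrow> norm (x - y) \<ge> e' \<Longrightarrow>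
        norm ((1/2) *\<^sub>R (x + y)) \<le> 1 - \<delta>"
      using uc unfolding uniformly_convex_space_def by metis
    \<comment> \<open>The midpoint of u m and u n loses one \<eta> to \<open>mid\<close> and one to
      the normalisation, and 2 \<eta> < \<delta>. The two normalisation errors in the final
      difference stay below e', so that it is below 2 e' = e / d.\<close>
    define \<eta> where "\<eta> = min (\<delta> / 4) (e' / 4)"
    have \<eta>: "\<eta> > 0" "\<eta> \<le> \<delta> / 4" "\<eta> \<le> e' / 4" using \<delta> e' by (auto simp: \<eta>_def)
    obtain N1 where N1: "\<And>n. n \<ge> N1 \<Longrightarrow> norm (u n - a n /\<^sub>R d) < \<eta>"
      using LIMSEQ_D[OF diff \<eta>(1)] by auto
    obtain N2 where N2: "\<And>n. n \<ge> N2 \<Longrightarrow> norm (a n) > 0"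
      using order_tendstoD(1)[OF lim d] by (auto simp: eventually_sequentially)
    obtain N3 where N3: "\<And>m n. m \<ge> N3 \<Longrightarrow> n \<ge> N3 \<Longrightarrow> norm ((1/2) *\<^sub>R (a m + a n)) \<ge> d - d * \<eta>"
      using mid[of "d * \<eta>"] d \<eta>(1) by auto
    show "\<exists>M. \<forall>m\<ge>M. \<forall>n\<ge>M. dist (a m) (a n) < e"
    proof (intro exI allI impI)
      fix m n assume mn: "max N1 (max N2 N3) \<le> m" "max N1 (max N2 N3) \<le> n"
      have un: "norm (u m) = 1" "norm (u n) = 1" using N2 mn by (auto simp: u_def)
      have "(1/2) *\<^sub>R (a m + a n) /\<^sub>R d - (1/2) *\<^sub>R (u m + u n) =
          (1/2) *\<^sub>R (- (u m - a m /\<^sub>R d) - (u n - a n /\<^sub>R d))"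
        by (simp add: algebra_simps)
      also have "norm \<dots> \<le> \<eta>"
        using norm_triangle_ineq4[of "- (u m - a m /\<^sub>R d)" "u n - a n /\<^sub>R d"]
          N1[of m] N1[of n] mn norm_minus_cancel[of "u m - a m /\<^sub>R d"] by simp
      finally have "norm ((1/2) *\<^sub>R (a m + a n) /\<^sub>R d) \<le> norm ((1/2) *\<^sub>R (u m + u n)) + \<eta>"
        by (smt (verit) norm_triangle_sub)
      moreover have "norm ((1/2) *\<^sub>R (a m + a n) /\<^sub>R d) \<ge> 1 - \<eta>"
      proof -
        have "norm ((1/2) *\<^sub>R (a m + a n)) \<ge> (1 - \<eta>) * d"
          using N3[of m n] mn by (simp add: algebra_simps)
        hence "norm ((1/2) *\<^sub>R (a m + a n)) / d \<ge> 1 - \<eta>"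
          using d by (simp add: pos_le_divide_eq)
        thus ?thesis by (simp only: nd)
      qed
      ultimately have "norm ((1/2) *\<^sub>R (u m + u n)) > 1 - \<delta>" using \<eta> \<delta> by linarith
      hence "norm (u m - u n) < e'" using uc'[OF un] by linarith
      moreover have "a m /\<^sub>R d - a n /\<^sub>R d = (u m - u n) - (u m - a m /\<^sub>R d) + (u n - a n /\<^sub>R d)" by simp
      hence "norm (a m /\<^sub>R d - a n /\<^sub>R d) \<le> norm (u m - u n) + norm (u m - a m /\<^sub>R d) + norm (u n - a n /\<^sub>R d)"
        by (metis add_mono_thms_linordered_semiring(3) norm_triangle_ineq norm_triangle_ineq4 order_trans)
      ultimately have "norm (a m /\<^sub>R d - a n /\<^sub>R d) < 2 * e'"
        using N1[of m] N1[of n] mn \<eta> by auto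
      hence "norm (a m - a n) / d < 2 * e'"
        by (simp only: nd flip: scaleR_diff_right)
      thus "dist (a m) (a n) < e" using d by (simp add: e'_def dist_norm field_simps)
    qed
  qed
qed

text \<open>In a uniformly convex space this replaces weak compactness: points of almost minimal norm in
  the sets form a Cauchy sequence.\<close>

theorem uniformly_convex_nested_Inter:
  fixes K :: "nat \<Rightarrow> 'a::banach set"
  assumes uc: "uniformly_convex_space TYPE('a)"
    and K: "\<And>n. closed (K n)" "\<And>n. convex (K n)" "\<And>n. K n \<noteq> {}" "\<And>n. K (Suc n) \<subseteq> K n"
    and bnd: "bounded (K 0)"
  shows "(\<Inter>n. K n) \<noteq> {}"
proof -
  have dec: "K n \<subseteq> K m" if "m \<le> n" for m n
    using that K(4) by (rule lift_Suc_antimono_le[of K, rotated])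
  define d where "d n = infdist 0 (K n)" for n
  have dlow: "d n \<le> norm y" if "y \<in> K n" for n y
    using infdist_le[OF that, of 0] by (simp add: d_def)
  have mono: "d m \<le> d n" if "m \<le> n" for m n
    unfolding d_def using that dec K(3) by (intro infdist_mono) auto
  obtain R where R: "\<And>y. y \<in> K 0 \<Longrightarrow> norm y \<le> R" using bnd by (auto simp: bounded_iff)
  have "d n \<le> R" for n
    using K(3)[of n] dec[of 0 n] dlow[of _ n] R by (meson all_not_in_conv order_trans subsetD zero_le)
  hence "Bseq d"
    by (intro BseqI'[of _ R]) (simp add: d_def infdist_nonneg)
  moreover have "monoseq d" using mono by (intro monoI1) auto
  ultimately have "convergent d" by (rule Bseq_monoseq_convergent)
  then obtain D where D: "d \<longlonglongrightarrow> D" by (auto simp: convergent_def)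
  have dD: "d n \<le> D" for n
    using D mono by (intro incseq_le) (auto simp: incseq_def)
  have "\<exists>a\<in>K n. norm a < d n + 1 / Suc n" for n
  proof -
    have "infdist 0 (K n) < d n + 1 / Suc n" by (simp add: d_def)
    moreover have "bdd_below (norm ` K n)" by (rule bdd_belowI2[of _ 0]) simp
    ultimately show ?thesis
      using K(3)[of n] by (simp add: infdist_notempty cINF_less_iff)
  qed
  then obtain a where a: "\<And>n. a n \<in> K n" "\<And>n. norm (a n) < d n + 1 / Suc n" by metis
  have lim: "(\<lambda>n. norm (a n)) \<longlonglongrightarrow> D"
  proof (rule tendsto_sandwich[where f = d and h = "\<lambda>n. d n + 1 / Suc n"])
    show "(\<lambda>n. d n + 1 / Suc n) \<longlonglongrightarrow> D"
      using tendsto_add[OF D LIMSEQ_inverse_real_of_nat] by (simp add: inverse_eq_divide)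
  qed (use D a dlow in \<open>auto intro!: always_eventually intro: less_imp_le\<close>)
  have "Cauchy a"
  proof (rule uniformly_convex_almost_minimal_Cauchy[OF uc lim])
    fix e :: real assume "e > 0"
    then obtain N where N: "\<And>n. n \<ge> N \<Longrightarrow> norm (d n - D) < e" using LIMSEQ_D[OF D] by blast
    have "norm ((1/2) *\<^sub>R (a m + a n)) \<ge> D - e" if "m \<ge> N" "n \<ge> N" for m n
    proof -
      \<comment> \<open>This is where convexity of the sets enters: the midpoint stays in K N, so
        its norm is at least d N, which is close to D.\<close>
      have "a m \<in> K N" "a n \<in> K N" using a(1) dec that by blast+
      hence "(1/2) *\<^sub>R a m + (1/2) *\<^sub>R a n \<in> K N" by (intro convexD K) auto
      hence "d N \<le> norm ((1/2) *\<^sub>R (a m + a n))" by (intro dlow) (simp add: scaleR_add_right)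
      thus ?thesis using N[of N] dD[of N] by simp
    qed
    thus "\<exists>N. \<forall>m\<ge>N. \<forall>n\<ge>N. norm ((1/2) *\<^sub>R (a m + a n)) \<ge> D - e" by blast
  qed
  then obtain z where z: "a \<longlonglongrightarrow> z" using Cauchy_convergent_iff convergent_def by blast
  have "z \<in> K n" for n
  proof (rule Lim_in_closed_set[OF K(1) _ _ z])
    show "\<forall>\<^sub>F m in sequentially. a m \<in> K n"
      using eventually_ge_at_top[of n] by eventually_elim (use a(1) dec in blast)
  qed simp
  thus ?thesis by blast
qed

section \<open>Lower semicontinuous convex functions\<close>

lemma lsc_on_eventually_greater:
  assumes "lsc_on S f" "q \<in> S" "c < f q"
  shows "\<forall>\<^sub>F y in at q within S. c < f y"
  using assms less_LiminfD unfolding lsc_on_def by (metis less_le_trans)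

lemma lsc_closed_sublevel:
  assumes lsc: "lsc_on UNIV h" and k: "continuous_on UNIV (k :: 'a::topological_space \<Rightarrow> real)"
  shows "closed {z. h z \<le> ereal (k z)}"
proof -
  have "\<exists>T. open T \<and> z \<in> T \<and> T \<subseteq> {z. ereal (k z) < h z}" if z: "ereal (k z) < h z" for z
  proof -
    obtain c where c: "ereal (k z) < ereal c" "ereal c < h z"
      using z ereal_dense2 by blast
    have "\<forall>\<^sub>F y in at z. ereal c < h y"
      using lsc_on_eventually_greater[OF lsc, of z] c(2) by simp
    hence "\<forall>\<^sub>F y in nhds z. ereal c < h y"
      using c(2) by (simp add: eventually_nhds_conv_at)
    moreover have "(k \<longlongrightarrow> k z) (nhds z)"
      using k by (simp add: continuous_on_def tendsto_nhds_iff)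
    hence "\<forall>\<^sub>F y in nhds z. k y < c"
      using c(1) by (intro order_tendstoD) auto
    ultimately have "\<forall>\<^sub>F y in nhds z. ereal (k y) < h y"
      by eventually_elim (metis less_ereal.simps(1) less_trans)
    thus ?thesis by (auto simp: eventually_nhds)
  qed
  hence "open {z. ereal (k z) < h z}" by (subst open_subopen) auto
  thus ?thesis by (simp add: closed_def Collect_neg_eq[symmetric] not_le)
qed

lemma convex_ereal_sublevel:
  fixes h :: "'a::real_normed_vector \<Rightarrow> ereal" and s :: "'a \<Rightarrow>\<^sub>L real"
  assumes "convex_ereal h"
  shows "convex {z. h z \<le> ereal (blinfun_apply s z + c)}"
proof (rule convexI, clarsimp)
  fix x y and u v :: real
  assume x: "h x \<le> ereal (blinfun_apply s x + c)" and y: "h y \<le> ereal (blinfun_apply s y + c)"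
    and uv: "0 \<le> u" "0 \<le> v" "u + v = 1"
  have v: "v = 1 - u" using uv by simp
  have "h (u *\<^sub>R x + v *\<^sub>R y) \<le> ereal u * h x + ereal v * h y"
    using assms uv unfolding convex_ereal_def v by auto
  also have "\<dots> \<le> ereal u * ereal (blinfun_apply s x + c) + ereal v * ereal (blinfun_apply s y + c)"
    using uv x y by (intro add_mono ereal_mult_left_mono) auto
  also have "\<dots> = ereal (blinfun_apply s (u *\<^sub>R x + v *\<^sub>R y) + c)"
    by (simp add: blinfun.add_right blinfun.scaleR_right v) (simp add: algebra_simps)
  finally show "h (u *\<^sub>R x + v *\<^sub>R y) \<le> ereal (blinfun_apply s (u *\<^sub>R x + v *\<^sub>R y) + c)" .
qed

lemma lsc_closed_sublevel_blinfun:
  fixes h :: "'a::real_normed_vector \<Rightarrow> ereal" and s :: "'a \<Rightarrow>\<^sub>L real"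
  assumes "lsc_on UNIV h"
  shows "closed {z. h z \<le> ereal (blinfun_apply s z + c)}"
  by (rule lsc_closed_sublevel[OF assms]) (intro continuous_intros)

lemma convex_eff_dom:
  assumes "convex_ereal h"
  shows "convex (eff_dom h)"
proof (rule convexI, simp add: eff_dom_def)
  fix x y and u v :: real
  assume xy: "h x \<noteq> \<infinity>" "h y \<noteq> \<infinity>" and uv: "0 \<le> u" "0 \<le> v" "u + v = 1"
  have v: "v = 1 - u" using uv by simp
  have "h (u *\<^sub>R x + v *\<^sub>R y) \<le> ereal u * h x + ereal v * h y"
    using assms uv unfolding convex_ereal_def v by auto
  also have "\<dots> < \<infinity>"
    using xy uv by (cases "h x"; cases "h y") (auto simp: zero_ereal_def)
  finally show "h (u *\<^sub>R x + v *\<^sub>R y) \<noteq> \<infinity>" by auto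
qed

section \<open>Baire category and local upper bounds of convex functions\<close>

lemma Baire_ball_subset:
  fixes F :: "nat \<Rightarrow> 'a::banach set"
  assumes "\<And>n. closed (F n)" "e > 0" "ball x e \<subseteq> (\<Union>n. F n)"
  obtains n y d where "d > 0" "ball y d \<subseteq> F n"
proof -
  have "\<exists>n. interior (F n) \<noteq> {}"
  proof (rule ccontr)
    assume "\<not> ?thesis"
    hence "euclidean interior_of (\<Union> (range F)) = {}"
      by (intro Baire_category_alt) (auto simp: completely_metrizable_space_euclidean assms)
    hence "interior (\<Union> (range F)) = {}" by simp
    moreover have "x \<in> interior (\<Union> (range F))"
      using assms(2,3) by (auto simp: mem_interior)
    ultimately show False by simp
  qed
  then obtain n y where "y \<in> interior (F n)" by blast
  thus thesis using that by (auto simp: mem_interior)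
qed

text \<open>The symmetrised sublevel sets around \<open>x\<close> are closed and cover a ball, so by Baire one of
  them has interior; being symmetric and convex it contains a neighbourhood of \<open>0\<close>.\<close>

theorem lsc_convex_locally_bounded_above:
  fixes h :: "'a::banach \<Rightarrow> ereal"
  assumes lsc: "lsc_on UNIV h" and conv: "convex_ereal h"
    and x: "x \<in> interior (eff_dom h)"
  obtains M d where "d > 0" "\<And>y. y \<in> ball x d \<Longrightarrow> h y \<le> ereal M"
proof -
  obtain e where e: "e > 0" "ball x e \<subseteq> eff_dom h" using x by (auto simp: mem_interior)
  define L where "L n = {z. h z \<le> ereal (real n)}" for n :: nat
  have L: "closed (L n)" "convex (L n)" for n
    using lsc_closed_sublevel_blinfun[OF lsc, of 0 "real n"] convex_ereal_sublevel[OF conv, of 0 "real n"]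
    by (simp_all add: L_def)
  define F where "F n = (\<lambda>u. x + u) -` L n \<inter> (\<lambda>u. x - u) -` L n" for n
  have closed: "closed (F n)" for n
    unfolding F_def by (intro closed_Int closed_vimage L continuous_intros)
  have "ball 0 e \<subseteq> (\<Union>n. F n)"
  proof
    fix u :: 'a assume "u \<in> ball 0 e"
    hence "x + u \<in> ball x e" "x - u \<in> ball x e" by (simp_all add: dist_norm)
    hence "h (x + u) < \<infinity>" "h (x - u) < \<infinity>" using e(2) unfolding eff_dom_def by blast+
    hence "max (h (x + u)) (h (x - u)) \<noteq> \<infinity>" by (simp add: max_def)
    then obtain n :: nat where "max (h (x + u)) (h (x - u)) < ereal (real n)"
      using less_PInf_Ex_of_nat by blast
    hence "u \<in> F n" by (auto simp: F_def L_def)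
    thus "u \<in> (\<Union>n. F n)" by blast
  qed
  then obtain n y d where d: "d > 0" "ball y d \<subseteq> F n"
    using Baire_ball_subset[of F e 0] closed e(1) by metis
  have "h w \<le> ereal (real n)" if w: "w \<in> ball x d" for w
  proof -
    define v where "v = w - x"
    have "norm v < d" using w by (simp add: v_def dist_norm norm_minus_commute)
    hence "y + v \<in> F n" "y - v \<in> F n" using d(2) by (auto simp: dist_norm subset_iff)
    hence "x + (y + v) \<in> L n" "x - (y - v) \<in> L n" by (auto simp: F_def)
    \<comment> \<open>The unknown centre y cancels in the midpoint of x + (y + v) and x - (y - v),
      which is x + v = w.\<close>
    hence "(1/2) *\<^sub>R (x + (y + v)) + (1/2) *\<^sub>R (x - (y - v)) \<in> L n"
      by (intro convexD L) auto
    also have "(1/2) *\<^sub>R (x + (y + v)) + (1/2) *\<^sub>R (x - (y - v)) = (1/2) *\<^sub>R (w + w)"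
      unfolding scaleR_add_right[symmetric] by (simp add: v_def)
    also have "\<dots> = w" by (simp flip: scaleR_2)
    finally show ?thesis by (simp add: L_def)
  qed
  with d(1) show thesis using that by blast
qed

text \<open>The points of D where h - s is within 1 / (n + 1) of its infimum form nested bounded
  closed convex sets; a common point attains the infimum. The conclusion has subgradient form so
  that D = \<open>UNIV\<close> produces subgradients with prescribed value s, and smaller D produce
  Bregman projections.\<close>

theorem attains_tilted_minimum:
  fixes h :: "'a::banach \<Rightarrow> ereal" and s :: "'a \<Rightarrow>\<^sub>L real"
  assumes uc: "uniformly_convex_space TYPE('a)"
    and lsc: "lsc_on UNIV h" and conv: "convex_ereal h"
    and D: "closed D" "convex D" "z0 \<in> D" "h z0 < \<infinity>"
    and lower: "\<And>z. z \<in> D \<Longrightarrow> ereal (blinfun_apply s z + m) \<le> h z"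
    and bnd: "\<And>c. bounded (D \<inter> {z. h z \<le> ereal (blinfun_apply s z + c)})"
  obtains z where "z \<in> D" "h z < \<infinity>"
    "\<And>w. w \<in> D \<Longrightarrow> h z + ereal (blinfun_apply s (w - z)) \<le> h w"
proof -
  \<comment> \<open>Outside the effective domain \<open>real_of_ereal\<close> would contribute the
    default value 0, so V is restricted to it.\<close>
  define V where "V = (\<lambda>z. real_of_ereal (h z) - blinfun_apply s z) ` (D \<inter> eff_dom h)"
  define \<mu> where "\<mu> = Inf V"
  have fin: "h z = ereal (real_of_ereal (h z))" if "z \<in> D" "h z < \<infinity>" for z
    using lower[OF that(1)] that(2) by (cases "h z") auto
  have "m \<le> v" if v: "v \<in> V" for v
  proof -
    obtain z where z: "z \<in> D" "h z < \<infinity>" "v = real_of_ereal (h z) - blinfun_apply s z"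
      using v unfolding V_def eff_dom_def by blast
    have "blinfun_apply s z + m \<le> real_of_ereal (h z)"
      using lower[OF z(1)] fin[OF z(1,2)] by (metis ereal_less_eq(3))
    thus ?thesis using z(3) by simp
  qed
  hence bdd: "bdd_below V" by (auto simp: bdd_below_def)
  have ne: "V \<noteq> {}" using D by (auto simp: V_def eff_dom_def)
  define K where "K n = D \<inter> {z. h z \<le> ereal (blinfun_apply s z + (\<mu> + 1 / Suc n))}" for n
  have "(\<Inter>n. K n) \<noteq> {}"
  proof (rule uniformly_convex_nested_Inter[OF uc])
    fix n
    show "closed (K n)" unfolding K_def by (intro closed_Int D lsc_closed_sublevel_blinfun lsc)
    show "convex (K n)" unfolding K_def by (intro convex_Int D convex_ereal_sublevel conv)
    have "1 / real (Suc (Suc n)) \<le> 1 / real (Suc n)" by (simp add: field_simps)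
    thus "K (Suc n) \<subseteq> K n" unfolding K_def by (force elim: order_trans)
    have "\<exists>v\<in>V. v < \<mu> + 1 / Suc n"
      using cInf_less_iff[OF ne bdd, of "\<mu> + 1 / Suc n"] by (simp add: \<mu>_def)
    then obtain z where z: "z \<in> D" "h z < \<infinity>" "real_of_ereal (h z) - blinfun_apply s z < \<mu> + 1 / Suc n"
      by (auto simp: V_def eff_dom_def)
    hence "h z \<le> ereal (blinfun_apply s z + (\<mu> + 1 / Suc n))"
      by (subst fin) auto
    thus "K n \<noteq> {}" using z(1) by (auto simp: K_def)
  next
    show "bounded (K 0)" unfolding K_def by (rule bnd)
  qed
  then obtain z where z: "\<And>n. z \<in> K n" by blast
  have zD: "z \<in> D" "h z < \<infinity>" using z[of 0] by (auto simp: K_def)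
  have "real_of_ereal (h z) - blinfun_apply s z - \<mu> \<le> inverse (Suc n)" for n
  proof -
    have "ereal (real_of_ereal (h z)) \<le> ereal (blinfun_apply s z + (\<mu> + 1 / Suc n))"
      using z[of n] fin[OF zD] by (simp add: K_def)
    thus ?thesis by (simp add: inverse_eq_divide)
  qed
  hence le: "real_of_ereal (h z) - blinfun_apply s z - \<mu> \<le> 0"
    by (intro LIMSEQ_le_const[OF LIMSEQ_inverse_real_of_nat]) auto
  show thesis
  proof (rule that[OF zD])
    fix w assume w: "w \<in> D"
    show "h z + ereal (blinfun_apply s (w - z)) \<le> h w"
    proof (cases "h w < \<infinity>")
      case True
      have "\<mu> \<le> real_of_ereal (h w) - blinfun_apply s w"
        unfolding \<mu>_def using w True by (intro cInf_lower bdd) (auto simp: V_def eff_dom_def)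
      thus ?thesis
        using le by (subst fin[OF zD], subst fin[OF w True]) (simp add: blinfun.diff_right)
    qed auto
  qed
qed

section \<open>Subgradients and gradients\<close>

text \<open>By convexity the slope of a chord from 0 shrinks as its endpoint approaches 0. So a
  single point on each side whose slope exceeds c by less than d controls all closer points, while
  \<open>low\<close> gives the opposite bound. The sign \<sigma> in \<open>slope\<close> treats both
  sides together.\<close>

lemma convex_has_real_derivative_0:
  fixes \<theta> :: "real \<Rightarrow> real"
  assumes conv: "convex_on {-e<..<e} \<theta>" and e: "e > 0"
    and low: "\<And>t. \<bar>t\<bar> < e \<Longrightarrow> \<theta> 0 + c * t \<le> \<theta> t"
    and right: "\<And>d. d > 0 \<Longrightarrow> \<exists>t>0. t < e \<and> \<theta> t < \<theta> 0 + (c + d) * t"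
    and left: "\<And>d. d > 0 \<Longrightarrow> \<exists>t>0. t < e \<and> \<theta> (- t) < \<theta> 0 + (- c + d) * t"
  shows "(\<theta> has_real_derivative c) (at 0)"
proof -
  have slope: "\<theta> (\<sigma> * h) \<le> \<theta> 0 + (h / t) * (\<theta> (\<sigma> * t) - \<theta> 0)"
    if "0 < h" "h \<le> t" "t < e" "\<sigma> \<in> {1, -1}" for h t \<sigma>
  proof -
    have "\<theta> ((1 - h / t) *\<^sub>R 0 + (h / t) *\<^sub>R (\<sigma> * t)) \<le> (1 - h / t) * \<theta> 0 + (h / t) * \<theta> (\<sigma> * t)"
      using that e by (intro convex_onD[OF conv]) (auto simp: field_simps)
    thus ?thesis using that by (simp add: algebra_simps)
  qed
  have "(\<lambda>h. (\<theta> (0 + h) - \<theta> 0) / h) \<midarrow>0\<rightarrow> c"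
  proof (rule LIM_I)
    fix d :: real assume d: "d > 0"
    obtain t1 where t1: "t1 > 0" "t1 < e" "\<theta> t1 < \<theta> 0 + (c + d) * t1" using right[OF d] by blast
    obtain t2 where t2: "t2 > 0" "t2 < e" "\<theta> (- t2) < \<theta> 0 + (- c + d) * t2" using left[OF d] by blast
    have "norm ((\<theta> (0 + h) - \<theta> 0) / h - c) < d" if h: "h \<noteq> 0" "norm (h - 0) < min t1 t2" for h
    proof (cases "h > 0")
      case True
      have "\<theta> h \<le> \<theta> 0 + (h / t1) * (\<theta> t1 - \<theta> 0)"
        using slope[of h t1 1] h t1 True by simp
      also have "\<dots> < \<theta> 0 + (h / t1) * ((c + d) * t1)"
        using t1 True by (intro add_strict_left_mono mult_strict_left_mono) auto
      finally have "\<theta> h < \<theta> 0 + h * (c + d)" using t1 by simp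
      moreover have "\<theta> 0 + c * h \<le> \<theta> h" using low[of h] h t1 by simp
      ultimately have "c \<le> (\<theta> h - \<theta> 0) / h" "(\<theta> h - \<theta> 0) / h < c + d"
        using True by (simp_all add: field_simps)
      thus ?thesis by simp
    next
      case False
      define k where "k = - h"
      have k: "k > 0" "h = - k" "k < t1" "k < t2" using False h by (auto simp: k_def)
      have "\<theta> h \<le> \<theta> 0 + (k / t2) * (\<theta> (- t2) - \<theta> 0)"
        using slope[of k t2 "-1"] k t2 by simp
      also have "\<dots> < \<theta> 0 + (k / t2) * ((- c + d) * t2)"
        using t2 k by (intro add_strict_left_mono mult_strict_left_mono) auto
      finally have "\<theta> h < \<theta> 0 + k * (- c + d)" using t2 by simp
      moreover have "\<theta> 0 + c * h \<le> \<theta> h" using low[of h] k t1 by simp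
      ultimately have "c - d < (\<theta> h - \<theta> 0) / h" "(\<theta> h - \<theta> 0) / h \<le> c"
        using k by (simp_all add: field_simps)
      thus ?thesis by simp
    qed
    thus "\<exists>r>0. \<forall>h. h \<noteq> 0 \<and> norm (h - 0) < r \<longrightarrow> norm ((\<theta> (0 + h) - \<theta> 0) / h - c) < d"
      using t1(1) t2(1) by (intro exI[of _ "min t1 t2"]) auto
  qed
  thus ?thesis by (simp add: DERIV_def)
qed

lemma eff_dom_real:
  assumes "\<And>x. k x \<noteq> -\<infinity>" "x \<in> eff_dom k"
  shows "k x = ereal (real_of_ereal (k x))"
  using assms(1)[of x] assms(2) by (cases "k x") (auto simp: eff_dom_def)

lemma convex_ereal_real:
  assumes conv: "convex_ereal k" and nm: "\<And>x. k x \<noteq> -\<infinity>"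
    and "x \<in> eff_dom k" "y \<in> eff_dom k" "0 \<le> t" "t \<le> 1"
  shows "real_of_ereal (k (t *\<^sub>R x + (1 - t) *\<^sub>R y))
    \<le> t * real_of_ereal (k x) + (1 - t) * real_of_ereal (k y)"
proof -
  have "t *\<^sub>R x + (1 - t) *\<^sub>R y \<in> eff_dom k"
    using convex_eff_dom[OF conv] assms by (intro convexD) auto
  note eff_dom_real[OF nm this]
  moreover have "k (t *\<^sub>R x + (1 - t) *\<^sub>R y) \<le> ereal t * k x + ereal (1 - t) * k y"
    using conv assms unfolding convex_ereal_def by auto
  moreover have "ereal t * k x + ereal (1 - t) * k y = ereal (t * real_of_ereal (k x) + (1 - t) * real_of_ereal (k y))"
    by (subst eff_dom_real[OF nm assms(3)], subst eff_dom_real[OF nm assms(4)]) simp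
  ultimately show ?thesis by (metis ereal_less_eq(3))
qed

lemma convex_on_line:
  assumes conv: "convex_ereal k" and nm: "\<And>x. k x \<noteq> -\<infinity>"
    and I: "convex I" "\<And>t. t \<in> I \<Longrightarrow> x + t *\<^sub>R h \<in> eff_dom k"
  shows "convex_on I (\<lambda>t. real_of_ereal (k (x + t *\<^sub>R h)))"
proof (rule convex_onI[OF _ I(1)])
  fix t u v :: real assume t: "0 < t" "t < 1" "u \<in> I" "v \<in> I"
  have "x + ((1 - t) *\<^sub>R u + t *\<^sub>R v) *\<^sub>R h = t *\<^sub>R (x + v *\<^sub>R h) + (1 - t) *\<^sub>R (x + u *\<^sub>R h)"
    by (simp add: algebra_simps)
  thus "real_of_ereal (k (x + ((1 - t) *\<^sub>R u + t *\<^sub>R v) *\<^sub>R h))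
    \<le> (1 - t) * real_of_ereal (k (x + u *\<^sub>R h)) + t * real_of_ereal (k (x + v *\<^sub>R h))"
    using convex_ereal_real[OF conv nm I(2) I(2), of v u t] t by (simp add: add.commute)
qed

lemma interior_line:
  fixes x :: "'a::real_normed_vector"
  assumes "x \<in> interior S"
  obtains e where "e > 0" "\<And>t. \<bar>t\<bar> < e \<Longrightarrow> x + t *\<^sub>R h \<in> interior S"
proof -
  obtain d where d: "d > 0" "ball x d \<subseteq> interior S"
    using assms open_contains_ball by blast
  show thesis
  proof (rule that)
    show "d / (norm h + 1) > 0" using d(1) by (simp add: add_nonneg_pos)
    fix t :: real assume t: "\<bar>t\<bar> < d / (norm h + 1)"
    have "\<bar>t\<bar> * norm h \<le> \<bar>t\<bar> * (norm h + 1)" by (intro mult_left_mono) auto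
    also have "\<dots> < d" using t by (simp add: pos_less_divide_eq add_nonneg_pos)
    finally have "x + t *\<^sub>R h \<in> ball x d" by (simp add: dist_norm)
    thus "x + t *\<^sub>R h \<in> interior S" using d(2) by blast
  qed
qed

text \<open>A subgradient bounds all directional slopes from below; \<open>up\<close> says that in
  each direction it is also the infimum of the slopes. Applied to h and to - h, this is two-sided
  differentiability along the line.\<close>

lemma subgradient_has_gradient:
  fixes k :: "'a::real_normed_vector \<Rightarrow> ereal"
  assumes conv: "convex_ereal k" and nm: "\<And>x. k x \<noteq> -\<infinity>"
    and x: "x \<in> interior (eff_dom k)" and f: "f \<in> subdiff k x"
    and up: "\<And>h c. blinfun_apply f h < c \<Longrightarrow> \<exists>t>0. k (x + t *\<^sub>R h) < k x + ereal (c * t)"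
  shows "has_gradient k f x"
  unfolding has_gradient_def
proof (intro conjI allI x)
  fix h
  have xd: "x \<in> eff_dom k" using x interior_subset by blast
  obtain e where e: "e > 0" "\<And>t. \<bar>t\<bar> < e \<Longrightarrow> x + t *\<^sub>R h \<in> eff_dom k"
    using interior_line[OF x, of h] interior_subset by (metis subsetD)
  let ?\<theta> = "\<lambda>t. real_of_ereal (k (x + t *\<^sub>R h))"
  have small: "\<exists>t>0. t < e \<and> real_of_ereal (k (x + t *\<^sub>R v)) < real_of_ereal (k x) + (blinfun_apply f v + d) * t"
    if d: "d > 0" for d v
  proof -
    obtain t where t: "t > 0" "k (x + t *\<^sub>R v) < k x + ereal ((blinfun_apply f v + d) * t)"
      using up[of v "blinfun_apply f v + d"] d by auto
    have "k x + ereal ((blinfun_apply f v + d) * t) < \<infinity>"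
      using xd by (cases "k x") (auto simp: eff_dom_def)
    hence td: "x + t *\<^sub>R v \<in> eff_dom k" using t(2) unfolding eff_dom_def by (auto dest: less_trans)
    have lt: "real_of_ereal (k (x + t *\<^sub>R v)) < real_of_ereal (k x) + (blinfun_apply f v + d) * t"
      using t(2) eff_dom_real[OF nm xd] eff_dom_real[OF nm td]
      by (metis less_ereal.simps(1) plus_ereal.simps(1))
    \<comment> \<open>The t supplied by \<open>up\<close> may leave the interval where k is known to
      be finite. Moving towards x by the factor l keeps the slope bound and makes l * t \<le> e /
      2.\<close>
    define l where "l = min 1 (e / (2 * t))"
    have l: "0 < l" "l \<le> 1" "l * t < e" using e(1) t(1) by (auto simp: l_def min_def field_simps)
    have "x + (l * t) *\<^sub>R v = l *\<^sub>R (x + t *\<^sub>R v) + (1 - l) *\<^sub>R x" by (simp add: algebra_simps)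
    hence "real_of_ereal (k (x + (l * t) *\<^sub>R v)) \<le> l * real_of_ereal (k (x + t *\<^sub>R v)) + (1 - l) * real_of_ereal (k x)"
      using convex_ereal_real[OF conv nm td xd, of l] l by simp
    also have "\<dots> < l * (real_of_ereal (k x) + (blinfun_apply f v + d) * t) + (1 - l) * real_of_ereal (k x)"
      using l lt by (intro add_strict_right_mono mult_strict_left_mono) auto
    also have "\<dots> = real_of_ereal (k x) + (blinfun_apply f v + d) * (l * t)" by (simp add: algebra_simps)
    finally show ?thesis using l t(1) by (intro exI[of _ "l * t"]) auto
  qed
  show "(?\<theta> has_real_derivative blinfun_apply f h) (at 0)"
  proof (rule convex_has_real_derivative_0)
    show "convex_on {-e<..<e} ?\<theta>" by (rule convex_on_line[OF conv nm]) (use e in auto)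
    show "e > 0" by fact
    show "?\<theta> 0 + blinfun_apply f h * t \<le> ?\<theta> t" if "\<bar>t\<bar> < e" for t
    proof -
      have "k x + ereal (blinfun_apply f (x + t *\<^sub>R h - x)) \<le> k (x + t *\<^sub>R h)"
        using f by (simp only: subdiff_def mem_Collect_eq)
      hence "ereal (real_of_ereal (k x) + blinfun_apply f (x + t *\<^sub>R h - x)) \<le> ereal (?\<theta> t)"
        using eff_dom_real[OF nm xd] eff_dom_real[OF nm e(2)[OF that]] by (metis plus_ereal.simps(1))
      thus ?thesis by (simp add: blinfun.scaleR_right mult.commute)
    qed
    show "\<exists>t>0. t < e \<and> ?\<theta> t < ?\<theta> 0 + (blinfun_apply f h + d) * t" if "d > 0" for d
      using small[OF that, of h] by simp
    show "\<exists>t>0. t < e \<and> ?\<theta> (- t) < ?\<theta> 0 + (- blinfun_apply f h + d) * t" if "d > 0" for d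
      using small[OF that, of "- h"] by (simp add: blinfun.minus_right)
  qed
qed

lemma has_gradient_unique:
  assumes "has_gradient k f x" "has_gradient k f' x" shows "f = f'"
  using assms unfolding has_gradient_def by (intro blinfun_eqI) (metis DERIV_unique)

lemma grad_eqI: "has_gradient k f x \<Longrightarrow> grad k x = f"
  unfolding grad_def using has_gradient_unique by blast

text \<open>For convex k the infimum of this set is the one-sided directional derivative at x along
  h. The inequality form never subtracts infinite values.\<close>

definition epi_slopes :: "('a::real_vector \<Rightarrow> ereal) \<Rightarrow> 'a \<Rightarrow> 'a \<Rightarrow> real set" where
  "epi_slopes k x h = {c. \<exists>t>0. k (x + t *\<^sub>R h) \<le> k x + ereal (c * t)}"

text \<open>The step lengths t and t' differ. The weight l = t' / (t + t') makes l * t = (1 - l) *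
  t', so the convex combination of the two endpoints moves along h + h' with one common
  step.\<close>

lemma epi_slopes_add:
  assumes conv: "convex_ereal k" and kx: "k x = ereal a"
    and c: "c \<in> epi_slopes k x h" and c': "c' \<in> epi_slopes k x h'"
  shows "c + c' \<in> epi_slopes k x (h + h')"
proof -
  obtain t where t: "t > 0" "k (x + t *\<^sub>R h) \<le> ereal (a + c * t)"
    using c kx by (auto simp: epi_slopes_def)
  obtain t' where t': "t' > 0" "k (x + t' *\<^sub>R h') \<le> ereal (a + c' * t')"
    using c' kx by (auto simp: epi_slopes_def)
  define l where "l = t' / (t + t')"
  have l: "0 \<le> l" "l \<le> 1" "1 - l = t / (t + t')" using t t' by (auto simp: l_def field_simps)
  have eq: "(1 - l) * t' = l * t" using l(3) by (simp add: l_def)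
  have "x + (l * t) *\<^sub>R (h + h') = l *\<^sub>R (x + t *\<^sub>R h) + (1 - l) *\<^sub>R (x + t' *\<^sub>R h')"
  proof -
    have "l *\<^sub>R (x + t *\<^sub>R h) + (1 - l) *\<^sub>R (x + t' *\<^sub>R h') = x + (l * t) *\<^sub>R h + ((1 - l) * t') *\<^sub>R h'"
      by (simp add: scaleR_add_right scaleR_diff_left)
    thus ?thesis unfolding eq by (simp add: scaleR_add_right)
  qed
  hence "k (x + (l * t) *\<^sub>R (h + h')) \<le> ereal l * k (x + t *\<^sub>R h) + ereal (1 - l) * k (x + t' *\<^sub>R h')"
    using conv l(1,2) unfolding convex_ereal_def by auto
  also have "\<dots> \<le> ereal l * ereal (a + c * t) + ereal (1 - l) * ereal (a + c' * t')"
    using l t t' by (intro add_mono ereal_mult_left_mono) auto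
  also have "\<dots> = ereal (a + (l * t) * c + ((1 - l) * t') * c')" by (simp add: algebra_simps)
  also have "\<dots> = k x + ereal ((c + c') * (l * t))" unfolding eq kx by (simp add: algebra_simps)
  finally show ?thesis
    unfolding epi_slopes_def using t t' by (auto simp: l_def intro!: exI[of _ "t' / (t + t') * t"])
qed

lemma epi_slopes_scale:
  assumes "a > 0" "c \<in> epi_slopes k x h" shows "a * c \<in> epi_slopes k x (a *\<^sub>R h)"
proof -
  obtain t where "t > 0" "k (x + t *\<^sub>R h) \<le> k x + ereal (c * t)"
    using assms(2) by (auto simp: epi_slopes_def)
  thus ?thesis using assms(1) by (auto simp: epi_slopes_def intro!: exI[of _ "t / a"])
qed

text \<open>The directional derivative of \<open>k\<close> at an interior point is sublinear, so by Hahn-Banach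
  every directional derivative is attained by a subgradient.\<close>

theorem subgradient_attains_directional_derivative:
  fixes k :: "'a::banach \<Rightarrow> ereal"
  assumes lsc: "lsc_on UNIV k" and conv: "convex_ereal k" and nm: "\<And>x. k x \<noteq> -\<infinity>"
    and x: "x \<in> interior (eff_dom k)"
  obtains f where "f \<in> subdiff k x"
    "\<And>c. blinfun_apply f h < c \<Longrightarrow> \<exists>t>0. k (x + t *\<^sub>R h) < k x + ereal (c * t)"
proof -
  have xd: "x \<in> eff_dom k" using x interior_subset by blast
  define a where "a = real_of_ereal (k x)"
  have kx: "k x = ereal a" using eff_dom_real[OF nm xd] by (simp add: a_def)
  define P where "P = epi_slopes k x"
  define p where "p v = Inf (P v)" for v
  obtain M d where d: "d > 0" "\<And>y. y \<in> ball x d \<Longrightarrow> k y \<le> ereal M"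
    using lsc_convex_locally_bounded_above[OF lsc conv x] by metis
  \<comment> \<open>A step of length d / 2 along v stays in the ball where k \<le> M, so the slope
    per unit length is at most (M - a) / (d / 2). The same constant will bound the norm of
    f.\<close>
  have Pb: "(2 * (M - a) / d) * norm v \<in> P v" for v
  proof (cases "v = 0")
    case False
    let ?t = "d / (2 * norm v)"
    have "x + ?t *\<^sub>R v \<in> ball x d" using d(1) False by (simp add: dist_norm)
    hence "k (x + ?t *\<^sub>R v) \<le> ereal M" by (rule d(2))
    also have "M = a + (2 * (M - a) / d) * norm v * ?t" using d(1) False by (simp add: field_simps)
    finally show ?thesis using d(1) False kx by (auto simp: P_def epi_slopes_def intro!: exI[of _ ?t])
  qed (auto simp: P_def epi_slopes_def kx intro: exI[of _ 1])
  have P0: "c \<in> P 0 \<longleftrightarrow> c \<ge> 0" for c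
    by (auto simp: P_def epi_slopes_def kx zero_le_mult_iff intro: exI[of _ 1])
  \<comment> \<open>A slope along v plus one along - v is a slope along 0, and these are
    nonnegative.\<close>
  have bdd: "bdd_below (P v)" for v
  proof (rule bdd_belowI)
    fix c assume "c \<in> P v"
    hence "c + (2 * (M - a) / d) * norm (- v) \<in> P (v + - v)"
      unfolding P_def using Pb[of "- v"] by (intro epi_slopes_add[OF conv kx]) (auto simp: P_def)
    thus "- ((2 * (M - a) / d) * norm (- v)) \<le> c" using P0 by simp
  qed
  have ne: "P v \<noteq> {}" for v using Pb by blast
  have lower: "p v \<le> c" if "c \<in> P v" for c v
    unfolding p_def by (rule cInf_lower[OF that bdd])
  have greatest: "m \<le> p v" if "\<And>c. c \<in> P v \<Longrightarrow> m \<le> c" for m v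
    unfolding p_def by (rule cInf_greatest[OF ne that])
  have "sublinear p"
  proof (rule sublinear_homogI)
    fix u v
    have "p (u + v) - c \<le> p u" if "c \<in> P v" for c
      using lower epi_slopes_add[OF conv kx] that unfolding P_def
      by (intro greatest) (fastforce simp: P_def algebra_simps)
    hence "p (u + v) - p u \<le> p v" by (intro greatest) (simp add: algebra_simps)
    thus "p (u + v) \<le> p u + p v" by simp
  next
    have "p 0 \<le> 0" using P0 by (intro lower) auto
    moreover have "0 \<le> p 0" using P0 by (intro greatest) auto
    ultimately show "p 0 = 0" by simp
  next
    fix c :: real and v assume c: "c > 0"
    have "inverse c * p (c *\<^sub>R v) \<le> p v"
    proof (rule greatest)
      fix b assume "b \<in> P v"
      hence "p (c *\<^sub>R v) \<le> c * b" using c unfolding P_def by (intro lower) (auto simp: P_def intro: epi_slopes_scale)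
      thus "inverse c * p (c *\<^sub>R v) \<le> b" using c by (simp add: field_simps)
    qed
    thus "p (c *\<^sub>R v) \<le> c * p v" using c by (simp add: field_simps)
  qed
  then obtain f where f: "linear f" "\<And>v. f v \<le> p v" "f h = p h"
    using Hahn_Banach_sublinear by metis
  have "f v \<le> (2 * (M - a) / d) * norm v" for v
    using f(2) lower[OF Pb] by (rule order_trans)
  hence "\<bar>f v\<bar> \<le> (2 * (M - a) / d) * norm v" for v
    using linear_neg[OF f(1), of v] by (metis abs_le_iff norm_minus_cancel)
  hence bl: "bounded_linear f"
    using f(1) by (intro bounded_linear_intro[where K = "2 * (M - a) / d"])
      (auto simp: linear_add linear_scale mult.commute)
  define F where "F = Blinfun f"
  have F: "blinfun_apply F = f" using bl by (simp add: F_def bounded_linear_Blinfun_apply)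
  show thesis
  proof (rule that)
    have "k x + ereal (f (y - x)) \<le> k y" for y
    proof (cases "k y")
      case (real b)
      have "b - a \<in> P (y - x)"
        using real kx by (auto simp: P_def epi_slopes_def intro!: exI[of _ 1])
      hence "f (y - x) \<le> b - a" using f(2) lower order_trans by blast
      thus ?thesis using real kx by simp
    qed (use nm in auto)
    thus "F \<in> subdiff k x" using xd by (simp add: subdiff_def F)
  next
    fix c assume "blinfun_apply F h < c"
    hence "Inf (P h) < c" by (simp add: F f(3) p_def)
    then obtain c' where c': "c' \<in> P h" "c' < c" using cInf_less_iff[OF ne bdd] by blast
    then obtain t where t: "t > 0" "k (x + t *\<^sub>R h) \<le> k x + ereal (c' * t)"
      by (auto simp: P_def epi_slopes_def)
    moreover have "k x + ereal (c' * t) < k x + ereal (c * t)" using c'(2) t(1) kx by simp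
    ultimately show "\<exists>t>0. k (x + t *\<^sub>R h) < k x + ereal (c * t)" by (blast intro: le_less_trans)
  qed
qed

section \<open>Fenchel conjugates and Legendre functions\<close>

lemma fenchel_conj_ge: "ereal (blinfun_apply f x) - g x \<le> fenchel_conj g f"
  unfolding fenchel_conj_def by (rule SUP_upper) simp

lemma fenchel_conj_not_MInf:
  assumes "proper_fun g" shows "fenchel_conj g f \<noteq> -\<infinity>"
proof -
  obtain x where "x \<in> eff_dom g" using assms by (auto simp: proper_fun_def)
  then obtain a where "g x = ereal a"
    using eff_dom_real[of g x] assms by (metis proper_fun_def)
  thus ?thesis using fenchel_conj_ge[of f x g] by auto
qed

lemma convex_fenchel_conj:
  assumes "proper_fun g" shows "convex_ereal (fenchel_conj g)"
  unfolding convex_ereal_def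
proof (intro allI ballI)
  fix f f' and t :: real assume t: "t \<in> {0..1}"
  show "fenchel_conj g (t *\<^sub>R f + (1 - t) *\<^sub>R f') \<le> ereal t * fenchel_conj g f + ereal (1 - t) * fenchel_conj g f'"
    unfolding fenchel_conj_def[of g "t *\<^sub>R f + (1 - t) *\<^sub>R f'"]
  proof (rule SUP_least)
    fix x
    show "ereal (blinfun_apply (t *\<^sub>R f + (1 - t) *\<^sub>R f') x) - g x
      \<le> ereal t * fenchel_conj g f + ereal (1 - t) * fenchel_conj g f'"
    proof (cases "g x")
      case (real a)
      have "ereal (blinfun_apply (t *\<^sub>R f + (1 - t) *\<^sub>R f') x) - g x =
        ereal t * (ereal (blinfun_apply f x) - g x) + ereal (1 - t) * (ereal (blinfun_apply f' x) - g x)"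
        using real by (simp add: blinfun.add_left blinfun.scaleR_left) (simp add: algebra_simps)
      also have "\<dots> \<le> ereal t * fenchel_conj g f + ereal (1 - t) * fenchel_conj g f'"
        using t by (intro add_mono ereal_mult_left_mono fenchel_conj_ge) auto
      finally show ?thesis .
    qed (use assms in \<open>auto simp: proper_fun_def\<close>)
  qed
qed

lemma lsc_fenchel_conj:
  assumes "proper_fun g" shows "lsc_on UNIV (fenchel_conj g)"
  unfolding lsc_on_def le_Liminf_iff
proof (intro ballI allI impI)
  fix f and y assume "y < fenchel_conj g f"
  then obtain x where x: "y < ereal (blinfun_apply f x) - g x"
    by (auto simp: fenchel_conj_def less_SUP_iff)
  have "g x \<noteq> \<infinity>" using x by auto
  then obtain a where a: "g x = ereal a" using assms by (cases "g x") (auto simp: proper_fun_def)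
  have "((\<lambda>f'. ereal (blinfun_apply f' x - a)) \<longlongrightarrow> ereal (blinfun_apply f x - a)) (at f)"
    by (intro tendsto_intros)
  hence "\<forall>\<^sub>F f' in at f. y < ereal (blinfun_apply f' x - a)"
    using x a by (intro order_tendstoD) auto
  thus "\<forall>\<^sub>F f' in at f. y < fenchel_conj g f'"
  proof eventually_elim
    case (elim f')
    thus ?case using fenchel_conj_ge[of f' x g] a by (auto intro: less_le_trans)
  qed
qed

text \<open>Equality in Young's inequality: f being a subgradient at x means exactly that f - g
  attains its supremum there.\<close>

lemma fenchel_conj_subdiff:
  assumes "f \<in> subdiff g x" "g x = ereal a"
  shows "fenchel_conj g f = ereal (blinfun_apply f x - a)"
proof (rule antisym)
  show "fenchel_conj g f \<le> ereal (blinfun_apply f x - a)"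
    unfolding fenchel_conj_def
  proof (rule SUP_least)
    fix y
    have "ereal a + ereal (blinfun_apply f (y - x)) \<le> g y"
      using assms by (simp add: subdiff_def)
    thus "ereal (blinfun_apply f y) - g y \<le> ereal (blinfun_apply f x - a)"
      by (cases "g y") (auto simp: blinfun.diff_right)
  qed
  show "ereal (blinfun_apply f x - a) \<le> fenchel_conj g f"
    using fenchel_conj_ge[of f x g] assms by simp
qed

text \<open>The set ?S consists of all minimisers of g - f. It is convex, and each of its points has
  f as a subgradient, so essential strict convexity applies on it; the midpoint of two distinct
  minimisers would then lie strictly below the minimum.\<close>

lemma strictly_convex_subdiff_inj:
  assumes proper: "proper_fun g" and conv: "convex_ereal g"
    and esc: "essentially_strictly_convex g"
    and x: "f \<in> subdiff g x" and y: "f \<in> subdiff g y"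
  shows "x = y"
proof (rule ccontr)
  assume ne: "x \<noteq> y"
  have nm: "g z \<noteq> -\<infinity>" for z using proper by (auto simp: proper_fun_def)
  have "x \<in> eff_dom g" "y \<in> eff_dom g" using x y by (simp_all add: subdiff_def)
  then obtain a b where a: "g x = ereal a" and b: "g y = ereal b"
    using eff_dom_real[of g, OF nm] by metis
  have ab: "b = a + blinfun_apply f (y - x)"
    using fenchel_conj_subdiff[OF x a] fenchel_conj_subdiff[OF y b] by (simp add: blinfun.diff_right)
  let ?S = "{z. g z \<le> ereal (blinfun_apply f z + (a - blinfun_apply f x))}"
  have S: "x \<in> ?S" "y \<in> ?S" using a b ab by (auto simp: blinfun.diff_right)
  have cS: "convex ?S" by (rule convex_ereal_sublevel[OF conv])
  have "f \<in> subdiff g z" if z: "z \<in> ?S" for z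
    unfolding subdiff_def
  proof (intro CollectI conjI allI)
    show "z \<in> eff_dom g" using z by (auto simp: eff_dom_def)
    fix w
    have "g z + ereal (blinfun_apply f (w - z)) \<le> ereal (blinfun_apply f z + (a - blinfun_apply f x)) + ereal (blinfun_apply f (w - z))"
      using z by (intro add_right_mono) auto
    also have "\<dots> = ereal a + ereal (blinfun_apply f (w - x))" by (simp add: blinfun.diff_right)
    also have "\<dots> \<le> g w" using x a by (simp add: subdiff_def)
    finally show "g z + ereal (blinfun_apply f (w - z)) \<le> g w" .
  qed
  hence "?S \<subseteq> {z. subdiff g z \<noteq> {}}" by blast
  hence "strictly_convex_ereal_on ?S g"
    using esc cS unfolding essentially_strictly_convex_def by blast
  moreover have "(1/2 :: real) \<in> {0<..<1}" by simp
  ultimately have "g ((1/2) *\<^sub>R x + (1 - 1/2) *\<^sub>R y) < ereal (1/2) * g x + ereal (1 - 1/2) * g y"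
    using S ne unfolding strictly_convex_ereal_on_def by blast
  also have "\<dots> = ereal (a + blinfun_apply f ((1/2) *\<^sub>R (y - x)))"
    by (simp add: a b ab blinfun.scaleR_right add_divide_distrib)
  also have "\<dots> = g x + ereal (blinfun_apply f (((1/2) *\<^sub>R x + (1 - 1/2) *\<^sub>R y) - x))"
  proof -
    have "((1/2) *\<^sub>R x + (1 - 1/2) *\<^sub>R y) - x = (1/2) *\<^sub>R y - (1/2) *\<^sub>R x"
      using scaleR_left_diff_distrib[of "1/2" 1 x] by (simp add: algebra_simps)
    thus ?thesis by (simp only: a scaleR_diff_right plus_ereal.simps)
  qed
  also have "\<dots> \<le> g ((1/2) *\<^sub>R x + (1 - 1/2) *\<^sub>R y)" using x by (simp add: subdiff_def)
  finally show False by simp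
qed

section \<open>Gradients of a Legendre function and of its conjugate\<close>

locale legendre_fun =
  fixes g :: "'a::banach \<Rightarrow> ereal"
  assumes uc: "uniformly_convex_space TYPE('a)" and legendre: "legendre g"
begin

abbreviation "U \<equiv> interior (eff_dom g)"
abbreviation "Ustar \<equiv> interior (eff_dom (fenchel_conj g))"

lemma proper: "proper_fun g" and lsc: "lsc_on UNIV g" and conv: "convex_ereal g"
  and smooth: "essentially_smooth g" and strict: "essentially_strictly_convex g"
  using legendre by (auto simp: legendre_def)

lemma nm: "g x \<noteq> -\<infinity>" using proper by (auto simp: proper_fun_def)

lemma conj_nm: "fenchel_conj g f \<noteq> -\<infinity>" by (rule fenchel_conj_not_MInf[OF proper])

text \<open>Real values of g and of its conjugate, faithful on the effective domains only. With
  them, Bregman identities become real linear arithmetic.\<close>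

definition G where "G x = real_of_ereal (g x)"
definition H where "H f = real_of_ereal (fenchel_conj g f)"

lemma g_G: "x \<in> eff_dom g \<Longrightarrow> g x = ereal (G x)"
  unfolding G_def by (rule eff_dom_real[OF nm])

lemma conj_H: "f \<in> eff_dom (fenchel_conj g) \<Longrightarrow> fenchel_conj g f = ereal (H f)"
  unfolding H_def by (rule eff_dom_real[OF conj_nm])

lemma U_dom: "x \<in> U \<Longrightarrow> x \<in> eff_dom g" using interior_subset by blast

text \<open>Each direction has its own exact subgradient, and essential smoothness makes them
  coincide. One functional is thus exact in every direction, which is Gateaux
  differentiability.\<close>

lemma has_gradient_U:
  assumes x: "x \<in> U"
  shows "has_gradient g (grad g x) x" "subdiff g x = {grad g x}"
proof -
  have ex: "\<exists>f\<in>subdiff g x. \<forall>c>blinfun_apply f h. \<exists>t>0. g (x + t *\<^sub>R h) < g x + ereal (c * t)" for h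
    by (rule subgradient_attains_directional_derivative[OF lsc conv nm x, of h]) blast
  then obtain f where f: "subdiff g x = {f}"
    using smooth unfolding essentially_smooth_def single_valued_on_dom_def by (metis empty_iff)
  have "has_gradient g f x"
    by (rule subgradient_has_gradient[OF conv nm x]) (use f ex in auto)
  thus "has_gradient g (grad g x) x" "subdiff g x = {grad g x}"
    using f grad_eqI by metis+
qed

text \<open>The conjugate is at most M on a ball around s. For small f, Young's inequality at s + f
  gives f(z) \<le> M + g(z) - s(z) \<le> M + c, and bounded values on a ball of functionals bound
  z.\<close>

lemma conj_level_bounded:
  assumes s: "s \<in> Ustar"
  shows "bounded {z. g z \<le> ereal (blinfun_apply s z + c)}"
proof -
  obtain M d where d: "d > 0" "\<And>f. f \<in> ball s d \<Longrightarrow> fenchel_conj g f \<le> ereal M"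
    using lsc_convex_locally_bounded_above[OF lsc_fenchel_conj[OF proper] convex_fenchel_conj[OF proper] s] by metis
  have "norm z \<le> (M + c) / (d / 2)" if z: "g z \<le> ereal (blinfun_apply s z + c)" for z
  proof (rule norm_le_functional_bound)
    show "d / 2 > 0" using d(1) by simp
    fix f :: "'a \<Rightarrow>\<^sub>L real" assume "norm f \<le> d / 2"
    hence "s + f \<in> ball s d" using d(1) by (simp add: dist_norm)
    have zd: "z \<in> eff_dom g" using z by (auto simp: eff_dom_def)
    have "ereal (blinfun_apply (s + f) z) - g z \<le> ereal M"
      using fenchel_conj_ge d(2)[OF \<open>s + f \<in> ball s d\<close>] by (rule order_trans)
    thus "blinfun_apply f z \<le> M + c" using z by (simp add: g_G[OF zd] blinfun.add_left)
  qed
  thus ?thesis by (auto simp: bounded_iff)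
qed

lemma conj_lower:
  assumes "f \<in> eff_dom (fenchel_conj g)"
  shows "ereal (blinfun_apply f z - H f) \<le> g z"
  using fenchel_conj_ge[of f z g] conj_H[OF assms] by (cases "g z") (auto simp: nm)

text \<open>A minimiser of g - s has s as a subgradient; one exists because the sublevel sets of g -
  s are bounded.\<close>

lemma ex_subdiff_conj:
  assumes s: "s \<in> Ustar"
  obtains x where "s \<in> subdiff g x"
proof -
  have sd: "s \<in> eff_dom (fenchel_conj g)" using s interior_subset by blast
  obtain z0 where z0: "g z0 < \<infinity>" using proper by (auto simp: proper_fun_def eff_dom_def)
  obtain x where x: "g x < \<infinity>" "\<And>w. g x + ereal (blinfun_apply s (w - x)) \<le> g w"
  proof (rule attains_tilted_minimum[OF uc lsc conv closed_UNIV convex_UNIV UNIV_I z0, of s "- H s"])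
    show "ereal (blinfun_apply s z + - H s) \<le> g z" for z using conj_lower[OF sd] by simp
    show "bounded (UNIV \<inter> {z. g z \<le> ereal (blinfun_apply s z + c)})" for c
      using conj_level_bounded[OF s] by simp
  qed blast
  thus thesis using that by (auto simp: subdiff_def eff_dom_def)
qed

lemma subdiff_inj: "f \<in> subdiff g x \<Longrightarrow> f \<in> subdiff g y \<Longrightarrow> x = y"
  by (rule strictly_convex_subdiff_inj[OF proper conv strict])

text \<open>If the slope of \<open>g*\<close> at \<open>s\<close> in direction \<open>\<phi>\<close> were at least \<open>c > \<phi> x\<close>, the minimisers \<open>y\<close> of
  \<open>g - (s + t \<phi>)\<close> for small \<open>t > 0\<close> would almost minimise \<open>g - s\<close> while \<open>\<phi> y \<ge> c\<close>; a common point of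
  the corresponding closed sets would be a second minimiser of \<open>g - s\<close>.\<close>

lemma conj_directional_derivative:
  assumes s: "s \<in> Ustar" and x: "s \<in> subdiff g x" and c: "blinfun_apply \<phi> x < c"
  shows "\<exists>t>0. fenchel_conj g (s + t *\<^sub>R \<phi>) < fenchel_conj g s + ereal (c * t)"
proof (rule ccontr)
  assume neg: "\<not> ?thesis"
  have sd: "s \<in> eff_dom (fenchel_conj g)" using s interior_subset by blast
  define \<theta> where "\<theta> t = H (s + t *\<^sub>R \<phi>)" for t
  obtain e where e: "e > 0" "\<And>t. \<bar>t\<bar> < e \<Longrightarrow> s + t *\<^sub>R \<phi> \<in> Ustar"
    using interior_line[OF s] by metis
  have e': "s + t *\<^sub>R \<phi> \<in> eff_dom (fenchel_conj g)" if "\<bar>t\<bar> < e" for t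
    using e(2)[OF that] interior_subset by blast
  have low: "\<theta> 0 + c * t \<le> \<theta> t" if "0 < t" "t < e" for t
  proof -
    have "fenchel_conj g s + ereal (c * t) \<le> fenchel_conj g (s + t *\<^sub>R \<phi>)"
      using neg that(1) by (metis not_less)
    thus ?thesis
      unfolding conj_H[OF sd] conj_H[OF e'[of t, simplified abs_of_pos[OF that(1)], OF that(2)]]
      by (simp add: \<theta>_def)
  qed
  have young: "\<theta> t = blinfun_apply (s + t *\<^sub>R \<phi>) y - G y" if "s + t *\<^sub>R \<phi> \<in> subdiff g y" for t y
    using fenchel_conj_subdiff[OF that g_G] that by (simp add: \<theta>_def H_def subdiff_def)
  have young_le: "blinfun_apply (s + t *\<^sub>R \<phi>) y - G y \<le> \<theta> t" if "\<bar>t\<bar> < e" "y \<in> eff_dom g" for t y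
    using conj_lower[OF e'[OF that(1)], of y] g_G[OF that(2)] by (simp add: \<theta>_def)
  have "convex_on {-e<..<e} \<theta>"
    unfolding \<theta>_def H_def
    by (rule convex_on_line[OF convex_fenchel_conj[OF proper] conj_nm]) (use e' in auto)
  hence "continuous_on {-e<..<e} \<theta>" by (intro convex_on_continuous) auto
  hence cont: "isCont \<theta> 0" using e(1) by (simp add: continuous_on_eq_continuous_at)
  \<comment> \<open>If y minimises g - (s + t \<phi>), twice Young's equality at t minus Young's
    inequality at 2 t bounds G y - s(y) + H s by this second difference. Continuity of \<theta> at 0
    makes it small.\<close>
  have "((\<lambda>t. \<theta> (2 * t) - 2 * \<theta> t + \<theta> 0) \<longlongrightarrow> \<theta> 0 - 2 * \<theta> 0 + \<theta> 0) (at_right 0)"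
  proof (intro tendsto_intros)
    show "(\<theta> \<longlongrightarrow> \<theta> 0) (at_right 0)"
      using cont by (simp add: isCont_def filterlim_at_split)
    show "((\<lambda>t. \<theta> (2 * t)) \<longlongrightarrow> \<theta> 0) (at_right 0)"
      by (rule isCont_tendsto_compose[OF cont]) (auto intro!: tendsto_eq_intros)
  qed
  hence lim: "((\<lambda>t. \<theta> (2 * t) - 2 * \<theta> t + \<theta> 0) \<longlongrightarrow> 0) (at_right 0)" by simp
  define K where "K n = {z. g z \<le> ereal (blinfun_apply s z + (1 / Suc n - H s))} \<inter> {z. c \<le> blinfun_apply \<phi> z}" for n
  have "(\<Inter>n. K n) \<noteq> {}"
  proof (rule uniformly_convex_nested_Inter[OF uc])
    fix n
    show "closed (K n)" unfolding K_def
      by (intro closed_Int lsc_closed_sublevel_blinfun lsc closed_Collect_le continuous_intros)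
    have "convex {z. c \<le> blinfun_apply \<phi> z}"
    proof (rule convexI, simp add: blinfun.add_right blinfun.scaleR_right)
      fix y z and u v :: real
      assume *: "c \<le> blinfun_apply \<phi> y" "c \<le> blinfun_apply \<phi> z" "0 \<le> u" "0 \<le> v" "u + v = 1"
      hence "u * c + v * c \<le> u * blinfun_apply \<phi> y + v * blinfun_apply \<phi> z"
        by (intro add_mono mult_left_mono) auto
      thus "c \<le> u * blinfun_apply \<phi> y + v * blinfun_apply \<phi> z"
        using * by (simp flip: distrib_right)
    qed
    thus "convex (K n)" unfolding K_def by (intro convex_Int convex_ereal_sublevel conv)
    have "1 / real (Suc (Suc n)) \<le> 1 / real (Suc n)" by (simp add: field_simps)
    thus "K (Suc n) \<subseteq> K n" unfolding K_def by (force elim: order_trans)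
    have "\<forall>\<^sub>F t in at_right 0. \<theta> (2 * t) - 2 * \<theta> t + \<theta> 0 < 1 / Suc n"
      using lim by (rule order_tendstoD) simp
    moreover have "\<forall>\<^sub>F t in at_right 0. t < e / 2"
      using e(1) by (intro eventually_at_rightI[of 0 "e / 2"]) auto
    moreover have "\<forall>\<^sub>F t in at_right 0. (0::real) < t"
      by (rule eventually_at_right_less)
    ultimately have "\<forall>\<^sub>F t in at_right 0. \<theta> (2 * t) - 2 * \<theta> t + \<theta> 0 < 1 / Suc n \<and> t < e / 2 \<and> 0 < t"
      by eventually_elim auto
    then obtain t where t: "\<theta> (2 * t) - 2 * \<theta> t + \<theta> 0 < 1 / Suc n" "t < e / 2" "0 < t"
      using eventually_happens[of _ "at_right (0::real)"] by auto
    obtain y where y: "s + t *\<^sub>R \<phi> \<in> subdiff g y"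
      using ex_subdiff_conj[OF e(2)[of t]] t by auto
    have yd: "y \<in> eff_dom g" using y by (simp add: subdiff_def)
    have 1: "\<theta> t = blinfun_apply s y + t * blinfun_apply \<phi> y - G y"
      using young[OF y] by (simp add: blinfun.add_left blinfun.scaleR_left)
    have 2: "blinfun_apply s y - G y \<le> \<theta> 0"
      using young_le[of 0, OF _ yd] e(1) by simp
    have 3: "blinfun_apply s y + 2 * t * blinfun_apply \<phi> y - G y \<le> \<theta> (2 * t)"
      using young_le[of "2 * t", OF _ yd] t by (simp add: blinfun.add_left blinfun.scaleR_left)
    \<comment> \<open>The negated claim makes \<theta> grow by at least c t, while \<theta> t is
      attained at y and s(y) - G y \<le> \<theta> 0.\<close>
    have "t * c \<le> t * blinfun_apply \<phi> y" using low[of t] 1 2 t unfolding mult.commute[of t c] by linarith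
    hence "c \<le> blinfun_apply \<phi> y" using t(3) by (rule mult_left_le_imp_le)
    moreover have "G y \<le> blinfun_apply s y + (1 / Suc n - H s)"
      using 1 3 t(1) by (simp add: \<theta>_def)
    ultimately have "y \<in> K n" using g_G[OF yd] by (simp add: K_def)
    thus "K n \<noteq> {}" by blast
  next
    show "bounded (K 0)" unfolding K_def
      by (rule bounded_subset[OF conj_level_bounded[OF s]]) blast
  qed
  then obtain z where z: "\<And>n. z \<in> K n" by blast
  have zd: "z \<in> eff_dom g" using z[of 0] by (auto simp: K_def eff_dom_def)
  have "G z - blinfun_apply s z + H s \<le> inverse (Suc n)" for n
    using z[of n] g_G[OF zd] by (simp add: K_def inverse_eq_divide)
  hence le: "G z - blinfun_apply s z + H s \<le> 0"
    by (intro LIMSEQ_le_const[OF LIMSEQ_inverse_real_of_nat]) auto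
  have "s \<in> subdiff g z"
    unfolding subdiff_def
  proof (intro CollectI conjI allI zd)
    fix w
    have "g z + ereal (blinfun_apply s (w - z)) \<le> ereal (blinfun_apply s w - H s)"
      using le g_G[OF zd] by (simp add: blinfun.diff_right)
    also have "\<dots> \<le> g w" by (rule conj_lower[OF sd])
    finally show "g z + ereal (blinfun_apply s (w - z)) \<le> g w" .
  qed
  hence "z = x" using x by (rule subdiff_inj)
  thus False using z[of 0] c by (simp add: K_def)
qed

text \<open>Young's equality makes evaluation at x a subgradient of the conjugate at s, and the
  preceding lemma makes it exact in every direction. Since functionals separate points, the
  description in \<open>grad_conj\<close> selects x.\<close>

lemma grad_conj_eq:
  assumes s: "s \<in> Ustar" and x: "s \<in> subdiff g x"
  shows "grad_conj g s = x"
proof -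
  have sd: "s \<in> eff_dom (fenchel_conj g)" using s interior_subset by blast
  have xd: "x \<in> eff_dom g" using x by (simp add: subdiff_def)
  define ev where "ev = Blinfun (\<lambda>f :: 'a \<Rightarrow>\<^sub>L real. blinfun_apply f x)"
  have ev: "blinfun_apply ev f = blinfun_apply f x" for f
    unfolding ev_def by (simp add: bounded_linear_Blinfun_apply blinfun.bounded_linear_left)
  have Hs: "fenchel_conj g s = ereal (blinfun_apply s x - G x)"
    by (rule fenchel_conj_subdiff[OF x g_G[OF xd]])
  have "has_gradient (fenchel_conj g) ev s"
  proof (rule subgradient_has_gradient[OF convex_fenchel_conj[OF proper] conj_nm s])
    show "ev \<in> subdiff (fenchel_conj g) s"
      unfolding subdiff_def
    proof (intro CollectI conjI allI sd)
      fix f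
      have "fenchel_conj g s + ereal (blinfun_apply ev (f - s)) = ereal (blinfun_apply f x) - g x"
        by (simp add: Hs ev g_G[OF xd] blinfun.diff_left)
      thus "fenchel_conj g s + ereal (blinfun_apply ev (f - s)) \<le> fenchel_conj g f"
        using fenchel_conj_ge[of f x g] by simp
    qed
  qed (use conj_directional_derivative[OF s x] in \<open>simp add: ev\<close>)
  hence "grad (fenchel_conj g) s = ev" by (rule grad_eqI)
  hence "grad_conj g s = (THE y. \<forall>f :: 'a \<Rightarrow>\<^sub>L real. blinfun_apply f x = blinfun_apply f y)"
    unfolding grad_conj_def by (simp add: ev)
  also have "\<dots> = x" by (rule the_equality) (auto intro: blinfun_separates)
  finally show ?thesis .
qed

lemma grad_conj_grad:
  assumes "x \<in> U" "grad g x \<in> Ustar"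
  shows "grad_conj g (grad g x) = x"
  using assms has_gradient_U(2) by (intro grad_conj_eq) auto

text \<open>Membership of the preimage in U identifies its subgradient s with its gradient. In the
  scheme it holds because the means lie in \<open>K1\<close>.\<close>

lemma grad_grad_conj:
  assumes "s \<in> Ustar" "grad_conj g s \<in> U"
  shows "grad g (grad_conj g s) = s"
proof -
  obtain x where x: "s \<in> subdiff g x" using ex_subdiff_conj[OF assms(1)] by blast
  with assms grad_conj_eq has_gradient_U(2) show ?thesis by (metis singletonD)
qed

end

section \<open>The duality mapping\<close>

text \<open>With v = x / |x|, the sum f1(v + y) + f2(v - y) equals 2 |x| + (f1 - f2)(y) and is at
  most |x| (|v + y| + |v - y|). Uniform smoothness bounds this by |x| (2 + \<epsilon> |y|) for small
  y, so f1 - f2 has norm at most \<epsilon> |x|.\<close>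

lemma duality_set_unique:
  fixes x :: "'a::real_normed_vector"
  assumes us: "uniformly_smooth_space TYPE('a)" and f: "f1 \<in> duality_set x" "f2 \<in> duality_set x"
  shows "f1 = f2"
proof (cases "x = 0")
  case True
  thus ?thesis using f by (simp add: duality_set_def)
next
  case False
  hence nx: "norm x > 0" by simp
  have n: "norm f = norm x" "blinfun_apply f x = (norm x)\<^sup>2" if "f \<in> duality_set x" for f
    using that by (auto simp: duality_set_def)
  define v where "v = x /\<^sub>R norm x"
  have v: "norm v = 1" using nx by (simp add: v_def)
  have fv: "blinfun_apply f v = norm x" if "f \<in> duality_set x" for f
  proof -
    have "blinfun_apply f v = inverse (norm x) * (norm x)\<^sup>2"
      by (simp add: v_def blinfun.scaleR_right n(2)[OF that])
    thus ?thesis using nx by (simp add: power2_eq_square)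
  qed
  have le: "norm (f1 - f2) \<le> \<epsilon> * norm x" if "\<epsilon> > 0" for \<epsilon>
  proof -
    obtain \<delta> where \<delta>: "\<delta> > 0" "\<And>x y :: 'a. norm x = 1 \<Longrightarrow> norm y \<le> \<delta> \<Longrightarrow> norm (x + y) + norm (x - y) \<le> 2 + \<epsilon> * norm y"
      using us \<open>\<epsilon> > 0\<close> unfolding uniformly_smooth_space_def by blast
    have small: "blinfun_apply (f1 - f2) y \<le> \<epsilon> * norm x * norm y" if "norm y \<le> \<delta>" for y
    proof -
      have "blinfun_apply f1 (v + y) + blinfun_apply f2 (v - y) \<le> norm x * norm (v + y) + norm x * norm (v - y)"
        using norm_blinfun[of f1 "v + y"] norm_blinfun[of f2 "v - y"] n(1)[OF f(1)] n(1)[OF f(2)]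
        by (intro add_mono) auto
      also have "\<dots> \<le> norm x * (2 + \<epsilon> * norm y)"
        using \<delta>(2)[OF v that] nx by (simp flip: distrib_left)
      finally show ?thesis
        using fv[OF f(1)] fv[OF f(2)]
        by (simp add: blinfun.add_right blinfun.diff_right blinfun.diff_left algebra_simps)
    qed
    have pos: "blinfun_apply (f1 - f2) y \<le> \<epsilon> * norm x * norm y" for y
    proof (cases "y = 0")
      case False
      let ?c = "\<delta> / norm y"
      have c: "?c > 0" using \<delta>(1) False by simp
      have "blinfun_apply (f1 - f2) (?c *\<^sub>R y) \<le> \<epsilon> * norm x * norm (?c *\<^sub>R y)"
        using \<delta>(1) False by (intro small) simp
      hence "?c * blinfun_apply (f1 - f2) y \<le> ?c * (\<epsilon> * norm x * norm y)"
        by (simp only: blinfun.scaleR_right norm_scaleR abs_of_pos[OF c] real_scaleR_def mult_ac)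
      thus ?thesis using c mult_le_cancel_left_pos by blast
    qed simp
    show ?thesis
    proof (rule norm_blinfun_bound)
      show "norm (blinfun_apply (f1 - f2) y) \<le> \<epsilon> * norm x * norm y" for y
        using pos[of y] pos[of "- y"] by (simp add: blinfun.minus_right abs_le_iff)
    qed (use that in simp)
  qed
  have "norm (f1 - f2) \<le> 0"
  proof (rule field_le_epsilon)
    fix e :: real assume "e > 0"
    thus "norm (f1 - f2) \<le> 0 + e" using le[of "e / norm x"] nx by simp
  qed
  thus ?thesis by simp
qed

text \<open>f attains its norm: the slices of the unit ball where f is within 1 / (n + 1) of its
  norm are nested, closed and convex, hence have a common point. Scaling that point by the norm of f
  gives the preimage under J.\<close>

lemma ex_duality_set:
  fixes f :: "'a::banach \<Rightarrow>\<^sub>L real"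
  assumes uc: "uniformly_convex_space TYPE('a)"
  obtains x where "f \<in> duality_set x"
proof (cases "f = 0")
  case True
  thus thesis using that[of 0] by (simp add: duality_set_def)
next
  case False
  hence nf: "norm f > 0" by simp
  define K where "K n = cball 0 1 \<inter> {x. norm f - 1 / Suc n \<le> blinfun_apply f x}" for n
  have "(\<Inter>n. K n) \<noteq> {}"
  proof (rule uniformly_convex_nested_Inter[OF uc])
    fix n
    show "closed (K n)" unfolding K_def
      by (intro closed_Int closed_cball closed_Collect_le continuous_intros)
    have "convex {x. norm f - 1 / Suc n \<le> blinfun_apply f x}"
    proof (rule convexI, unfold mem_Collect_eq blinfun.add_right blinfun.scaleR_right real_scaleR_def)
      fix y z and u v :: real
      assume *: "norm f - 1 / Suc n \<le> blinfun_apply f y" "norm f - 1 / Suc n \<le> blinfun_apply f z"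
        "0 \<le> u" "0 \<le> v" "u + v = 1"
      hence "u * (norm f - 1 / Suc n) + v * (norm f - 1 / Suc n) \<le> u * blinfun_apply f y + v * blinfun_apply f z"
        by (intro add_mono mult_left_mono) auto
      thus "norm f - 1 / Suc n \<le> u * blinfun_apply f y + v * blinfun_apply f z"
        using *(5) by (metis distrib_right mult_1)
    qed
    thus "convex (K n)" unfolding K_def by (intro convex_Int convex_cball)
    have "1 / real (Suc (Suc n)) \<le> 1 / real (Suc n)" by (simp add: field_simps)
    thus "K (Suc n) \<subseteq> K n" unfolding K_def by auto
    show "K n \<noteq> {}"
    proof
      assume empty: "K n = {}"
      have one: "blinfun_apply f y \<le> norm f - 1 / Suc n" if "norm y \<le> 1" for y
        using empty that by (force simp: K_def)
      have "norm f \<le> norm f - 1 / Suc n"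
      proof (rule norm_blinfun_bound)
        show "0 \<le> norm f - 1 / Suc n" using one[of 0] by simp
        fix y
        show "norm (blinfun_apply f y) \<le> (norm f - 1 / Suc n) * norm y"
        proof (cases "y = 0")
          case False
          have "\<sigma> * blinfun_apply f y \<le> (norm f - 1 / Suc n) * norm y" if "\<bar>\<sigma>\<bar> = 1" for \<sigma>
          proof -
            have "blinfun_apply f ((\<sigma> / norm y) *\<^sub>R y) \<le> norm f - 1 / Suc n"
              using False that by (intro one) simp
            hence "\<sigma> * blinfun_apply f y / norm y \<le> norm f - 1 / Suc n"
              by (simp add: blinfun.scaleR_right)
            thus ?thesis using False by (simp add: pos_divide_le_eq)
          qed
          from this[of 1] this[of "-1"] show ?thesis by (simp add: abs_le_iff)
        qed simp
      qed
      thus False by simp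
    qed
  next
    show "bounded (K 0)" unfolding K_def by (rule bounded_subset[OF bounded_cball]) blast
  qed
  then obtain x where x: "\<And>n. x \<in> K n" by blast
  have nx: "norm x \<le> 1" using x[of 0] by (simp add: K_def)
  have "norm f - blinfun_apply f x \<le> inverse (Suc n)" for n
    using x[of n] by (simp add: K_def inverse_eq_divide)
  hence "norm f - blinfun_apply f x \<le> 0"
    by (intro LIMSEQ_le_const[OF LIMSEQ_inverse_real_of_nat]) auto
  moreover have fx: "blinfun_apply f x \<le> norm f * norm x"
    using norm_blinfun[of f x] by simp
  moreover have "norm f * norm x \<le> norm f * 1" by (intro mult_left_mono nx) auto
  ultimately have "blinfun_apply f x = norm f" "norm f * norm x = norm f" by linarith+
  hence "blinfun_apply f x = norm f" "norm x = 1" using nf by simp_all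
  hence "f \<in> duality_set (norm f *\<^sub>R x)"
    by (simp add: duality_set_def blinfun.scaleR_right power2_eq_square)
  thus thesis by (rule that)
qed

text \<open>Surjectivity makes \<open>inv\<close> a right inverse. This converts q = J_* T q into T
  q = J q at the end.\<close>

lemma duality_map_inverse:
  fixes f :: "'a::banach \<Rightarrow>\<^sub>L real"
  assumes "uniformly_smooth_space TYPE('a)" "uniformly_convex_space TYPE('a)"
  shows "duality_map (duality_map_inv f) = f"
proof -
  have "\<exists>x. f = duality_map x" for f :: "'a \<Rightarrow>\<^sub>L real"
  proof -
    obtain x where "f \<in> duality_set x" using ex_duality_set[OF assms(2)] by metis
    hence "duality_map x = f"
      unfolding duality_map_def using duality_set_unique[OF assms(1)] by blast
    thus ?thesis by blast
  qed
  hence "surj (duality_map :: 'a \<Rightarrow> _)" unfolding surj_def by blast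
  thus ?thesis unfolding duality_map_inv_def by (rule surj_f_inv_f)
qed

section \<open>Equilibrium problems and Bregman projections\<close>

lemma equilibrium_bifunctionD:
  assumes "equilibrium_bifunction C \<Theta>"
  shows "x \<in> C \<Longrightarrow> \<Theta> x x = 0"
    and "x \<in> C \<Longrightarrow> y \<in> C \<Longrightarrow> \<Theta> x y + \<Theta> y x \<le> 0"
    and "x \<in> C \<Longrightarrow> y \<in> C \<Longrightarrow> z \<in> C \<Longrightarrow>
      Limsup (at_right 0) (\<lambda>t. ereal (\<Theta> (t *\<^sub>R z + (1 - t) *\<^sub>R x) y)) \<le> ereal (\<Theta> x y)"
    and "x \<in> C \<Longrightarrow> convex_on C (\<Theta> x)"
    and "x \<in> C \<Longrightarrow> lsc_on C (\<lambda>y. ereal (\<Theta> x y))"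
  using assms unfolding equilibrium_bifunction_def by blast+

text \<open>Minty's device. Monotonicity moves the varying point into the second argument, where
  lower semicontinuity gives \<Theta>(y, q) \<le> 0 for all y. Testing at y_t = t y + (1 - t) q,
  convexity and \<Theta>(y_t, y_t) = 0 give \<Theta>(y_t, y) \<ge> 0, and t tends to 0. The sequence
  b y is the vanishing resolvent error.\<close>

lemma equilibrium_limit_in_EP:
  assumes \<Theta>: "equilibrium_bifunction C \<Theta>" and C: "convex C"
    and z: "\<And>n. z n \<in> C" "z \<longlonglongrightarrow> q" "q \<in> C"
    and b: "\<And>y. y \<in> C \<Longrightarrow> b y \<longlonglongrightarrow> (0::real)"
      "\<And>n y. y \<in> C \<Longrightarrow> 0 \<le> \<Theta> (z n) y + b y n"
  shows "q \<in> EP C \<Theta>"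
  unfolding EP_def
proof (intro CollectI conjI ballI z(3))
  note mon = equilibrium_bifunctionD(2)[OF \<Theta>] and conv = equilibrium_bifunctionD(4)[OF \<Theta>]
    and lsc = equilibrium_bifunctionD(5)[OF \<Theta>]
  have le0: "\<Theta> y q \<le> 0" if y: "y \<in> C" for y
  proof (rule ccontr)
    assume "\<not> ?thesis"
    then obtain c where c: "0 < c" "c < \<Theta> y q" using dense[of 0 "\<Theta> y q"] by auto
    have "\<forall>\<^sub>F v in at q within C. ereal c < ereal (\<Theta> y v)"
      using lsc_on_eventually_greater[OF lsc[OF y] z(3), of "ereal c"] c by simp
    hence "\<forall>\<^sub>F v in nhds q. v \<in> C \<longrightarrow> v \<noteq> q \<longrightarrow> c < \<Theta> y v"
      by (auto simp: eventually_at_filter elim: eventually_mono)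
    hence "\<forall>\<^sub>F n in sequentially. z n \<in> C \<longrightarrow> z n \<noteq> q \<longrightarrow> c < \<Theta> y (z n)"
      using z(2) by (rule eventually_compose_filterlim)
    moreover have "\<forall>\<^sub>F n in sequentially. b y n < c"
      using b(1)[OF y] c(1) by (rule order_tendstoD)
    ultimately have "\<forall>\<^sub>F n in sequentially. False"
    proof eventually_elim
      case (elim n)
      \<comment> \<open>The lower limit in \<open>lsc_on\<close> ignores the point q itself, so z n
        = q is treated separately.\<close>
      have "c < \<Theta> y (z n)" using elim(1) c(2) z(1)[of n] by (cases "z n = q") simp_all
      thus False using mon[OF y z(1)[of n]] b(2)[OF y, of n] elim(2) by linarith
    qed
    thus False by simp
  qed
  fix y assume y: "y \<in> C"
  have pos: "0 \<le> \<Theta> (t *\<^sub>R y + (1 - t) *\<^sub>R q) y" if t: "0 < t" "t < 1" for t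
  proof -
    let ?y = "t *\<^sub>R y + (1 - t) *\<^sub>R q"
    have yC: "?y \<in> C" using y z(3) t by (intro convexD[OF C]) auto
    have "0 = \<Theta> ?y ?y" using equilibrium_bifunctionD(1)[OF \<Theta> yC] by simp
    also have "\<dots> = \<Theta> ?y ((1 - t) *\<^sub>R q + t *\<^sub>R y)" by (simp add: add.commute)
    also have "\<dots> \<le> (1 - t) * \<Theta> ?y q + t * \<Theta> ?y y"
      using t y z(3) by (intro convex_onD[OF conv[OF yC]]) auto
    also have "(1 - t) * \<Theta> ?y q \<le> 0"
      using le0[OF yC] t by (simp add: mult_nonneg_nonpos)
    finally have "0 \<le> t * \<Theta> ?y y" by simp
    thus ?thesis using t by (simp add: zero_le_mult_iff)
  qed
  have "0 \<le> Limsup (at_right 0) (\<lambda>t. ereal (\<Theta> (t *\<^sub>R y + (1 - t) *\<^sub>R q) y))"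
  proof (rule le_Limsup)
    show "\<forall>\<^sub>F t in at_right 0. 0 \<le> ereal (\<Theta> (t *\<^sub>R y + (1 - t) *\<^sub>R q) y)"
      using pos by (intro eventually_at_rightI[of 0 1]) auto
  qed simp
  also have "\<dots> \<le> ereal (\<Theta> q y)"
    by (rule equilibrium_bifunctionD(3)[OF \<Theta> z(3) y y])
  finally show "0 \<le> \<Theta> q y" by simp
qed

context legendre_fun
begin

lemma bregman_G: "bregman g p y = G p - G y - blinfun_apply (grad g y) (p - y)"
  by (simp add: bregman_def G_def)

lemma bregman_refl: "bregman g y y = 0"
  by (simp add: bregman_G)

lemma bregman_nonneg:
  assumes "p \<in> U" "y \<in> U" shows "0 \<le> bregman g p y"
proof -
  have "g y + ereal (blinfun_apply (grad g y) (p - y)) \<le> g p"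
    using has_gradient_U(2)[OF assms(2)] by (auto simp: subdiff_def)
  thus ?thesis using g_G U_dom assms by (simp add: bregman_G)
qed

lemma bregman_three_point:
  "bregman g p x - bregman g p z - bregman g z x = blinfun_apply (grad g z - grad g x) (p - z)"
  by (simp add: bregman_G blinfun.diff_left blinfun.diff_right)

text \<open>In this form D(p, y) depends on y through its gradient alone, by way of the conjugate;
  averaging gradients can then be estimated by convexity of the conjugate.\<close>

lemma bregman_conj:
  assumes "y \<in> U"
  shows "bregman g p y = G p + H (grad g y) - blinfun_apply (grad g y) p"
proof -
  have "H (grad g y) = blinfun_apply (grad g y) y - G y"
    using fenchel_conj_subdiff[of "grad g y" g y] has_gradient_U(2)[OF assms] g_G[OF U_dom[OF assms]]
    by (simp add: H_def)
  thus ?thesis by (simp add: bregman_G blinfun.diff_right)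
qed

text \<open>First-order optimality: minimality bounds the difference quotients of G from z towards w
  below by the gradient at x applied to w - z. In the limit, the three-point identity turns this
  into the claim.\<close>

lemma bregman_minimizer:
  assumes D: "convex D" "D \<subseteq> U" and z: "z \<in> D" "\<And>w. w \<in> D \<Longrightarrow> bregman g z x \<le> bregman g w x"
    and w: "w \<in> D"
  shows "bregman g w z + bregman g z x \<le> bregman g w x"
proof -
  have der: "((\<lambda>t. G (z + t *\<^sub>R (w - z))) has_real_derivative blinfun_apply (grad g z) (w - z)) (at 0)"
    using has_gradient_U(1)[of z] z(1) D(2) unfolding has_gradient_def G_def by blast
  hence lim: "((\<lambda>t. (G (z + t *\<^sub>R (w - z)) - G z) / t) \<longlongrightarrow> blinfun_apply (grad g z) (w - z)) (at_right 0)"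
    by (simp add: DERIV_def filterlim_at_split)
  have "blinfun_apply (grad g x) (w - z) \<le> blinfun_apply (grad g z) (w - z)"
  proof (rule tendsto_lowerbound[OF lim])
    have "blinfun_apply (grad g x) (w - z) \<le> (G (z + t *\<^sub>R (w - z)) - G z) / t" if t: "0 < t" "t < 1" for t
    proof -
      have "z + t *\<^sub>R (w - z) = (1 - t) *\<^sub>R z + t *\<^sub>R w" by (simp add: algebra_simps)
      also have "\<dots> \<in> D" using t z w by (intro convexD D) auto
      finally have "bregman g z x \<le> bregman g (z + t *\<^sub>R (w - z)) x" by (rule z(2))
      hence "t * blinfun_apply (grad g x) (w - z) \<le> G (z + t *\<^sub>R (w - z)) - G z"
        by (simp add: bregman_G blinfun.diff_right blinfun.add_right blinfun.scaleR_right)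
      thus ?thesis using t by (simp add: pos_le_divide_eq mult.commute)
    qed
    thus "\<forall>\<^sub>F t in at_right 0. blinfun_apply (grad g x) (w - z) \<le> (G (z + t *\<^sub>R (w - z)) - G z) / t"
      by (intro eventually_at_rightI[of 0 1]) auto
  qed simp
  thus ?thesis using bregman_three_point[of w x z] by (simp add: blinfun.diff_left)
qed

text \<open>For p in S no farther from x than z, \<open>bregman_minimizer\<close> gives D(p, z)
  \<le> 0, hence p = z. Two sets appear because the limit of the scheme minimises over the
  intersection of all C_n, whereas the projection is onto the subset S.\<close>

lemma bregman_proj_eqI:
  assumes D: "convex D" "D \<subseteq> U" and sep: "\<And>u v. u \<in> D \<Longrightarrow> v \<in> D \<Longrightarrow> bregman g u v = 0 \<Longrightarrow> u = v"
    and z: "z \<in> D" "\<And>w. w \<in> D \<Longrightarrow> bregman g z x \<le> bregman g w x"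
    and S: "S \<subseteq> D" "z \<in> S"
  shows "bregman_proj g S x = z"
  unfolding bregman_proj_def
proof (rule the_equality)
  show "z \<in> S \<and> (\<forall>w\<in>S. bregman g z x \<le> bregman g w x)" using z S by blast
  fix p assume p: "p \<in> S \<and> (\<forall>w\<in>S. bregman g p x \<le> bregman g w x)"
  have pD: "p \<in> D" using p S by blast
  have "bregman g p x \<le> bregman g z x" using p S by blast
  with bregman_minimizer[OF D z pD] have "bregman g p z \<le> 0" by simp
  moreover have "0 \<le> bregman g p z" using pD z(1) D(2) by (intro bregman_nonneg) auto
  ultimately show "p = z" using sep[OF pD z(1)] by simp
qed

text \<open>On U the function D(., x) is g minus a continuous affine function, so a tilted minimum
  exists; \<open>sep\<close> supplies the uniqueness that the definite description needs.\<close>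

lemma bregman_proj_minimizer:
  assumes D: "closed D" "convex D" "bounded D" "D \<noteq> {}" "D \<subseteq> U" and x: "x \<in> U"
    and sep: "\<And>u v. u \<in> D \<Longrightarrow> v \<in> D \<Longrightarrow> bregman g u v = 0 \<Longrightarrow> u = v"
  shows "bregman_proj g D x \<in> D" "\<And>w. w \<in> D \<Longrightarrow> bregman g (bregman_proj g D x) x \<le> bregman g w x"
proof -
  obtain z0 where z0: "z0 \<in> D" using D by blast
  have fin: "g z < \<infinity>" if "z \<in> D" for z using that D(5) U_dom by (auto simp: eff_dom_def)
  obtain z where z: "z \<in> D" "\<And>w. w \<in> D \<Longrightarrow> g z + ereal (blinfun_apply (grad g x) (w - z)) \<le> g w"
  proof (rule attains_tilted_minimum[OF uc lsc conv D(1,2) z0 fin[OF z0], of "grad g x" "G x - blinfun_apply (grad g x) x"])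
    fix z
    have "g x + ereal (blinfun_apply (grad g x) (z - x)) \<le> g z"
      using has_gradient_U(2)[OF x] by (auto simp: subdiff_def)
    thus "ereal (blinfun_apply (grad g x) z + (G x - blinfun_apply (grad g x) x)) \<le> g z"
      using g_G[OF U_dom[OF x]] by (simp add: blinfun.diff_right add.commute add_diff_eq)
    fix c
    show "bounded (D \<inter> {z. g z \<le> ereal (blinfun_apply (grad g x) z + c)})"
      by (rule bounded_subset[OF D(3)]) blast
  qed blast
  have min: "bregman g z x \<le> bregman g w x" if "w \<in> D" for w
  proof -
    have "z \<in> U" "w \<in> U" using that z(1) D(5) by auto
    thus ?thesis using z(2)[OF that] g_G U_dom
      by (simp add: bregman_G blinfun.diff_right)
  qed
  have "bregman_proj g D x = z"
    by (rule bregman_proj_eqI[OF D(2,5) sep z(1) min]) (use z(1) in auto)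
  thus "bregman_proj g D x \<in> D" "\<And>w. w \<in> D \<Longrightarrow> bregman g (bregman_proj g D x) x \<le> bregman g w x"
    using z(1) min by auto
qed

text \<open>G z cancels from both sides, leaving an affine inequality in z.\<close>

lemma closed_convex_bregman_halfspace:
  "closed {z. bregman g z y \<le> bregman g z x}" "convex {z. bregman g z y \<le> bregman g z x}"
proof -
  define c where "c = G y - G x - blinfun_apply (grad g y) y + blinfun_apply (grad g x) x"
  have eq: "{z. bregman g z y \<le> bregman g z x} = {z. blinfun_apply (grad g x - grad g y) z \<le> c}"
    by (auto simp: bregman_G c_def blinfun.diff_left blinfun.diff_right)
  show "closed {z. bregman g z y \<le> bregman g z x}"
    unfolding eq by (intro closed_Collect_le continuous_intros)
  show "convex {z. bregman g z y \<le> bregman g z x}"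
    unfolding eq
  proof (rule convexI, unfold mem_Collect_eq blinfun.add_right blinfun.scaleR_right real_scaleR_def)
    fix u v and a b :: real
    assume *: "blinfun_apply (grad g x - grad g y) u \<le> c" "blinfun_apply (grad g x - grad g y) v \<le> c"
      "0 \<le> a" "0 \<le> b" "a + b = 1"
    have "a * blinfun_apply (grad g x - grad g y) u + b * blinfun_apply (grad g x - grad g y) v \<le> a * c + b * c"
      using * by (intro add_mono mult_left_mono) auto
    thus "a * blinfun_apply (grad g x - grad g y) u + b * blinfun_apply (grad g x - grad g y) v \<le> c"
      using *(5) by (metis distrib_right mult_1)
  qed
qed

text \<open>Test each solution with the other and add. Monotonicity removes \<Theta>, and the
  remaining pairing is minus the symmetrised distance D(z, z') + D(z', z).\<close>

lemma EP_resolvent_singleton: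
  assumes \<Theta>: "equilibrium_bifunction C \<Theta>" and C: "C \<subseteq> U" and r: "r > 0"
    and sep: "\<And>u v. u \<in> C \<Longrightarrow> v \<in> C \<Longrightarrow> bregman g u v = 0 \<Longrightarrow> u = v"
    and ne: "EP_resolvent_set g C \<Theta> r x \<noteq> {}"
  shows "EP_resolvent g C \<Theta> r x \<in> EP_resolvent_set g C \<Theta> r x"
proof -
  have "z = z'" if z: "z \<in> EP_resolvent_set g C \<Theta> r x" "z' \<in> EP_resolvent_set g C \<Theta> r x" for z z'
  proof -
    have zC: "z \<in> C" "z' \<in> C" using z by (auto simp: EP_resolvent_set_def)
    have "\<Theta> z z' + \<Theta> z' z \<le> 0" using equilibrium_bifunctionD(2)[OF \<Theta>] zC by blast
    moreover have "0 \<le> \<Theta> z z' + (1 / r) * blinfun_apply (grad g z - grad g x) (z' - z)"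
      "0 \<le> \<Theta> z' z + (1 / r) * blinfun_apply (grad g z' - grad g x) (z - z')"
      using z zC by (auto simp: EP_resolvent_set_def)
    ultimately have "0 \<le> (1 / r) * (blinfun_apply (grad g z - grad g x) (z' - z) + blinfun_apply (grad g z' - grad g x) (z - z'))"
      unfolding distrib_left by linarith
    hence "0 \<le> blinfun_apply (grad g z - grad g x) (z' - z) + blinfun_apply (grad g z' - grad g x) (z - z')"
      using r by (simp add: zero_le_divide_iff)
    hence "bregman g z z' + bregman g z' z \<le> 0"
      by (simp add: bregman_G blinfun.diff_left blinfun.diff_right)
    moreover have "0 \<le> bregman g z z'" "0 \<le> bregman g z' z"
      using zC C by (auto intro: bregman_nonneg)
    ultimately show ?thesis using sep[OF zC] by simp
  qed
  thus ?thesis unfolding EP_resolvent_def using ne by (metis (no_types, lifting) ex_in_conv theI)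
qed

text \<open>Tested at p, the \<Theta>-term is at most - \<Theta>(p, z) \<le> 0, so the gradient
  pairing is nonnegative; the three-point identity does the rest.\<close>

lemma EP_resolvent_bregman:
  assumes \<Theta>: "equilibrium_bifunction C \<Theta>" and r: "r > 0"
    and z: "z \<in> EP_resolvent_set g C \<Theta> r x" and p: "p \<in> EP C \<Theta>"
  shows "bregman g p z \<le> bregman g p x - bregman g z x"
proof -
  have zC: "z \<in> C" "p \<in> C" using z p by (auto simp: EP_resolvent_set_def EP_def)
  have "\<Theta> z p + \<Theta> p z \<le> 0" "0 \<le> \<Theta> p z"
    using equilibrium_bifunctionD(2)[OF \<Theta>] zC p by (auto simp: EP_def)
  moreover have "0 \<le> \<Theta> z p + (1 / r) * blinfun_apply (grad g z - grad g x) (p - z)"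
    using z zC by (auto simp: EP_resolvent_set_def)
  ultimately have "0 \<le> (1 / r) * blinfun_apply (grad g z - grad g x) (p - z)" by linarith
  hence "0 \<le> blinfun_apply (grad g z - grad g x) (p - z)" using r by (simp add: zero_le_divide_iff)
  thus ?thesis using bregman_three_point[of p x z] by simp
qed

end

text \<open>Reduces variational inequalities and their resolvents to the equilibrium case.
  Monotonicity of A is that of the bifunction, and norm continuity along segments gives the upper
  limit condition.\<close>

lemma VI_bifunction:
  assumes cont: "continuous_on C A" and mono: "monotone_map_on C A" and C: "convex C"
  shows "equilibrium_bifunction C (\<lambda>z y. blinfun_apply (A z) (y - z))"
  unfolding equilibrium_bifunction_def
proof (intro conjI ballI)
  fix x y assume xy: "x \<in> C" "y \<in> C"
  have "0 \<le> blinfun_apply (A x - A y) (x - y)" using mono xy by (auto simp: monotone_map_on_def)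
  thus "blinfun_apply (A x) (y - x) + blinfun_apply (A y) (x - y) \<le> 0"
    by (simp add: blinfun.diff_left blinfun.diff_right)
  fix z assume z: "z \<in> C"
  let ?w = "\<lambda>t. t *\<^sub>R z + (1 - t) *\<^sub>R x"
  have w: "(?w \<longlongrightarrow> 0 *\<^sub>R z + (1 - 0) *\<^sub>R x) (at_right 0)" by (intro tendsto_intros)
  have "?w t \<in> C" if "0 < t" "t < 1" for t
    using that xy z by (intro convexD[OF C]) auto
  hence "\<forall>\<^sub>F t in at_right 0. ?w t \<in> C" by (intro eventually_at_rightI[of 0 1]) auto
  hence "((\<lambda>t. A (?w t)) \<longlongrightarrow> A x) (at_right 0)"
    using w by (intro continuous_on_tendsto_compose[OF cont]) (auto simp: xy)
  hence "((\<lambda>t. blinfun_apply (A (?w t)) (y - ?w t)) \<longlongrightarrow> blinfun_apply (A x) (y - x)) (at_right 0)"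
    using w by (intro blinfun.tendsto tendsto_diff tendsto_const) auto
  hence "((\<lambda>t. ereal (blinfun_apply (A (?w t)) (y - ?w t))) \<longlongrightarrow> ereal (blinfun_apply (A x) (y - x))) (at_right 0)"
    by simp
  hence "Limsup (at_right 0) (\<lambda>t. ereal (blinfun_apply (A (?w t)) (y - ?w t))) = ereal (blinfun_apply (A x) (y - x))"
    by (intro lim_imp_Limsup) auto
  thus "Limsup (at_right 0) (\<lambda>t. ereal (blinfun_apply (A (?w t)) (y - ?w t))) \<le> ereal (blinfun_apply (A x) (y - x))"
    by simp
next
  fix x assume "x \<in> C"
  show "convex_on C (\<lambda>y. blinfun_apply (A x) (y - x))"
  proof (rule convex_onI[OF _ C])
    fix t :: real and u v
    show "blinfun_apply (A x) ((1 - t) *\<^sub>R u + t *\<^sub>R v - x)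
      \<le> (1 - t) * blinfun_apply (A x) (u - x) + t * blinfun_apply (A x) (v - x)"
      unfolding blinfun.diff_right blinfun.add_right blinfun.scaleR_right real_scaleR_def
      by (simp add: algebra_simps)
  qed
  show "lsc_on C (\<lambda>y. ereal (blinfun_apply (A x) (y - x)))"
    unfolding lsc_on_def
  proof
    fix q
    show "ereal (blinfun_apply (A x) (q - x)) \<le> Liminf (at q within C) (\<lambda>y. ereal (blinfun_apply (A x) (y - x)))"
    proof (cases "at q within C = bot")
      case False
      have lim: "((\<lambda>y. ereal (blinfun_apply (A x) (y - x))) \<longlongrightarrow> ereal (blinfun_apply (A x) (q - x))) (at q within C)"
        by (intro tendsto_intros)
      show ?thesis by (simp only: lim_imp_Liminf[OF False lim] order_refl)
    qed simp
  qed
qed simp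

lemma VI_eq_EP: "VI C A = EP C (\<lambda>z y. blinfun_apply (A z) (y - z))"
  by (simp add: VI_def EP_def)

lemma VI_resolvent_set_eq_EP:
  "VI_resolvent_set g C A r x = EP_resolvent_set g C (\<lambda>z y. blinfun_apply (A z) (y - z)) r x"
  by (simp add: VI_resolvent_set_def EP_resolvent_set_def)

lemma VI_resolvent_eq_EP:
  "VI_resolvent g C A r x = EP_resolvent g C (\<lambda>z y. blinfun_apply (A z) (y - z)) r x"
  by (simp add: VI_resolvent_def EP_resolvent_def VI_resolvent_set_eq_EP)

lemma inf_often_subseq:
  assumes "inf_often_index_map \<tau>" "k \<ge> 1"
  obtains \<sigma> :: "nat \<Rightarrow> nat" where "strict_mono \<sigma>" "\<And>n. \<sigma> n \<ge> 1" "\<And>n. \<tau> (\<sigma> n) = k"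
proof -
  have "infinite {n. n \<ge> 1 \<and> \<tau> n = k}" using assms by (simp add: inf_often_index_map_def)
  then obtain \<sigma> :: "nat \<Rightarrow> nat" where "strict_mono \<sigma>" "\<And>n. \<sigma> n \<in> {n. n \<ge> 1 \<and> \<tau> n = k}"
    using infinite_enumerate by metis
  thus thesis by (intro that[of \<sigma>]) auto
qed

text \<open>Monotonicity replaces continuity of \<rho>: \<rho>(a n) < \<rho>(e) already forces a n <
  e.\<close>

lemma tendsto_0_of_mono_on:
  fixes \<rho> :: "real \<Rightarrow> real"
  assumes \<rho>: "mono_on {0..} \<rho>" "\<And>t. t > 0 \<Longrightarrow> \<rho> t > 0"
    and a: "\<And>n. a n \<ge> 0" and lim: "(\<lambda>n. \<rho> (a n)) \<longlonglongrightarrow> 0"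
  shows "a \<longlonglongrightarrow> 0"
proof (rule order_tendstoI)
  fix e :: real assume e: "0 < e"
  have "\<forall>\<^sub>F n in sequentially. \<rho> (a n) < \<rho> e"
    using lim \<rho>(2)[OF e] by (rule order_tendstoD)
  thus "\<forall>\<^sub>F n in sequentially. a n < e"
  proof eventually_elim
    case (elim n)
    show ?case
    proof (rule ccontr)
      assume "\<not> a n < e"
      hence "\<rho> e \<le> \<rho> (a n)" using e by (intro mono_onD[OF \<rho>(1)]) auto
      thus False using elim by simp
    qed
  qed
qed (use a in \<open>auto intro: always_eventually less_le_trans\<close>)

section \<open>Quantitative convexity and passage to limits\<close>

context legendre_fun
begin

text \<open>s1 and s3 are grouped with total weight \<beta> = a1 + a3 and inner weight l = a1 /
  \<beta>. The outer gap term is dropped; the inner one has coefficient \<beta> l (1 - l) = a1 a3 /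
  (a1 + a3). In the scheme s1 and s3 are the gradients at x_n and w_n.\<close>

lemma uniformly_convex_conj_three:
  assumes K: "convex K" "K \<subseteq> Ustar"
    and \<rho>: "\<And>t. t \<ge> 0 \<Longrightarrow> \<rho> t \<ge> (0::real)"
      "\<And>s t l. s \<in> K \<Longrightarrow> t \<in> K \<Longrightarrow> l \<in> {0..1} \<Longrightarrow>
        fenchel_conj g (l *\<^sub>R s + (1 - l) *\<^sub>R t) \<le>
          ereal l * fenchel_conj g s + ereal (1 - l) * fenchel_conj g t - ereal (l * (1 - l) * \<rho> (norm (s - t)))"
    and s: "s1 \<in> K" "s2 \<in> K" "s3 \<in> K"
    and a: "a1 > 0" "a2 > 0" "a3 > 0" "a1 + a2 + a3 = 1"
  shows "H (a1 *\<^sub>R s1 + a2 *\<^sub>R s2 + a3 *\<^sub>R s3)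
    \<le> a1 * H s1 + a2 * H s2 + a3 * H s3 - a1 * a3 / (a1 + a3) * \<rho> (norm (s1 - s3))"
proof -
  have dom: "f \<in> eff_dom (fenchel_conj g)" if "f \<in> K" for f
    using that K(2) interior_subset by blast
  have uconv: "H (l *\<^sub>R s + (1 - l) *\<^sub>R t) \<le> l * H s + (1 - l) * H t - l * (1 - l) * \<rho> (norm (s - t))"
    if "s \<in> K" "t \<in> K" "0 \<le> l" "l \<le> 1" for s t l
  proof -
    have "l *\<^sub>R s + (1 - l) *\<^sub>R t \<in> K" using that by (intro convexD K) auto
    thus ?thesis using \<rho>(2)[of s t l] that conj_H[OF dom] by simp
  qed
  define \<beta> where "\<beta> = a1 + a3"
  define l where "l = a1 / \<beta>"
  have \<beta>: "\<beta> > 0" "\<beta> < 1" "1 - \<beta> = a2" using a by (auto simp: \<beta>_def)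
  have l: "0 \<le> l" "l \<le> 1" "\<beta> * l = a1" "\<beta> * (1 - l) = a3"
    using a \<beta>(1) by (auto simp: l_def \<beta>_def field_simps)
  let ?s = "l *\<^sub>R s1 + (1 - l) *\<^sub>R s3"
  have sK: "?s \<in> K" using s l by (intro convexD K) auto
  have eq: "a1 *\<^sub>R s1 + a2 *\<^sub>R s2 + a3 *\<^sub>R s3 = \<beta> *\<^sub>R ?s + (1 - \<beta>) *\<^sub>R s2"
    by (simp add: scaleR_add_right l \<beta>(3))
  have "H (a1 *\<^sub>R s1 + a2 *\<^sub>R s2 + a3 *\<^sub>R s3)
    \<le> \<beta> * H ?s + (1 - \<beta>) * H s2 - \<beta> * (1 - \<beta>) * \<rho> (norm (?s - s2))"
    unfolding eq using \<beta> by (intro uconv sK s) auto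
  also have "\<dots> \<le> \<beta> * H ?s + a2 * H s2"
    using \<beta> \<rho>(1)[of "norm (?s - s2)"] by simp
  also have "\<dots> \<le> \<beta> * (l * H s1 + (1 - l) * H s3 - l * (1 - l) * \<rho> (norm (s1 - s3))) + a2 * H s2"
    using \<beta> l s by (intro add_right_mono mult_left_mono uconv) auto
  also have "\<dots> = (\<beta> * l) * H s1 + a2 * H s2 + (\<beta> * (1 - l)) * H s3 - (\<beta> * l) * (\<beta> * (1 - l)) / \<beta> * \<rho> (norm (s1 - s3))"
    using \<beta>(1) by (simp add: field_simps)
  finally show ?thesis unfolding l(3,4) by (simp add: \<beta>_def)
qed

text \<open>The Cauchy argument compares x_m and x_n for independent m and n, so the sequential
  hypothesis is recast as a modulus uniform over all pairs; counterexamples for 1 / (n + 1) would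
  violate the sequential form.\<close>

lemma bregman_uniform_separation:
  assumes K: "K \<subseteq> U"
    and sep: "\<And>\<zeta> \<eta>. (\<And>n::nat. \<zeta> n \<in> K) \<Longrightarrow> (\<And>n. \<eta> n \<in> K) \<Longrightarrow>
      (\<lambda>n. bregman g (\<zeta> n) (\<eta> n)) \<longlonglongrightarrow> 0 \<Longrightarrow> (\<lambda>n. norm (\<zeta> n - \<eta> n)) \<longlonglongrightarrow> 0"
    and e: "e > 0"
  obtains d where "d > 0" "\<And>u v. u \<in> K \<Longrightarrow> v \<in> K \<Longrightarrow> bregman g u v < d \<Longrightarrow> norm (u - v) < e"
proof -
  have "\<exists>d>0. \<forall>u\<in>K. \<forall>v\<in>K. bregman g u v < d \<longrightarrow> norm (u - v) < e"
  proof (rule ccontr)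
    assume "\<not> ?thesis"
    hence "\<forall>n. \<exists>u v. u \<in> K \<and> v \<in> K \<and> bregman g u v < inverse (real (Suc n)) \<and> \<not> norm (u - v) < e"
      by (metis inverse_positive_iff_positive of_nat_0_less_iff zero_less_Suc)
    then obtain u v where uv: "\<And>n. u n \<in> K" "\<And>n. v n \<in> K"
        "\<And>n. bregman g (u n) (v n) < inverse (real (Suc n))" "\<And>n. \<not> norm (u n - v n) < e"
      by metis
    have "(\<lambda>n. bregman g (u n) (v n)) \<longlonglongrightarrow> 0"
    proof (rule tendsto_sandwich[OF _ _ tendsto_const LIMSEQ_inverse_real_of_nat])
      show "\<forall>\<^sub>F n in sequentially. 0 \<le> bregman g (u n) (v n)"
        using uv K by (intro always_eventually allI bregman_nonneg) auto
    qed (use uv(3) in \<open>auto intro!: always_eventually intro: less_imp_le\<close>)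
    hence "(\<lambda>n. norm (u n - v n)) \<longlonglongrightarrow> 0" by (rule sep[OF uv(1,2)])
    hence "\<forall>\<^sub>F n in sequentially. norm (u n - v n) < e" using e by (rule order_tendstoD)
    thus False using uv(4) by simp
  qed
  thus thesis using that by blast
qed

lemma continuous_on_bregman:
  assumes B: "B \<subseteq> U" "continuous_on B g" "continuous_on B (grad g)"
  shows "continuous_on B (\<lambda>y. bregman g p y)" "continuous_on B (\<lambda>p. bregman g p y)"
proof -
  have G: "continuous_on B G"
    unfolding continuous_on_def
  proof
    fix x assume x: "x \<in> B"
    have gx: "g x = ereal (G x)" using x B(1) by (intro g_G U_dom) auto
    have "(g \<longlongrightarrow> g x) (at x within B)" using B(2) x by (simp add: continuous_on_def)
    hence "(g \<longlongrightarrow> ereal (G x)) (at x within B)" unfolding gx .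
    thus "(G \<longlongrightarrow> G x) (at x within B)" unfolding G_def by (rule lim_real_of_ereal)
  qed
  show "continuous_on B (\<lambda>y. bregman g p y)"
    unfolding bregman_G
    by (intro continuous_on_diff continuous_on_const G B(3) continuous_on_id
        bounded_bilinear.continuous_on[OF bounded_bilinear_blinfun_apply])
  show "continuous_on B (\<lambda>p. bregman g p y)"
    unfolding bregman_G
    by (intro continuous_on_diff continuous_on_const G continuous_on_id
        bounded_bilinear.continuous_on[OF bounded_bilinear_blinfun_apply])
qed

text \<open>The resolvent term is the error sequence of \<open>equilibrium_limit_in_EP\<close>: both
  gradients tend to that at q, and 1 / r n \<le> 1 / r0 keeps the factor bounded.\<close>

lemma EP_resolvent_limit:
  assumes \<Theta>: "equilibrium_bifunction C \<Theta>" and C: "convex C"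
    and cont: "continuous_on C (grad g)" and r0: "r0 > 0" "\<And>n. r n \<ge> r0"
    and z: "\<And>n. z n \<in> EP_resolvent_set g C \<Theta> (r n) (x n)"
    and x: "\<And>n. x n \<in> C" "x \<longlonglongrightarrow> q" and zq: "z \<longlonglongrightarrow> q" and q: "q \<in> C"
  shows "q \<in> EP C \<Theta>"
proof (rule equilibrium_limit_in_EP[OF \<Theta> C])
  show zC: "z n \<in> C" for n using z by (auto simp: EP_resolvent_set_def)
  show "z \<longlonglongrightarrow> q" "q \<in> C" by fact+
  fix y assume y: "y \<in> C"
  let ?p = "\<lambda>n. blinfun_apply (grad g (z n) - grad g (x n)) (y - z n)"
  show "0 \<le> \<Theta> (z n) y + (1 / r n) * ?p n" for n
    using z y by (auto simp: EP_resolvent_set_def)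
  have "(\<lambda>n. grad g (z n)) \<longlonglongrightarrow> grad g q" "(\<lambda>n. grad g (x n)) \<longlonglongrightarrow> grad g q"
    using zC x q zq by (auto intro!: continuous_on_tendsto_compose[OF cont])
  hence "?p \<longlonglongrightarrow> blinfun_apply (grad g q - grad g q) (y - q)"
    using zq by (intro blinfun.tendsto tendsto_diff tendsto_const)
  hence p: "?p \<longlonglongrightarrow> 0" by simp
  have lim: "(\<lambda>n. (1 / r0) * \<bar>?p n\<bar>) \<longlonglongrightarrow> 0"
    using tendsto_mult_left[OF tendsto_rabs_zero[OF p], of "1 / r0"] by simp
  show "(\<lambda>n. (1 / r n) * ?p n) \<longlonglongrightarrow> 0"
  proof (rule Lim_null_comparison[OF _ lim], intro always_eventually allI)
    fix n
    have "r n > 0" "1 / r n \<le> 1 / r0" using r0(1) r0(2)[of n] by (auto intro: frac_le)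
    thus "norm ((1 / r n) * ?p n) \<le> (1 / r0) * \<bar>?p n\<bar>"
      unfolding real_norm_def abs_mult by (intro mult_right_mono) auto
  qed
qed

end

section \<open>Convergence of the hybrid projection scheme\<close>

lemma Jstar_closedD:
  assumes "Jstar_closed C T" "\<And>n. X n \<in> C" "x \<in> C" "X \<longlonglongrightarrow> x"
    "(\<lambda>n. duality_map_inv (T (X n))) \<longlonglongrightarrow> y"
  shows "y = duality_map_inv (T x)"
  by (rule assms(1)[unfolded Jstar_closed_def, THEN conjunct2, rule_format, of X x y])
    (rule assms(2-))+

theorem corollary3p3:
  fixes g :: "'a::banach \<Rightarrow> ereal"
    and C U S K0 K1 :: "'a set"
    and Ustar Kstar :: "('a \<Rightarrow>\<^sub>L real) set"
    and \<Theta> :: "nat \<Rightarrow> 'a \<Rightarrow> 'a \<Rightarrow> real"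
    and A T :: "nat \<Rightarrow> 'a \<Rightarrow> ('a \<Rightarrow>\<^sub>L real)"
    and \<alpha>1 \<alpha>2 \<alpha>3 r0 :: real
    and r :: "nat \<Rightarrow> real"
    and \<tau>T \<tau>A \<tau>\<Theta> :: "nat \<Rightarrow> nat"
    and x :: 'a
    and xs zs us ys :: "nat \<Rightarrow> 'a"
    and Cs :: "nat \<Rightarrow> 'a set"
  assumes "uniformly_smooth_space TYPE('a)"
    and "uniformly_convex_space TYPE('a)"
    and "legendre g"
    and "U = interior (eff_dom g)"
    and "Ustar = interior (eff_dom (fenchel_conj g))"
    and "C \<subseteq> U" "C \<noteq> {}" "closed C" "convex C" "bounded C"
    and "\<forall>l\<ge>1. equilibrium_bifunction C (\<Theta> l)"
    and "\<forall>k\<ge>1. continuous_on C (A k) \<and> monotone_map_on C (A k)"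
    and "\<forall>j\<ge>1. Jstar_closed C (T j) \<and> gen_bregman_Jstar_nonexpansive g C (T j)"
    and "\<forall>l\<ge>1. \<forall>v\<in>C. \<forall>s>0. EP_resolvent_set g C (\<Theta> l) s v \<noteq> {}"
    and "\<forall>k\<ge>1. \<forall>v\<in>C. \<forall>s>0. VI_resolvent_set g C (A k) s v \<noteq> {}"
    and "S = (\<Inter>j\<in>{1..}. FJ C (T j)) \<inter> (\<Inter>l\<in>{1..}. EP C (\<Theta> l)) \<inter> (\<Inter>k\<in>{1..}. VI C (A k))"
    and "S \<noteq> {}"
    and "\<alpha>1 \<in> {0<..<1}" "\<alpha>2 \<in> {0<..<1}" "\<alpha>3 \<in> {0<..<1}" "\<alpha>1 + \<alpha>2 + \<alpha>3 = 1"
    and "r0 > 0" "\<forall>n\<ge>1. r n \<ge> r0"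
    and "inf_often_index_map \<tau>T" "inf_often_index_map \<tau>A" "inf_often_index_map \<tau>\<Theta>"
    and "bounded K0" "K0 \<subseteq> U" "bounded K1" "K1 \<subseteq> U"
    and "bounded Kstar" "convex Kstar" "Kstar \<subseteq> Ustar"
    and "C \<subseteq> K0"
    and "grad g ` K0 \<subseteq> Kstar"
    and "\<forall>v1\<in>K0. \<forall>v2\<in>K0. \<forall>v3\<in>K0. bregman_mean g \<alpha>1 \<alpha>2 \<alpha>3 v1 v2 v3 \<in> K1"
    and "\<exists>B. bounded B \<and> B \<subseteq> U \<and> K0 \<union> K1 \<subseteq> B \<and> continuous_on B g \<and> continuous_on B (grad g)"
    and "uniformly_continuous_on K0 (grad g)"
    and "\<forall>\<zeta> \<eta> :: nat \<Rightarrow> 'a. (\<forall>n. \<zeta> n \<in> K0 \<union> K1) \<longrightarrow> (\<forall>n. \<eta> n \<in> K0 \<union> K1) \<longrightarrow>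
           (\<lambda>n. bregman g (\<zeta> n) (\<eta> n)) \<longlonglongrightarrow> 0 \<longrightarrow> (\<lambda>n. norm (\<zeta> n - \<eta> n)) \<longlonglongrightarrow> 0"
    and "uniformly_convex_fun_on Kstar (fenchel_conj g)"
    and "bounded (grad_conj g ` Kstar)"
    and "uniformly_continuous_on Kstar (grad_conj g)"
    and "x \<in> C" "xs 1 = x" "Cs 1 = C"
    and "\<forall>n\<ge>1. zs n = EP_resolvent g C (\<Theta> (\<tau>\<Theta> n)) (r n) (xs n)"
    and "\<forall>n\<ge>1. us n = VI_resolvent g C (A (\<tau>A n)) (r n) (xs n)"
    and "\<forall>n\<ge>1. ys n = bregman_mean g \<alpha>1 \<alpha>2 \<alpha>3 (xs n) (zs n) (duality_map_inv (T (\<tau>T n) (us n)))"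
    and "\<forall>n\<ge>1. Cs (n + 1) = {z \<in> Cs n. bregman g z (ys n) \<le> bregman g z (xs n)}"
    and "\<forall>n\<ge>1. xs (n + 1) = bregman_proj g (Cs (n + 1)) x"
  shows "xs \<longlonglongrightarrow> bregman_proj g S x"
proof -
  interpret legendre_fun g by unfold_locales fact+
  note U = \<open>U = interior (eff_dom g)\<close> and Ustar = \<open>Ustar = interior (eff_dom (fenchel_conj g))\<close>
  note J = duality_map_inverse[OF \<open>uniformly_smooth_space TYPE('a)\<close> \<open>uniformly_convex_space TYPE('a)\<close>]
  let ?K = "K0 \<union> K1"
  have KU: "?K \<subseteq> U" and CK: "C \<subseteq> K0" and CU: "C \<subseteq> U"
    using \<open>K0 \<subseteq> U\<close> \<open>K1 \<subseteq> U\<close> \<open>C \<subseteq> K0\<close> by auto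
  obtain B where B: "B \<subseteq> U" "?K \<subseteq> B" "continuous_on B g" "continuous_on B (grad g)"
    using \<open>\<exists>B. bounded B \<and> B \<subseteq> U \<and> ?K \<subseteq> B \<and> continuous_on B g \<and> continuous_on B (grad g)\<close> by blast
  have CB: "C \<subseteq> B" using CK B(2) by blast
  note contB = continuous_on_bregman[OF B(1)[unfolded U] B(3,4)]
  have seq: "(\<lambda>n. norm (\<zeta> n - \<eta> n)) \<longlonglongrightarrow> 0"
    if "\<And>n::nat. \<zeta> n \<in> ?K" "\<And>n. \<eta> n \<in> ?K" "(\<lambda>n. bregman g (\<zeta> n) (\<eta> n)) \<longlonglongrightarrow> 0" for \<zeta> \<eta>
    using that \<open>\<forall>\<zeta> \<eta> :: nat \<Rightarrow> 'a. (\<forall>n. \<zeta> n \<in> ?K) \<longrightarrow> (\<forall>n. \<eta> n \<in> ?K) \<longrightarrow>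
      (\<lambda>n. bregman g (\<zeta> n) (\<eta> n)) \<longlonglongrightarrow> 0 \<longrightarrow> (\<lambda>n. norm (\<zeta> n - \<eta> n)) \<longlonglongrightarrow> 0\<close> by blast
  \<comment> \<open>The separation hypothesis applied to two constant sequences.\<close>
  have sep: "u = v" if "u \<in> ?K" "v \<in> ?K" "bregman g u v = 0" for u v
    using seq[of "\<lambda>_. u" "\<lambda>_. v"] that by (simp add: LIMSEQ_const_iff)
  have sepC: "u = v" if "u \<in> C" "v \<in> C" "bregman g u v = 0" for u v
    using sep that CK by blast
  have nonneg: "0 \<le> bregman g u v" if "u \<in> ?K" "v \<in> ?K" for u v
    using that KU U by (intro bregman_nonneg) auto
  have init [simp]: "xs (Suc 0) = x" "Cs (Suc 0) = C"
    using \<open>xs 1 = x\<close> \<open>Cs 1 = C\<close> by simp_all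
  obtain \<rho> :: "real \<Rightarrow> real" where \<rho>: "mono_on {0..} \<rho>" "\<rho> 0 = 0" "\<And>t. t > 0 \<Longrightarrow> \<rho> t > 0"
    and \<rho>_conv: "\<And>s t l. s \<in> Kstar \<Longrightarrow> t \<in> Kstar \<Longrightarrow> l \<in> {0..1} \<Longrightarrow>
      fenchel_conj g (l *\<^sub>R s + (1 - l) *\<^sub>R t) \<le>
        ereal l * fenchel_conj g s + ereal (1 - l) * fenchel_conj g t - ereal (l * (1 - l) * \<rho> (norm (s - t)))"
    using \<open>uniformly_convex_fun_on Kstar (fenchel_conj g)\<close> unfolding uniformly_convex_fun_on_def by blast
  have \<rho>_nonneg: "\<rho> t \<ge> 0" if "t \<ge> 0" for t
    using \<rho>(2) \<rho>(3)[of t] that by (cases "t = 0") auto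
  define A' where "A' k z y = blinfun_apply (A k z) (y - z)" for k z y
  have \<Theta>: "equilibrium_bifunction C (\<Theta> l)" if "l \<ge> 1" for l
    using \<open>\<forall>l\<ge>1. equilibrium_bifunction C (\<Theta> l)\<close> that by blast
  have A': "equilibrium_bifunction C (A' k)" if "k \<ge> 1" for k
    unfolding A'_def using \<open>\<forall>k\<ge>1. continuous_on C (A k) \<and> monotone_map_on C (A k)\<close> that \<open>convex C\<close>
    by (intro VI_bifunction) auto
  define c where "c = \<alpha>1 * \<alpha>3 / (\<alpha>1 + \<alpha>3)"
  have c: "c > 0" using \<open>\<alpha>1 \<in> {0<..<1}\<close> \<open>\<alpha>3 \<in> {0<..<1}\<close> by (simp add: c_def)
  define ws where "ws n = duality_map_inv (T (\<tau>T n) (us n))" for n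
  have idx: "\<tau>T n \<ge> 1" "\<tau>A n \<ge> 1" "\<tau>\<Theta> n \<ge> 1" if "n \<ge> 1" for n
    using \<open>inf_often_index_map \<tau>T\<close> \<open>inf_often_index_map \<tau>A\<close> \<open>inf_often_index_map \<tau>\<Theta>\<close> that
    by (auto simp: inf_often_index_map_def)
  have rpos: "r n > 0" if "n \<ge> 1" for n
    using \<open>r0 > 0\<close> \<open>\<forall>n\<ge>1. r n \<ge> r0\<close> that by (meson less_le_trans)
  have EP_ne: "EP_resolvent_set g C (\<Theta> l) s v \<noteq> {}" if "l \<ge> 1" "v \<in> C" "s > 0" for l s v
    using \<open>\<forall>l\<ge>1. \<forall>v\<in>C. \<forall>s>0. EP_resolvent_set g C (\<Theta> l) s v \<noteq> {}\<close> that by simp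
  have VI_ne: "EP_resolvent_set g C (A' k) s v \<noteq> {}" if "k \<ge> 1" "v \<in> C" "s > 0" for k s v
    using \<open>\<forall>k\<ge>1. \<forall>v\<in>C. \<forall>s>0. VI_resolvent_set g C (A k) s v \<noteq> {}\<close> that
    by (simp add: VI_resolvent_set_eq_EP A'_def[abs_def])
  have Tsub: "duality_map_inv (T j v) \<in> C" if "j \<ge> 1" "v \<in> C" for j v
    using \<open>\<forall>j\<ge>1. Jstar_closed C (T j) \<and> gen_bregman_Jstar_nonexpansive g C (T j)\<close> that
    unfolding Jstar_closed_def Jstar_self_map_def by blast
  have S: "p \<in> C" "\<And>j. j \<ge> 1 \<Longrightarrow> p \<in> FJ C (T j)" "\<And>l. l \<ge> 1 \<Longrightarrow> p \<in> EP C (\<Theta> l)"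
    "\<And>k. k \<ge> 1 \<Longrightarrow> p \<in> EP C (A' k)" if "p \<in> S" for p
  proof -
    show "\<And>j. j \<ge> 1 \<Longrightarrow> p \<in> FJ C (T j)" "\<And>l. l \<ge> 1 \<Longrightarrow> p \<in> EP C (\<Theta> l)"
      "\<And>k. k \<ge> 1 \<Longrightarrow> p \<in> EP C (A' k)"
      using that \<open>S = _\<close> by (auto simp: VI_eq_EP A'_def[abs_def])
    from this(2)[of 1] show "p \<in> C" by (simp add: EP_def)
  qed
  have gradK: "grad g v \<in> Kstar" if "v \<in> K0" for v
    using \<open>grad g ` K0 \<subseteq> Kstar\<close> that by blast
  have zs: "zs n \<in> EP_resolvent_set g C (\<Theta> (\<tau>\<Theta> n)) (r n) (xs n)" and zsC: "zs n \<in> C"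
    and us: "us n \<in> EP_resolvent_set g C (A' (\<tau>A n)) (r n) (xs n)" and usC: "us n \<in> C"
    and wsC: "ws n \<in> C" and ysK: "ys n \<in> K1"
    and key: "\<And>p. p \<in> S \<Longrightarrow> bregman g p (ys n) \<le> bregman g p (xs n) - \<alpha>2 * bregman g (zs n) (xs n)
        - \<alpha>3 * bregman g (us n) (xs n) - c * \<rho> (norm (grad g (xs n) - grad g (ws n)))"
    if n: "n \<ge> 1" and xC: "xs n \<in> C" for n
  proof -
    have "EP_resolvent g C (\<Theta> (\<tau>\<Theta> n)) (r n) (xs n) \<in> EP_resolvent_set g C (\<Theta> (\<tau>\<Theta> n)) (r n) (xs n)"
      by (rule EP_resolvent_singleton[OF \<Theta>[OF idx(3)[OF n]] CU[unfolded U] rpos[OF n]])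
        (erule (2) sepC, rule EP_ne[OF idx(3)[OF n] xC rpos[OF n]])
    thus z: "zs n \<in> EP_resolvent_set g C (\<Theta> (\<tau>\<Theta> n)) (r n) (xs n)"
      using \<open>\<forall>n\<ge>1. zs n = _ n\<close> n by simp
    thus zC: "zs n \<in> C" by (simp add: EP_resolvent_set_def)
    have "EP_resolvent g C (A' (\<tau>A n)) (r n) (xs n) \<in> EP_resolvent_set g C (A' (\<tau>A n)) (r n) (xs n)"
      by (rule EP_resolvent_singleton[OF A'[OF idx(2)[OF n]] CU[unfolded U] rpos[OF n]])
        (erule (2) sepC, rule VI_ne[OF idx(2)[OF n] xC rpos[OF n]])
    thus u: "us n \<in> EP_resolvent_set g C (A' (\<tau>A n)) (r n) (xs n)"
      using \<open>\<forall>n\<ge>1. us n = _ n\<close> n by (simp add: VI_resolvent_eq_EP A'_def[abs_def])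
    thus uC: "us n \<in> C" by (simp add: EP_resolvent_set_def)
    show wC: "ws n \<in> C" unfolding ws_def using Tsub idx(1)[OF n] uC by blast
    have y: "ys n = bregman_mean g \<alpha>1 \<alpha>2 \<alpha>3 (xs n) (zs n) (ws n)"
      using \<open>\<forall>n\<ge>1. ys n = _ n\<close> n by (simp add: ws_def)
    have K0: "xs n \<in> K0" "zs n \<in> K0" "ws n \<in> K0" using xC zC wC CK by auto
    show yK: "ys n \<in> K1"
      unfolding y using \<open>\<forall>v1\<in>K0. \<forall>v2\<in>K0. \<forall>v3\<in>K0. bregman_mean g \<alpha>1 \<alpha>2 \<alpha>3 v1 v2 v3 \<in> K1\<close> K0 by blast
    let ?s = "\<alpha>1 *\<^sub>R grad g (xs n) + \<alpha>2 *\<^sub>R grad g (zs n) + \<alpha>3 *\<^sub>R grad g (ws n)"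
    note \<alpha> = \<open>\<alpha>1 \<in> {0<..<1}\<close> \<open>\<alpha>2 \<in> {0<..<1}\<close> \<open>\<alpha>3 \<in> {0<..<1}\<close> \<open>\<alpha>1 + \<alpha>2 + \<alpha>3 = 1\<close>
    have "?s \<in> Kstar"
    proof -
      \<comment> \<open>Convexity combines two points at a time, so the gradients at x_n and z_n are
        averaged first.\<close>
      let ?l = "\<alpha>1 / (\<alpha>1 + \<alpha>2)"
      have l: "(\<alpha>1 + \<alpha>2) * ?l = \<alpha>1" "(\<alpha>1 + \<alpha>2) * (\<alpha>2 / (\<alpha>1 + \<alpha>2)) = \<alpha>2" "0 \<le> ?l"
        "0 \<le> \<alpha>2 / (\<alpha>1 + \<alpha>2)" "?l + \<alpha>2 / (\<alpha>1 + \<alpha>2) = 1"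
        using \<alpha> by (auto simp flip: add_divide_distrib)
      have "?l *\<^sub>R grad g (xs n) + (\<alpha>2 / (\<alpha>1 + \<alpha>2)) *\<^sub>R grad g (zs n) \<in> Kstar"
        using l gradK K0 by (intro convexD[OF \<open>convex Kstar\<close>]) auto
      hence "(\<alpha>1 + \<alpha>2) *\<^sub>R (?l *\<^sub>R grad g (xs n) + (\<alpha>2 / (\<alpha>1 + \<alpha>2)) *\<^sub>R grad g (zs n)) + \<alpha>3 *\<^sub>R grad g (ws n) \<in> Kstar"
        using \<alpha> gradK K0 l(5) by (intro convexD[OF \<open>convex Kstar\<close>]) auto
      thus ?thesis unfolding scaleR_add_right scaleR_scaleR l(1,2) .
    qed
    moreover have "ys n = grad_conj g ?s" by (simp add: y bregman_mean_def)
    \<comment> \<open>The iterate y_n is defined through the gradient of the conjugate; only now is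
      its own gradient known to be the weighted mean.\<close>
    ultimately have gy: "grad g (ys n) = ?s"
      using grad_grad_conj[of ?s] yK \<open>K1 \<subseteq> U\<close> \<open>Kstar \<subseteq> Ustar\<close> U Ustar by auto
    fix p assume p: "p \<in> S"
    have three: "H ?s \<le> \<alpha>1 * H (grad g (xs n)) + \<alpha>2 * H (grad g (zs n)) + \<alpha>3 * H (grad g (ws n))
        - c * \<rho> (norm (grad g (xs n) - grad g (ws n)))"
      unfolding c_def
      by (rule uniformly_convex_conj_three[OF \<open>convex Kstar\<close> _ \<rho>_nonneg \<rho>_conv])
        (use \<alpha> gradK K0 \<open>Kstar \<subseteq> Ustar\<close> Ustar in auto)
    have vU: "xs n \<in> interior (eff_dom g)" "zs n \<in> interior (eff_dom g)" "ws n \<in> interior (eff_dom g)"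
      "ys n \<in> interior (eff_dom g)"
      using K0 yK \<open>K0 \<subseteq> U\<close> \<open>K1 \<subseteq> U\<close> U by auto
    have "bregman g p (ys n) = G p + H ?s - blinfun_apply ?s p"
      using bregman_conj[OF vU(4), of p] gy by simp
    also have "\<dots> = \<alpha>1 * (G p - blinfun_apply (grad g (xs n)) p) + \<alpha>2 * (G p - blinfun_apply (grad g (zs n)) p)
        + \<alpha>3 * (G p - blinfun_apply (grad g (ws n)) p) + H ?s"
    proof -
      have "G p = \<alpha>1 * G p + \<alpha>2 * G p + \<alpha>3 * G p"
        using \<alpha>(4) by (metis distrib_right mult_1)
      thus ?thesis by (simp add: blinfun.add_left blinfun.scaleR_left algebra_simps)
    qed
    also have "\<dots> \<le> \<alpha>1 * bregman g p (xs n) + \<alpha>2 * bregman g p (zs n) + \<alpha>3 * bregman g p (ws n)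
        - c * \<rho> (norm (grad g (xs n) - grad g (ws n)))"
      using three unfolding bregman_conj[OF vU(1)] bregman_conj[OF vU(2)] bregman_conj[OF vU(3)]
      by (simp add: algebra_simps)
    also have "\<dots> \<le> \<alpha>1 * bregman g p (xs n) + \<alpha>2 * (bregman g p (xs n) - bregman g (zs n) (xs n))
        + \<alpha>3 * (bregman g p (xs n) - bregman g (us n) (xs n)) - c * \<rho> (norm (grad g (xs n) - grad g (ws n)))"
    proof -
      \<comment> \<open>Both resolvents gain a Bregman distance. As D(p, w_n) \<le> D(p, u_n), the
        third term of the mean inherits the gain of u_n.\<close>
      have "bregman g p (zs n) \<le> bregman g p (xs n) - bregman g (zs n) (xs n)"
        by (rule EP_resolvent_bregman[OF \<Theta>[OF idx(3)[OF n]] rpos[OF n] z S(3)[OF p idx(3)[OF n]]])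
      moreover have "bregman g p (us n) \<le> bregman g p (xs n) - bregman g (us n) (xs n)"
        by (rule EP_resolvent_bregman[OF A'[OF idx(2)[OF n]] rpos[OF n] u S(4)[OF p idx(2)[OF n]]])
      moreover have "bregman g p (ws n) \<le> bregman g p (us n)"
        using \<open>\<forall>j\<ge>1. Jstar_closed C (T j) \<and> gen_bregman_Jstar_nonexpansive g C (T j)\<close>
          idx(1)[OF n] S(2)[OF p idx(1)[OF n]] uC
        unfolding ws_def gen_bregman_Jstar_nonexpansive_def by blast
      ultimately show ?thesis
        using \<alpha> by (intro diff_right_mono add_mono mult_left_mono) auto
    qed
    also have "\<dots> = (\<alpha>1 + \<alpha>2 + \<alpha>3) * bregman g p (xs n) - \<alpha>2 * bregman g (zs n) (xs n)
        - \<alpha>3 * bregman g (us n) (xs n) - c * \<rho> (norm (grad g (xs n) - grad g (ws n)))"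
      by (simp add: algebra_simps)
    finally show "bregman g p (ys n) \<le> bregman g p (xs n) - \<alpha>2 * bregman g (zs n) (xs n)
        - \<alpha>3 * bregman g (us n) (xs n) - c * \<rho> (norm (grad g (xs n) - grad g (ws n)))"
      unfolding \<alpha>(4) by simp
  qed
  have Cs_Suc: "Cs (Suc n) = Cs n \<inter> {z. bregman g z (ys n) \<le> bregman g z (xs n)}" if "n \<ge> 1" for n
    using \<open>\<forall>n\<ge>1. Cs (n + 1) = _ n\<close> that by auto
  \<comment> \<open>One simultaneous induction is required: \<open>key\<close> presupposes that x_n
    lies in C, it yields that S lies in C_(n+1), and only this nonempty set lets x_(n+1) be a
    genuine projection.\<close>
  have inv: "closed (Cs n) \<and> convex (Cs n) \<and> Cs n \<subseteq> C \<and> S \<subseteq> Cs n \<and> xs n \<in> Cs n \<and>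
      (\<forall>w\<in>Cs n. bregman g (xs n) x \<le> bregman g w x)" if "n \<ge> 1" for n
    using that
  proof (induction n rule: dec_induct)
    case base
    have "bregman g x x \<le> bregman g w x" if "w \<in> C" for w
      using nonneg[of w x] that \<open>x \<in> C\<close> CK by (auto simp: bregman_refl)
    thus ?case using \<open>closed C\<close> \<open>convex C\<close> \<open>x \<in> C\<close> S(1) by auto
  next
    case (step n)
    have n: "n \<ge> 1" and xC: "xs n \<in> C" using step by auto
    have cl: "closed (Cs (Suc n))" "convex (Cs (Suc n))" "Cs (Suc n) \<subseteq> C"
      unfolding Cs_Suc[OF n] using step closed_convex_bregman_halfspace
      by (auto intro: closed_Int convex_Int)
    have Ssub: "S \<subseteq> Cs (Suc n)"
    proof
      fix p assume p: "p \<in> S"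
      have "0 \<le> \<alpha>2 * bregman g (zs n) (xs n)" "0 \<le> \<alpha>3 * bregman g (us n) (xs n)"
        using nonneg zsC[OF n xC] usC[OF n xC] xC CK \<open>\<alpha>2 \<in> {0<..<1}\<close> \<open>\<alpha>3 \<in> {0<..<1}\<close>
        by (auto intro!: mult_nonneg_nonneg)
      moreover have "0 \<le> c * \<rho> (norm (grad g (xs n) - grad g (ws n)))"
        using c \<rho>_nonneg by simp
      ultimately have "bregman g p (ys n) \<le> bregman g p (xs n)"
        using key[OF n xC p] by linarith
      thus "p \<in> Cs (Suc n)" using p step by (auto simp: Cs_Suc[OF n])
    qed
    have "Cs (Suc n) \<noteq> {}" using Ssub \<open>S \<noteq> {}\<close> by blast
    moreover have "bounded (Cs (Suc n))" using cl(3) \<open>bounded C\<close> bounded_subset by blast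
    moreover have "xs (Suc n) = bregman_proj g (Cs (Suc n)) x"
      using \<open>\<forall>n\<ge>1. xs (n + 1) = _ n\<close> n by simp
    ultimately have "xs (Suc n) \<in> Cs (Suc n)"
      "\<And>w. w \<in> Cs (Suc n) \<Longrightarrow> bregman g (xs (Suc n)) x \<le> bregman g w x"
      using bregman_proj_minimizer[OF cl(1,2), of x] cl(3) CU U \<open>x \<in> C\<close> sepC by (auto simp: subset_iff)
    with cl Ssub show ?case by blast
  qed
  have mono: "Cs n \<subseteq> Cs m" if "1 \<le> m" "m \<le> n" for m n
    using that(2)
  proof (induction n rule: dec_induct)
    case (step n)
    thus ?case using Cs_Suc[of n] that(1) by auto
  qed simp
  \<comment> \<open>Shift to sequences starting at 0, since the values of the scheme at index 0 are
    unspecified.\<close>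
  define X where "X n = xs (Suc n)" for n
  define D where "D n = Cs (Suc n)" for n
  have D: "closed (D n)" "convex (D n)" "D n \<subseteq> C" "S \<subseteq> D n" "X n \<in> D n"
    and min: "\<And>w. w \<in> D n \<Longrightarrow> bregman g (X n) x \<le> bregman g w x" for n
    using inv[of "Suc n"] by (auto simp: X_def D_def)
  have Dmono: "D n \<subseteq> D m" if "m \<le> n" for m n using mono that by (simp add: D_def)
  have XC: "X n \<in> C" for n using D by blast
  have proj: "bregman g w (X n) + bregman g (X n) x \<le> bregman g w x" if "w \<in> D n" for w n
    using bregman_minimizer[OF D(2) _ D(5) min that] D(3)[of n] CU U by blast
  define d where "d n = bregman g (X n) x" for n
  have d_mono: "d m \<le> d n" if "m \<le> n" for m n
    unfolding d_def using Dmono[OF that] D(5)[of n] by (intro min) blast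
  obtain p0 where p0: "p0 \<in> S" using \<open>S \<noteq> {}\<close> by blast
  have "0 \<le> d n" "d n \<le> bregman g p0 x" for n
    using nonneg[of "X n" x] XC[of n] \<open>x \<in> C\<close> CK min[of p0 n] D(4)[of n] p0 by (auto simp: d_def)
  hence "Bseq d" by (intro BseqI'[of _ "bregman g p0 x"]) simp
  moreover have "monoseq d" using d_mono by (intro monoI1) auto
  ultimately have "Cauchy d" by (intro convergent_Cauchy Bseq_monoseq_convergent)
  have "Cauchy X"
  proof (rule metric_CauchyI)
    fix e :: real assume e: "e > 0"
    obtain \<delta> where \<delta>: "\<delta> > 0"
      "\<And>u v. u \<in> ?K \<Longrightarrow> v \<in> ?K \<Longrightarrow> bregman g u v < \<delta> \<Longrightarrow> norm (u - v) < e"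
    proof (rule bregman_uniform_separation[of ?K e])
      show "?K \<subseteq> interior (eff_dom g)" using KU U by simp
    qed (use seq e in blast)+
    obtain N where N: "\<And>m n. m \<ge> N \<Longrightarrow> n \<ge> N \<Longrightarrow> dist (d m) (d n) < \<delta>"
      using metric_CauchyD[OF \<open>Cauchy d\<close> \<delta>(1)] by blast
    have *: "dist (X m) (X n) < e" if "n \<ge> N" "m \<ge> n" for m n
    proof -
      have "bregman g (X m) (X n) \<le> d m - d n"
        using proj[of "X m" n] D(5)[of m] Dmono[OF that(2)] by (auto simp: d_def)
      also have "\<dots> < \<delta>" using N[of m n] that by (simp add: dist_real_def)
      finally show ?thesis
        unfolding dist_norm using XC CK by (intro \<delta>(2)) auto
    qed
    show "\<exists>M. \<forall>m\<ge>M. \<forall>n\<ge>M. dist (X m) (X n) < e"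
      using * by (metis dist_commute linear)
  qed
  then obtain q where q: "X \<longlonglongrightarrow> q" using Cauchy_convergent_iff convergent_def by blast
  have qD: "q \<in> D n" for n
  proof (rule Lim_in_closed_set[OF D(1) _ _ q])
    show "\<forall>\<^sub>F m in sequentially. X m \<in> D n"
      using eventually_ge_at_top[of n] by eventually_elim (use D(5) Dmono in blast)
  qed simp
  have qC: "q \<in> C" using qD D(3) by blast
  define Y where "Y n = ys (Suc n)" for n
  define Z where "Z n = zs (Suc n)" for n
  define V where "V n = us (Suc n)" for n
  define W where "W n = ws (Suc n)" for n
  have YK: "Y n \<in> K1" and ZC: "Z n \<in> C" and VC: "V n \<in> C" and WC: "W n \<in> C" for n
    using ysK[of "Suc n"] zsC[of "Suc n"] usC[of "Suc n"] wsC[of "Suc n"] XC[of n]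
    by (auto simp: X_def Y_def Z_def V_def W_def)
  have to_q: "R \<longlonglongrightarrow> q" if "\<And>n. R n \<in> ?K" "(\<lambda>n. bregman g (R n) (X n)) \<longlonglongrightarrow> 0" for R
  proof -
    have "(\<lambda>n. norm (R n - X n)) \<longlonglongrightarrow> 0" using that XC CK by (intro seq) auto
    thus ?thesis using q by (metis tendsto_norm_zero_cancel Lim_transform)
  qed
  have Y: "Y \<longlonglongrightarrow> q"
  proof -
    have "(\<lambda>n. bregman g (X (Suc n)) (Y n)) \<longlonglongrightarrow> 0"
    proof (rule tendsto_sandwich[OF _ _ tendsto_const])
      have qX: "(\<lambda>n. X (Suc n)) \<longlonglongrightarrow> q" using q by (rule LIMSEQ_Suc)
      show "\<forall>\<^sub>F n in sequentially. 0 \<le> bregman g (X (Suc n)) (Y n)"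
        using XC YK CK by (intro always_eventually allI nonneg) auto
      have "bregman g (X (Suc n)) (Y n) \<le> d (Suc n) - d n" for n
      proof -
        \<comment> \<open>Here \<open>D (Suc n)\<close> is \<open>Cs (n + 2)\<close>, whose defining
          half-space compares \<open>ys (n + 1)\<close> with \<open>xs (n + 1)\<close>, that is, Y n
          with X n.\<close>
        have "X (Suc n) \<in> D (Suc n)" by (rule D)
        hence "bregman g (X (Suc n)) (Y n) \<le> bregman g (X (Suc n)) (X n)"
          using Cs_Suc[of "Suc n"] by (simp add: D_def X_def Y_def)
        also have "\<dots> \<le> d (Suc n) - d n"
          using proj[of "X (Suc n)" n] D(5)[of "Suc n"] Dmono[of n "Suc n"] by (auto simp: d_def)
        finally show ?thesis .
      qed
      thus "\<forall>\<^sub>F n in sequentially. bregman g (X (Suc n)) (Y n) \<le> d (Suc n) - d n" by simp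
      obtain l where "d \<longlonglongrightarrow> l" using \<open>Cauchy d\<close> Cauchy_convergent_iff convergent_def by blast
      from tendsto_diff[OF LIMSEQ_Suc[OF this] this] show "(\<lambda>n. d (Suc n) - d n) \<longlonglongrightarrow> 0" by simp
    qed
    hence "(\<lambda>n. norm (X (Suc n) - Y n)) \<longlonglongrightarrow> 0" using XC YK CK by (intro seq) auto
    hence "(\<lambda>n. Y n - X (Suc n)) \<longlonglongrightarrow> 0"
      by (simp add: tendsto_norm_zero_iff norm_minus_commute)
    thus ?thesis using LIMSEQ_Suc[OF q] Lim_transform by blast
  qed
  \<comment> \<open>D(p0, .) is continuous and X, Y have the same limit, so the gap vanishes even
    though D(p0, q) may be positive. The losses in \<open>key\<close> are nonnegative, so each is at
    most the gap.\<close>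
  define gap where "gap n = bregman g p0 (X n) - bregman g p0 (Y n)" for n
  have gap: "gap \<longlonglongrightarrow> 0"
  proof -
    have "(\<lambda>n. bregman g p0 (X n)) \<longlonglongrightarrow> bregman g p0 q" "(\<lambda>n. bregman g p0 (Y n)) \<longlonglongrightarrow> bregman g p0 q"
      using XC YK CB B(2) q Y qC by (auto intro!: continuous_on_tendsto_compose[OF contB(1)] always_eventually)
    from tendsto_diff[OF this] show ?thesis by (simp add: gap_def[abs_def])
  qed
  have small: "\<alpha>2 * bregman g (Z n) (X n) \<le> gap n" "\<alpha>3 * bregman g (V n) (X n) \<le> gap n"
      "c * \<rho> (norm (grad g (X n) - grad g (W n))) \<le> gap n"
      "0 \<le> bregman g (Z n) (X n)" "0 \<le> bregman g (V n) (X n)" for n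
  proof -
    show n1: "0 \<le> bregman g (Z n) (X n)" and n2: "0 \<le> bregman g (V n) (X n)"
      using ZC[of n] VC[of n] XC[of n] CK by (auto intro!: nonneg)
    have "bregman g p0 (Y n) \<le> bregman g p0 (X n) - \<alpha>2 * bregman g (Z n) (X n)
        - \<alpha>3 * bregman g (V n) (X n) - c * \<rho> (norm (grad g (X n) - grad g (W n)))"
      using key[of "Suc n" p0] XC[of n] p0 by (simp add: X_def Y_def Z_def V_def W_def)
    moreover have "0 \<le> c * \<rho> (norm (grad g (X n) - grad g (W n)))" using c \<rho>_nonneg by simp
    moreover have "0 \<le> \<alpha>2 * bregman g (Z n) (X n)" "0 \<le> \<alpha>3 * bregman g (V n) (X n)"
      using n1 n2 \<open>\<alpha>2 \<in> {0<..<1}\<close> \<open>\<alpha>3 \<in> {0<..<1}\<close> by auto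
    ultimately show "\<alpha>2 * bregman g (Z n) (X n) \<le> gap n" "\<alpha>3 * bregman g (V n) (X n) \<le> gap n"
      "c * \<rho> (norm (grad g (X n) - grad g (W n))) \<le> gap n" unfolding gap_def by linarith+
  qed
  have null: "f \<longlonglongrightarrow> 0" if "a > 0" "\<And>n. 0 \<le> f n" "\<And>n. a * f n \<le> gap n" for a :: real and f
  proof (rule tendsto_sandwich[OF _ _ tendsto_const])
    show "(\<lambda>n. gap n / a) \<longlonglongrightarrow> 0" using tendsto_divide[OF gap tendsto_const, of a] that(1) by simp
  qed (use that in \<open>auto simp: pos_le_divide_eq mult.commute\<close>)
  have Zq: "Z \<longlonglongrightarrow> q"
    using ZC CK small \<open>\<alpha>2 \<in> {0<..<1}\<close> by (intro to_q null[of \<alpha>2]) auto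
  have Vq: "V \<longlonglongrightarrow> q"
    using VC CK small \<open>\<alpha>3 \<in> {0<..<1}\<close> by (intro to_q null[of \<alpha>3]) auto
  have Wq: "W \<longlonglongrightarrow> q"
  proof -
    \<comment> \<open>The modulus \<rho> compares gradients, not points; uniform continuity of
      \<open>grad_conj g\<close> on \<open>Kstar\<close> carries the closeness back to W n and X
      n.\<close>
    have "(\<lambda>n. \<rho> (norm (grad g (X n) - grad g (W n)))) \<longlonglongrightarrow> 0"
      using c small \<rho>_nonneg by (intro null[of c]) auto
    hence "(\<lambda>n. norm (grad g (X n) - grad g (W n))) \<longlonglongrightarrow> 0"
      by (rule tendsto_0_of_mono_on[OF \<rho>(1,3), rotated 2]) auto
    hence "(\<lambda>n. dist (grad g (W n)) (grad g (X n))) \<longlonglongrightarrow> 0"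
      by (simp add: dist_norm norm_minus_commute)
    moreover have "grad g (W n) \<in> Kstar" "grad g (X n) \<in> Kstar" for n
      using gradK XC WC CK by auto
    ultimately have "(\<lambda>n. dist (grad_conj g (grad g (W n))) (grad_conj g (grad g (X n)))) \<longlonglongrightarrow> 0"
      using \<open>uniformly_continuous_on Kstar (grad_conj g)\<close>[unfolded uniformly_continuous_on_sequentially,
          rule_format, of "\<lambda>n. grad g (W n)" "\<lambda>n. grad g (X n)"] by blast
    moreover have "grad_conj g (grad g v) = v" if "v \<in> C" for v
      using that gradK CK CU \<open>Kstar \<subseteq> Ustar\<close> U Ustar by (intro grad_conj_grad) auto
    ultimately have "(\<lambda>n. norm (W n - X n)) \<longlonglongrightarrow> 0" using XC WC by (simp add: dist_norm)
    thus ?thesis using q by (metis tendsto_norm_zero_cancel Lim_transform)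
  qed
  \<comment> \<open>\<open>\<sigma> n - 1\<close> translates an index of the scheme into one of the
    shifted sequences; truncation at 0 does not affect the limit.\<close>
  have sub: "(\<lambda>n. R (\<sigma> n - 1)) \<longlonglongrightarrow> q" if "R \<longlonglongrightarrow> q" "strict_mono \<sigma>" for R and \<sigma> :: "nat \<Rightarrow> nat"
  proof -
    have "filterlim (\<lambda>n. \<sigma> n - 1) sequentially sequentially"
      using filterlim_compose[OF filterlim_minus_const_nat_at_top filterlim_subseq[OF that(2)]] .
    thus ?thesis by (rule filterlim_compose[OF that(1)])
  qed
  have contC: "continuous_on C (grad g)" using B(4) CB by (rule continuous_on_subset)
  have "q \<in> FJ C (T j)" if j: "j \<ge> 1" for j
  proof -
    \<comment> \<open>Along indices selecting j the mapping is the fixed T j, so its closedness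
      applies to V tending to q with images W tending to q.\<close>
    obtain \<sigma> :: "nat \<Rightarrow> nat" where \<sigma>: "strict_mono \<sigma>" "\<And>n. \<sigma> n \<ge> 1" "\<And>n. \<tau>T (\<sigma> n) = j"
      using inf_often_subseq[OF \<open>inf_often_index_map \<tau>T\<close> j] by blast
    have "W (\<sigma> n - 1) = duality_map_inv (T j (V (\<sigma> n - 1)))" for n
      using \<sigma>(2,3)[of n] by (simp add: W_def V_def ws_def)
    hence lim: "(\<lambda>n. duality_map_inv (T j (V (\<sigma> n - 1)))) \<longlonglongrightarrow> q" using sub[OF Wq \<sigma>(1)] by simp
    have "Jstar_closed C (T j)"
      using \<open>\<forall>j\<ge>1. Jstar_closed C (T j) \<and> gen_bregman_Jstar_nonexpansive g C (T j)\<close> j by blast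
    hence "q = duality_map_inv (T j q)"
      using VC qC sub[OF Vq \<sigma>(1)] lim by (rule Jstar_closedD)
    hence "T j q = duality_map q" using J by metis
    thus ?thesis using qC by (simp add: FJ_def)
  qed
  moreover have "q \<in> EP C (\<Theta> l)" if l: "l \<ge> 1" for l
  proof -
    obtain \<sigma> :: "nat \<Rightarrow> nat" where \<sigma>: "strict_mono \<sigma>" "\<And>n. \<sigma> n \<ge> 1" "\<And>n. \<tau>\<Theta> (\<sigma> n) = l"
      using inf_often_subseq[OF \<open>inf_often_index_map \<tau>\<Theta>\<close> l] by blast
    show ?thesis
    proof (rule EP_resolvent_limit[OF \<Theta>[OF l] \<open>convex C\<close> contC \<open>r0 > 0\<close>])
      show "Z (\<sigma> n - 1) \<in> EP_resolvent_set g C (\<Theta> l) (r (\<sigma> n)) (X (\<sigma> n - 1))" for n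
        using zs[OF \<sigma>(2)[of n]] XC[of "\<sigma> n - 1"] \<sigma>(2,3)[of n] by (simp add: Z_def X_def)
    qed (use \<sigma> \<open>\<forall>n\<ge>1. r n \<ge> r0\<close> XC qC sub[OF q] sub[OF Zq] in auto)
  qed
  moreover have "q \<in> VI C (A k)" if k: "k \<ge> 1" for k
  proof -
    obtain \<sigma> :: "nat \<Rightarrow> nat" where \<sigma>: "strict_mono \<sigma>" "\<And>n. \<sigma> n \<ge> 1" "\<And>n. \<tau>A (\<sigma> n) = k"
      using inf_often_subseq[OF \<open>inf_often_index_map \<tau>A\<close> k] by blast
    have "q \<in> EP C (A' k)"
    proof (rule EP_resolvent_limit[OF A'[OF k] \<open>convex C\<close> contC \<open>r0 > 0\<close>])
      show "V (\<sigma> n - 1) \<in> EP_resolvent_set g C (A' k) (r (\<sigma> n)) (X (\<sigma> n - 1))" for n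
        using us[OF \<sigma>(2)[of n]] XC[of "\<sigma> n - 1"] \<sigma>(2,3)[of n] by (simp add: V_def X_def)
    qed (use \<sigma> \<open>\<forall>n\<ge>1. r n \<ge> r0\<close> XC qC sub[OF q] sub[OF Vq] in auto)
    thus ?thesis by (simp add: VI_eq_EP A'_def[abs_def])
  qed
  ultimately have qS: "q \<in> S" using \<open>S = _\<close> by blast
  have "bregman_proj g S x = q"
  proof (rule bregman_proj_eqI)
    show "convex (\<Inter>n. D n)" using D(2) by (rule convex_INT)
    show "(\<Inter>n. D n) \<subseteq> interior (eff_dom g)" using D(3) CU U by blast
    show "u = v" if "u \<in> (\<Inter>n. D n)" "v \<in> (\<Inter>n. D n)" "bregman g u v = 0" for u v
      using that D(3) sepC by blast
    show "q \<in> (\<Inter>n. D n)" "S \<subseteq> (\<Inter>n. D n)" "q \<in> S" using qD D(4) qS by auto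
    fix w assume w: "w \<in> (\<Inter>n. D n)"
    have "(\<lambda>n. bregman g (X n) x) \<longlonglongrightarrow> bregman g q x"
      using XC CB q qC by (auto intro!: continuous_on_tendsto_compose[OF contB(2)] always_eventually)
    thus "bregman g q x \<le> bregman g w x"
      by (rule LIMSEQ_le_const2) (use min w in auto)
  qed
  thus "xs \<longlonglongrightarrow> bregman_proj g S x" using q by (simp add: X_def[abs_def] filterlim_sequentially_Suc)
qed

end
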